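(* Let $M_0$ be a closed connected manifold, $x_0\in M_0$ a fixed basepoint, and $G=\pi_1(M_0,x_0)$. Let $f\colon\mathcal{S}\to M_0$ be a weak solenoid with Cantor fiber $X=f^{-1}(x_0)$, and let $x\in X$ be a given basepoint. Suppose the monodromy action $(X,G,\Phi)$ on the fiber has finite discriminant group $\mathcal{D}_x$. Then there exists a finite-to-one covering map $p_0\colon M_0'\to M_0$ such that the pullback solenoid $f'\colon\mathcal{S}'\to M_0'$ is homogeneous.
   Context: A weak solenoid $\mathcal{S}$ is the inverse limit of an increasing sequence of non-trivial finite-to-one coverings $M_\ell\to M_0$ of a closed connected manifold $M_0$, i.e. of a tower $\cdots\to M_2\to M_1\to M_0$ of connected non-trivial finite coverings. The projection $f\colon\mathcal{S}\to M_0$ is a fiber bundle whose fiber $X=f^{-1}(x_0)$ is a Cantor set. Path lifting in the coverings $M_\ell\to M_0$ induces the monodromy action $\Phi\colon G\times X\to X$ of $G=\pi_1(M_0,x_0)$, which is minimal and equicontinuous. A point $x=(x_i)\in X$ determines the group chain $\{G_i\}_{i\ge0}$ where $G_i\subset G$ is the image of $\pi_1(M_i,x_i)$ and $G_0=G$. A space $\mathcal{S}$ is homogeneous if for all $u,v\in\mathcal{S}$ there is a homeomorphism $h\colon\mathcal{S}\to\mathcal{S}$ with $h(u)=v$. With $C_i=\bigcap_{g\in G}gG_ig^{-1}$, the discriminant group at $x$ is the profinite group $\mathcal{D}_x=\varprojlim\{G_{i+1}/C_{i+1}\to G_i/C_i\}$, with bonding maps induced by inclusion of cosets; up to isomorphism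 it does not depend on the choice of group chain presenting the action $(X,G,\Phi)$. Given a finite covering $p_0\colon M_0'\to M_0$ with $M_0'$ connected, corresponding to a finite-index subgroup $G_0'\subset G$, the pullback solenoid $f'\colon\mathcal{S}'\to M_0'$ is the inverse limit $\mathcal{S}'=\varprojlim\{M_i'\to M_{i-1}'\}$, where $M_i'$ is the covering of $M_0'$ (pulled back from $M_i\to M_0$) with fundamental group $G_i\cap G_0'$. *)

theory Defs
  imports "HOL-Analysis.Analysis" "HOL-Algebra.Coset" "HOL-Algebra.Product_Groups"
begin

section \<open>Closed manifolds and finite coverings\<close>

text \<open>Spaces are subsets of a topological type, carrying the subspace topology.\<close>

definition locally_euclidean :: "nat \<Rightarrow> 'a::topological_space set \<Rightarrow> bool" where
  "locally_euclidean n S \<longleftrightarrow>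
     (\<forall>x\<in>S. \<exists>U V. openin (top_of_set S) U \<and> x \<in> U \<and> openin (Euclidean_space n) V \<and>
        top_of_set U homeomorphic_space subtopology (Euclidean_space n) V)"

definition closed_connected_manifold :: "'a::topological_space set \<Rightarrow> bool" where
  "closed_connected_manifold S \<longleftrightarrow>
     S \<noteq> {} \<and> compact S \<and> connected S \<and>
     Hausdorff_space (top_of_set S) \<and> second_countable (top_of_set S) \<and>
     (\<exists>n. locally_euclidean n S)"

definition finite_covering ::
    "'b::topological_space set \<Rightarrow> ('b \<Rightarrow> 'a) \<Rightarrow> 'a::topological_space set \<Rightarrow> bool" where
  "finite_covering C p S \<longleftrightarrow>
     covering_space C p S \<and> (\<forall>y\<in>S. finite {z \<in> C. p z = y})"

definition homogeneous_space :: "'a::topological_space set \<Rightarrow> bool" where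
  "homogeneous_space S \<longleftrightarrow> (\<forall>u\<in>S. \<forall>v\<in>S. \<exists>h k. homeomorphism S S h k \<and> h u = v)"

section \<open>The fundamental group\<close>

definition path_class :: "'a::topological_space set \<Rightarrow> (real \<Rightarrow> 'a) \<Rightarrow> (real \<Rightarrow> 'a) set" where
  "path_class S q = {r. homotopic_paths S q r}"

definition based_loops :: "'a::topological_space set \<Rightarrow> 'a \<Rightarrow> (real \<Rightarrow> 'a) set" where
  "based_loops S a = {q. path q \<and> path_image q \<subseteq> S \<and> pathstart q = a \<and> pathfinish q = a}"

definition fundamental_group ::
    "'a::topological_space set \<Rightarrow> 'a \<Rightarrow> (real \<Rightarrow> 'a) set monoid" where
  "fundamental_group S a =
     \<lparr>carrier = path_class S ` based_loops S a,
      monoid.mult = (\<lambda>A B. \<Union>q\<in>A. \<Union>r\<in>B. path_class S (q +++ r)),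
      one = path_class S (\<lambda>_. a)\<rparr>"

text \<open>The action on path classes of a map \<open>f\<close> into \<open>T\<close>.\<close>

definition induced_map ::
    "'b::topological_space set \<Rightarrow> ('a \<Rightarrow> 'b) \<Rightarrow> (real \<Rightarrow> 'a::topological_space) set \<Rightarrow> (real \<Rightarrow> 'b) set" where
  "induced_map T f A = (\<Union>q\<in>A. path_class T (f \<circ> q))"

section \<open>Weak solenoids\<close>

definition inverse_limit :: "(nat \<Rightarrow> 'a set) \<Rightarrow> (nat \<Rightarrow> 'a \<Rightarrow> 'a) \<Rightarrow> (nat \<Rightarrow> 'a) set" where
  "inverse_limit M p = {s. \<forall>i. s i \<in> M i \<and> p i (s (Suc i)) = s i}"

text \<open>
  A tower \<open>\<dots> \<rightarrow> M 2 \<rightarrow> M 1 \<rightarrow> M 0\<close> with bonding maps \<open>p i : M (Suc i) \<rightarrow> M i\<close>.  Its weak solenoid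
  is \<open>inverse_limit M p\<close>, with the topology induced from the product topology on \<open>nat \<Rightarrow> 'a\<close>.
  Having all \<open>M i\<close> in one type is no restriction: any sequence of spaces embeds in its
  disjoint union.
\<close>

definition solenoid_tower :: "(nat \<Rightarrow> 'a::topological_space set) \<Rightarrow> (nat \<Rightarrow> 'a \<Rightarrow> 'a) \<Rightarrow> bool" where
  "solenoid_tower M p \<longleftrightarrow>
     closed_connected_manifold (M 0) \<and>
     (\<forall>i. connected (M (Suc i)) \<and> finite_covering (M (Suc i)) (p i) (M i) \<and>
          \<not> (\<exists>q. homeomorphism (M (Suc i)) (M i) (p i) q))"

definition solenoid_fiber ::
    "(nat \<Rightarrow> 'a set) \<Rightarrow> (nat \<Rightarrow> 'a \<Rightarrow> 'a) \<Rightarrow> 'a \<Rightarrow> (nat \<Rightarrow> 'a) set" where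
  "solenoid_fiber M p x0 = {s \<in> inverse_limit M p. s 0 = x0}"

text \<open>The composite covering \<open>M i \<rightarrow> M 0\<close>.\<close>

primrec tower_proj :: "(nat \<Rightarrow> 'a \<Rightarrow> 'a) \<Rightarrow> nat \<Rightarrow> 'a \<Rightarrow> 'a" where
  "tower_proj p 0 = id"
| "tower_proj p (Suc i) = tower_proj p i \<circ> p i"

text \<open>The group chain at \<open>x\<close>: the image of \<open>\<pi>\<^sub>1(M i, x i)\<close> in \<open>\<pi>\<^sub>1(M 0, x 0)\<close>.\<close>

definition group_chain ::
    "(nat \<Rightarrow> 'a::topological_space set) \<Rightarrow> (nat \<Rightarrow> 'a \<Rightarrow> 'a) \<Rightarrow> (nat \<Rightarrow> 'a) \<Rightarrow> nat \<Rightarrow> (real \<Rightarrow> 'a) set set" where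
  "group_chain M p x i =
     induced_map (M 0) (tower_proj p i) ` carrier (fundamental_group (M i) (x i))"

section \<open>The discriminant group of a group chain\<close>

definition normal_core :: "('g, 'm) monoid_scheme \<Rightarrow> 'g set \<Rightarrow> 'g set" where
  "normal_core G H = (\<Inter>g\<in>carrier G. g <#\<^bsub>G\<^esub> (H #>\<^bsub>G\<^esub> inv\<^bsub>G\<^esub> g))"

definition chain_quotient :: "('g, 'm) monoid_scheme \<Rightarrow> (nat \<Rightarrow> 'g set) \<Rightarrow> nat \<Rightarrow> 'g set monoid" where
  "chain_quotient G H i = (G\<lparr>carrier := H i\<rparr>) Mod (normal_core G (H i))"

text \<open>
  The inverse limit of the groups \<open>H i / C i\<close> with \<open>C i = normal_core G (H i)\<close>, as a subgroup of
  their product.  Multiplying a coset of \<open>C (Suc i)\<close> by \<open>C i\<close> yields the coset of \<open>C i\<close>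
  containing it.
\<close>

definition discriminant_group ::
    "('g, 'm) monoid_scheme \<Rightarrow> (nat \<Rightarrow> 'g set) \<Rightarrow> (nat \<Rightarrow> 'g set) monoid" where
  "discriminant_group G H =
     (product_group UNIV (chain_quotient G H))
       \<lparr>carrier := inverse_limit (\<lambda>i. carrier (chain_quotient G H i))
                                (\<lambda>i K. normal_core G (H i) <#>\<^bsub>G\<^esub> K)\<rparr>"

section \<open>The pullback solenoid\<close>

text \<open>
  For a pointed covering \<open>p0 : (N, z0) \<rightarrow> (M 0, x 0)\<close>, the component of \<open>(x i, z0)\<close> in the fiber
  product of \<open>M i\<close> and \<open>N\<close> over \<open>M 0\<close> is the covering of \<open>N\<close> pulled back from \<open>M i \<rightarrow> M 0\<close> whose
  fundamental group is the intersection of those of \<open>(M i, x i)\<close> and \<open>(N, z0)\<close>.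
\<close>

definition pullback_space ::
    "(nat \<Rightarrow> 'a::topological_space set) \<Rightarrow> (nat \<Rightarrow> 'a \<Rightarrow> 'a) \<Rightarrow> (nat \<Rightarrow> 'a) \<Rightarrow>
     'b::topological_space set \<Rightarrow> ('b \<Rightarrow> 'a) \<Rightarrow> 'b \<Rightarrow> nat \<Rightarrow> ('a \<times> 'b) set" where
  "pullback_space M p x N p0 z0 i =
     connected_component_set {(y, z). y \<in> M i \<and> z \<in> N \<and> tower_proj p i y = p0 z} (x i, z0)"

definition pullback_bond :: "(nat \<Rightarrow> 'a \<Rightarrow> 'a) \<Rightarrow> nat \<Rightarrow> 'a \<times> 'b \<Rightarrow> 'a \<times> 'b" where
  "pullback_bond p i = (\<lambda>(y, z). (p i y, z))"

definition pullback_solenoid ::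
    "(nat \<Rightarrow> 'a::topological_space set) \<Rightarrow> (nat \<Rightarrow> 'a \<Rightarrow> 'a) \<Rightarrow> (nat \<Rightarrow> 'a) \<Rightarrow>
     'b::topological_space set \<Rightarrow> ('b \<Rightarrow> 'a) \<Rightarrow> 'b \<Rightarrow> (nat \<Rightarrow> 'a \<times> 'b) set" where
  "pullback_solenoid M p x N p0 z0 = inverse_limit (pullback_space M p x N p0 z0) (pullback_bond p)"

end

theory Submission
  imports Defs
begin

text \<open>
  Write \<open>C i\<close> for the normal core of the member \<open>G i\<close> of the group chain. Since the discriminant is
  finite, some \<open>n\<close> is such that its only element trivial at level \<open>n\<close> is the identity; by compactness,
  for every \<open>i\<close> there is \<open>j \<ge> i\<close> with \<open>G j \<inter> C n \<subseteq> C i\<close>. Let \<open>M0'\<close> be the covering with group \<open>C n\<close>,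
  realised as a component of the fibre product of as many copies of \<open>M n\<close> as \<open>M n \<rightarrow> M 0\<close> has sheets.
  Then every loop that lifts to a loop at level \<open>j\<close> of the pullback tower lifts only to loops at level
  \<open>i\<close>. The lifting criterion turns this into maps from level \<open>j\<close> to level \<open>i\<close> over \<open>M 0\<close>, whose limit
  is a homeomorphism of the pullback solenoid carrying a given point of a fibre over \<open>M 0\<close> to any
  other. To move between fibres, push a point of \<open>M 0\<close> inside a coordinate ball by an isotopy and lift
  the isotopy to all levels; connectedness of \<open>M 0\<close> does the rest.
\<close>

section \<open>Coverings of topological spaces\<close>

text \<open>The levels of the pullback tower need not be regular coverings of \<open>M 0\<close>, so
  no single level supplies deck transformations moving its fibres transitively. Finiteness gives
  less: the group \<open>G j\<close> \<inter> \<open>C n\<close> of level \<open>j\<close> lies in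
  the normal core \<open>C i\<close> \<inter> \<open>C n\<close> of the group of level
  \<open>i\<close>. Symmetries therefore exist only as systems of maps from level \<open>j\<close>
  down to level \<open>i\<close>, and the inverse of their limit comes from exchanging the two given
  points, not from inverting the maps of the system. Passing to \<open>C n\<close> instead of
  \<open>G n\<close> makes the criterion independent of base points: since \<open>C n\<close> and
  \<open>C i\<close> are normal, a closed lift at any point of level \<open>j\<close> can be
  conjugated to the base point and the conclusion conjugated back. As \<open>C n\<close> is the
  stabiliser of a tuple listing the whole fibre of \<open>M n\<close> over \<open>x0\<close>, a
  fibre power is the natural place to realise it. These symmetries cover the identity of
  \<open>M 0\<close>, so they never leave a fibre; this is why isotopies are needed. An isotopy that
  starts at the identity has a canonical lift at each level, and canonical lifts commute with the
  bonding maps.\<close>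

text \<open>
  An evenly covered neighbourhood \<open>T\<close> is recorded by its family \<open>Q\<close> of local sections rather than by
  its sheets: composites, fibre products and restrictions of coverings then amount to operations on
  sections.
\<close>

definition even_sections ::
    "'c::topological_space set \<Rightarrow> ('c \<Rightarrow> 'b::topological_space) \<Rightarrow> 'b set \<Rightarrow> ('b \<Rightarrow> 'c) set \<Rightarrow> bool" where
  "even_sections C p T Q \<longleftrightarrow>
     (\<forall>q\<in>Q. continuous_on T q \<and> q ` T \<subseteq> C \<and> (\<forall>t\<in>T. p (q t) = t) \<and> openin (top_of_set C) (q ` T)) \<and>
     (\<forall>c\<in>C. p c \<in> T \<longrightarrow> (\<exists>q\<in>Q. q (p c) = c)) \<and>
     (\<forall>q\<in>Q. \<forall>r\<in>Q. \<forall>s\<in>T. \<forall>t\<in>T. q s = r s \<longrightarrow> q t = r t)"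

lemma even_sectionsD:
  assumes "even_sections C p T Q" "q \<in> Q"
  shows "continuous_on T q" "q ` T \<subseteq> C" "\<And>t. t \<in> T \<Longrightarrow> p (q t) = t" "\<And>t. t \<in> T \<Longrightarrow> q t \<in> C"
    "openin (top_of_set C) (q ` T)"
  using assms by (auto simp: even_sections_def)

lemma even_sectionsE:
  assumes "even_sections C p T Q" "c \<in> C" "p c \<in> T"
  obtains q where "q \<in> Q" "q (p c) = c"
  using assms by (auto simp: even_sections_def)

text \<open>This clause takes the place of disjointness of sheets: sections through a common point
  have the same sheet.\<close>

lemma even_sections_eq:
  assumes "even_sections C p T Q" "q \<in> Q" "r \<in> Q" "s \<in> T" "t \<in> T" "q s = r s"
  shows "q t = r t"
proof -
  have "\<forall>q\<in>Q. \<forall>r\<in>Q. \<forall>s\<in>T. \<forall>t\<in>T. q s = r s \<longrightarrow> q t = r t"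
    using assms(1) unfolding even_sections_def by (elim conjE)
  then show ?thesis using assms by blast
qed

text \<open>Allows several evenly covered neighbourhoods to be intersected, or one to be shrunk to a
  connected one, while keeping the same family of sections.\<close>

lemma even_sections_subset:
  assumes Q: "even_sections C p T Q" and p: "continuous_on C p" "p ` C \<subseteq> B"
    and "openin (top_of_set B) T'" "T' \<subseteq> T"
  shows "even_sections C p T' Q"
proof -
  have "openin (top_of_set C) (q ` T')" if "q \<in> Q" for q
  proof -
    have "q ` T' = q ` T \<inter> (C \<inter> p -` T')"
      using even_sectionsD[OF Q that] \<open>T' \<subseteq> T\<close> by force
    moreover have "openin (top_of_set C) (C \<inter> p -` T')"
      using p assms(4) by (simp add: continuous_openin_preimage image_subset_iff_funcset)
    ultimately show ?thesis
      using even_sectionsD(5)[OF Q that] by (simp add: openin_Int)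
  qed
  moreover have "continuous_on T' q" "q ` T' \<subseteq> C" "\<forall>t\<in>T'. p (q t) = t" if "q \<in> Q" for q
    using even_sectionsD[OF Q that] \<open>T' \<subseteq> T\<close> by (auto intro: continuous_on_subset)
  moreover have "\<forall>c\<in>C. p c \<in> T' \<longrightarrow> (\<exists>q\<in>Q. q (p c) = c)"
    using even_sectionsE[OF Q] \<open>T' \<subseteq> T\<close> by (metis subsetD)
  moreover have "\<forall>q\<in>Q. \<forall>r\<in>Q. \<forall>s\<in>T'. \<forall>t\<in>T'. q s = r s \<longrightarrow> q t = r t"
    using even_sections_eq[OF Q] \<open>T' \<subseteq> T\<close> by (meson subsetD)
  ultimately show ?thesis
    unfolding even_sections_def by simp
qed

section \<open>Sheets versus local sections\<close>

lemma covering_space_sections: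
  assumes "covering_space C p B" "x \<in> B"
  obtains T Q where "x \<in> T" "openin (top_of_set B) T" "even_sections C p T Q"
proof -
  obtain T v where T: "x \<in> T" "openin (top_of_set B) T"
    and v: "\<Union>v = C \<inter> p -` T" "\<forall>u\<in>v. openin (top_of_set C) u" "pairwise disjnt v"
      "\<forall>u\<in>v. \<exists>q. homeomorphism u T p q"
    using assms unfolding covering_space_def by metis
  obtain q where q: "\<And>u. u \<in> v \<Longrightarrow> homeomorphism u T p (q u)"
    using v(4) by metis
  have "even_sections C p T (q ` v)"
    unfolding even_sections_def
  proof (intro conjI ballI impI)
    fix f assume "f \<in> q ` v"
    then obtain u where u: "u \<in> v" "f = q u" by auto
    have h: "homeomorphism u T p f" using q u by simp
    show "continuous_on T f" "\<And>t. t \<in> T \<Longrightarrow> p (f t) = t"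
      using h by (auto simp: homeomorphism_def)
    have "f ` T = u" using h by (auto simp: homeomorphism_def)
    then show "f ` T \<subseteq> C" "openin (top_of_set C) (f ` T)"
      using u v by auto
  next
    fix c assume "c \<in> C" "p c \<in> T"
    then obtain u where "u \<in> v" "c \<in> u" using v(1) by blast
    then show "\<exists>f\<in>q ` v. f (p c) = c"
      using q homeomorphism_apply1 by blast
  next
    fix f g s t assume fg: "f \<in> q ` v" "g \<in> q ` v" and st: "s \<in> T" "t \<in> T" "f s = g s"
    then obtain u w where u: "u \<in> v" "f = q u" and w: "w \<in> v" "g = q w" by auto
    have "f s \<in> u" "g s \<in> w"
      using q[of u] q[of w] u w st by (auto simp: homeomorphism_def)
    then have "u = w" using v(3) u w st by (metis disjnt_iff pairwiseD)
    then show "f t = g t" using u w by simp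
  qed
  then show ?thesis using T that by blast
qed

lemma covering_space_sectionsI:
  assumes "continuous_on C p" "p ` C = B"
    and sec: "\<And>x. x \<in> B \<Longrightarrow> \<exists>T Q. x \<in> T \<and> openin (top_of_set B) T \<and> even_sections C p T Q"
  shows "covering_space C p B"
  unfolding covering_space_def
proof (intro conjI ballI)
  fix x assume "x \<in> B"
  then obtain T Q where T: "x \<in> T" "openin (top_of_set B) T" and Q: "even_sections C p T Q"
    using sec by blast
  define v where "v = (\<lambda>q. q ` T) ` Q"
  note D = even_sectionsD[OF Q]
  have "\<Union>v = C \<inter> p -` T"
  proof
    show "C \<inter> p -` T \<subseteq> \<Union>v"
      unfolding v_def by (auto, metis even_sectionsE[OF Q] imageI)
  qed (use D in \<open>force simp: v_def\<close>)
  moreover have "\<forall>u\<in>v. openin (top_of_set C) u"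
    unfolding v_def using D by blast
  moreover have "pairwise disjnt v"
  proof (rule pairwiseI)
    fix a b assume "a \<in> v" "b \<in> v" "a \<noteq> b"
    then obtain q r where qr: "q \<in> Q" "r \<in> Q" "a = q ` T" "b = r ` T"
      by (auto simp: v_def)
    show "disjnt a b"
    proof (rule ccontr)
      assume "\<not> disjnt a b"
      then obtain s t where "s \<in> T" "t \<in> T" "q s = r t" unfolding qr disjnt_iff by auto
      moreover have "s = t" using calculation D qr by metis
      ultimately have "q y = r y" if "y \<in> T" for y
        using even_sections_eq[OF Q qr(1,2)] that by blast
      then show False using \<open>a \<noteq> b\<close> qr by (metis image_cong)
    qed
  qed
  moreover have "\<forall>u\<in>v. \<exists>q. homeomorphism u T p q"
  proof
    fix u assume "u \<in> v"
    then obtain q where "q \<in> Q" "u = q ` T" by (auto simp: v_def)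
    then have "homeomorphism u T p q"
      unfolding homeomorphism_def using D[of q] assms(1)
      by (auto simp: image_image intro: continuous_on_subset)
    then show "\<exists>q. homeomorphism u T p q" by blast
  qed
  ultimately show "\<exists>T. x \<in> T \<and> openin (top_of_set B) T \<and>
      (\<exists>v. \<Union>v = C \<inter> p -` T \<and> (\<forall>u\<in>v. openin (top_of_set C) u) \<and> pairwise disjnt v \<and>
           (\<forall>u\<in>v. \<exists>q. homeomorphism u T p q))"
    using T by blast
qed (use assms in auto)

section \<open>Unique lifting and homotopy lifting\<close>

text \<open>Near any point, \<open>g\<close> and \<open>h\<close> are two local sections applied to
  the same base point, and two sections agree everywhere or nowhere. So the truth value of
  \<open>g z = h z\<close> is locally constant on the connected set \<open>X\<close>.\<close>

lemma covering_space_lift_unique_top: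
  fixes C :: "'c::topological_space set" and B :: "'b::topological_space set"
  assumes cov: "covering_space C p B" and "connected X"
    and g: "continuous_on X g" "g ` X \<subseteq> C" and h: "continuous_on X h" "h ` X \<subseteq> C"
    and eq: "\<And>x. x \<in> X \<Longrightarrow> p (g x) = p (h x)"
    and "a \<in> X" "g a = h a" "x \<in> X"
  shows "g x = h x"
proof -
  have pc: "continuous_on C p" "p ` C = B" using cov by (auto simp: covering_space_def)
  have "\<exists>T. openin (top_of_set X) T \<and> y \<in> T \<and> (\<forall>z\<in>T. (g z = h z) = (g y = h y))"
    if "y \<in> X" for y
  proof -
    have gh: "g y \<in> C" "h y \<in> C" "p (h y) = p (g y)" using that g(2) h(2) eq by auto
    then have "p (g y) \<in> B" using pc(2) by blast
    then obtain T Q where T: "p (g y) \<in> T" "openin (top_of_set B) T" and Q: "even_sections C p T Q"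
      using covering_space_sections[OF cov] by metis
    obtain q where q: "q \<in> Q" "q (p (g y)) = g y"
      using even_sectionsE[OF Q gh(1) T(1)] by blast
    obtain r where r: "r \<in> Q" "r (p (g y)) = h y"
      using even_sectionsE[OF Q gh(2)] gh(3) T(1) by metis
    let ?W = "(X \<inter> g -` (q ` T)) \<inter> (X \<inter> h -` (r ` T))"
    have "openin (top_of_set X) ?W"
      by (intro openin_Int continuous_openin_preimage[of _ _ C])
        (use g h even_sectionsD[OF Q q(1)] even_sectionsD[OF Q r(1)] in auto)
    moreover have "y \<in> ?W" using that q r T by (auto simp: image_iff intro: bexI[of _ "p (g y)"])
    moreover have "(g z = h z) = (g y = h y)" if z: "z \<in> ?W" for z
    proof -
      have "g z = q (p (g z))" "h z = r (p (g z))" "p (g z) \<in> T"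
        using z eq[of z] even_sectionsD[OF Q q(1)] even_sectionsD[OF Q r(1)] by auto
      then show ?thesis
        using even_sections_eq[OF Q q(1) r(1)] T(1) q(2) r(2) by metis
    qed
    ultimately show ?thesis by blast
  qed
  then have "(g x = h x) = (g a = h a)"
    by (intro connected_equivalence_relation[OF \<open>connected X\<close> \<open>x \<in> X\<close> \<open>a \<in> X\<close>,
          of "\<lambda>y z. (g y = h y) = (g z = h z)"]) metis+
  then show ?thesis using \<open>g a = h a\<close> by simp
qed

lemma continuous_on_openin_cover:
  assumes "\<And>x. x \<in> X \<Longrightarrow> \<exists>U. openin (top_of_set X) U \<and> x \<in> U \<and> continuous_on U f"
  shows "continuous_on X f"
  unfolding continuous_on_topological
proof (intro ballI allI impI)
  fix x W assume x: "x \<in> X" and W: "open W" "f x \<in> W"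
  obtain U where U: "openin (top_of_set X) U" "x \<in> U" "continuous_on U f"
    using assms x by blast
  obtain A1 where A1: "open A1" "U = X \<inter> A1" using U(1) openin_open by metis
  obtain A2 where A2: "open A2" "x \<in> A2" "\<forall>y\<in>U. y \<in> A2 \<longrightarrow> f y \<in> W"
    using U(2,3) W unfolding continuous_on_topological by metis
  show "\<exists>A. open A \<and> x \<in> A \<and> (\<forall>y\<in>X. y \<in> A \<longrightarrow> f y \<in> W)"
    using A1 A2 U(2) by (intro exI[of _ "A1 \<inter> A2"]) auto
qed

lemma covering_space_lift_homotopy_top:
  fixes C :: "'c::topological_space set" and B :: "'b::topological_space set"
    and U :: "'a::topological_space set"
  assumes cov: "covering_space C p B"
    and h: "continuous_on ({0..1} \<times> U) h" "h ` ({0..1::real} \<times> U) \<subseteq> B"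
    and f: "continuous_on U f" "f ` U \<subseteq> C" "\<And>y. y \<in> U \<Longrightarrow> h (0, y) = p (f y)"
  obtains k where "continuous_on ({0..1} \<times> U) k" "k ` ({0..1} \<times> U) \<subseteq> C"
    "\<And>y. y \<in> U \<Longrightarrow> k (0, y) = f y" "\<And>z. z \<in> {0..1} \<times> U \<Longrightarrow> p (k z) = h z"
proof -
  have local_lift: "\<exists>V k. openin (top_of_set U) V \<and> y \<in> V \<and> continuous_on ({0..1} \<times> V) k \<and>
      k ` ({0..1} \<times> V) \<subseteq> C \<and> (\<forall>z\<in>V. k (0, z) = f z) \<and> (\<forall>w\<in>{0..1} \<times> V. p (k w) = h w)"
    if y: "y \<in> U" for y
  proof -
    \<comment> \<open>\<open>I\<close> is initial data at time \<open>a\<close> near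
      \<open>y\<close>; \<open>L\<close> says that it extends to a lift up to time \<open>b\<close>
      over a smaller neighbourhood. The property \<open>P\<close> that this is always possible
      concatenates and holds on short intervals, as \<open>Bolzano\<close> requires.\<close>
    define L where "L a b V f V' k \<longleftrightarrow> openin (top_of_set U) V' \<and> y \<in> V' \<and> V' \<subseteq> V \<and>
        continuous_on ({a..b} \<times> V') k \<and> k ` ({a..b} \<times> V') \<subseteq> C \<and>
        (\<forall>z\<in>V'. k (a, z) = f z) \<and> (\<forall>w\<in>{a..b} \<times> V'. p (k w) = h w)"
      for a b :: real and V f V' k
    define I where "I a V f \<longleftrightarrow> openin (top_of_set U) V \<and> y \<in> V \<and> continuous_on V f \<and>
        f ` V \<subseteq> C \<and> (\<forall>z\<in>V. p (f z) = h (a, z))" for a :: real and V f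
    define P where "P a b \<longleftrightarrow> 0 \<le> a \<longrightarrow> b \<le> 1 \<longrightarrow> (\<forall>V f. I a V f \<longrightarrow> (\<exists>V' k. L a b V f V' k))"
      for a b :: real
    have "P 0 1"
    proof (rule Bolzano)
      fix a b c assume trans: "P a b" "P b c" and "a \<le> b" "b \<le> c"
      show "P a c" unfolding P_def
      proof (intro impI allI)
        fix V f assume ac: "0 \<le> a" "c \<le> 1" and I: "I a V f"
        obtain V1 k1 where 1: "L a b V f V1 k1" using trans ac I \<open>a \<le> b\<close> \<open>b \<le> c\<close> unfolding P_def by (meson order_trans)
        have "I b V1 (\<lambda>z. k1 (b, z))"
          using 1 \<open>a \<le> b\<close> unfolding L_def I_def
          by (auto intro!: continuous_intros continuous_on_compose2[of "{a..b} \<times> V1" k1])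
        then obtain V2 k2 where 2: "L b c V1 (\<lambda>z. k1 (b, z)) V2 k2"
          using trans ac \<open>a \<le> b\<close> unfolding P_def by (meson order_trans)
        let ?k = "\<lambda>w. if fst w \<le> b then k1 w else k2 w"
        have "continuous_on ({a..c} \<times> V2) ?k"
        proof (rule continuous_on_cases_le)
          show "continuous_on {t \<in> {a..c} \<times> V2. fst t \<le> b} k1"
            using 1 2 unfolding L_def
            by (auto intro: continuous_on_subset[of "{a..b} \<times> V1"])
          show "continuous_on {t \<in> {a..c} \<times> V2. b \<le> fst t} k2"
            using 2 unfolding L_def
            by (auto intro: continuous_on_subset[of "{b..c} \<times> V2"])
          show "continuous_on ({a..c} \<times> V2) fst" by (intro continuous_intros)
          show "k1 t = k2 t" if "t \<in> {a..c} \<times> V2" "fst t = b" for t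
            using 2 that unfolding L_def by (cases t) auto
        qed
        moreover have "?k ` ({a..c} \<times> V2) \<subseteq> C"
          using 1 2 unfolding L_def by (auto simp: image_subset_iff)
        moreover have "\<forall>w\<in>{a..c} \<times> V2. p (?k w) = h w"
          using 1 2 unfolding L_def by auto
        ultimately have "L a c V f V2 ?k"
          using 1 2 \<open>a \<le> b\<close> unfolding L_def by auto
        then show "\<exists>V' k. L a c V f V' k" by blast
      qed
    next
      fix x :: real assume "0 \<le> x" "x \<le> 1"
      then have x01: "x \<in> {0..1}" by simp
      then have "h (x, y) \<in> B" using h(2) y by blast
      then obtain T Q where T: "h (x, y) \<in> T" "openin (top_of_set B) T" and Q: "even_sections C p T Q"
        using covering_space_sections[OF cov] by metis
      have "openin (top_of_set ({0..1} \<times> U)) (({0..1} \<times> U) \<inter> h -` T)"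
        using h T(2) by (simp add: continuous_openin_preimage image_subset_iff_funcset)
      then obtain O' where O': "open O'" "({0..1} \<times> U) \<inter> h -` T = ({0..1} \<times> U) \<inter> O'"
        using openin_open by metis
      then have "(x, y) \<in> O'" using x01 y T(1) by blast
      then obtain A V0 where A: "open A" "open V0" "x \<in> A" "y \<in> V0" "A \<times> V0 \<subseteq> O'"
        using O'(1) by (metis open_prod_elim mem_Sigma_iff)
      obtain d where d: "d > 0" "ball x d \<subseteq> A" using A openE by metis
      have "P a b" if ab: "a \<le> x" "x \<le> b" "b - a < d" for a b
        unfolding P_def
      proof (intro impI allI)
        fix V f assume a0: "0 \<le> a" and b1: "b \<le> 1" and I: "I a V f"
        have hT: "h (t, z) \<in> T" if "t \<in> {a..b}" "z \<in> U" "z \<in> V0" for t z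
        proof -
          have "t \<in> ball x d" using that ab by (auto simp: dist_real_def)
          then have "(t, z) \<in> O'" using d A that by blast
          then show ?thesis using O'(2) that a0 b1 by auto
        qed
        have VU: "V \<subseteq> U" using I unfolding I_def by (auto dest: openin_imp_subset)
        have fy: "f y \<in> C" "p (f y) = h (a, y)" using I unfolding I_def by auto
        moreover have "h (a, y) \<in> T" using hT y A ab by auto
        ultimately obtain q where q: "q \<in> Q" "q (h (a, y)) = f y"
          using even_sectionsE[OF Q] by metis
        note D = even_sectionsD[OF Q q(1)]
        \<comment> \<open>Keep only points whose initial value lies on the same sheet as
          \<open>f y\<close>, so that the single section \<open>q\<close> continues \<open>f\<close>
          over all of \<open>V'\<close>.\<close>
        define V' where "V' = (V \<inter> f -` (q ` T)) \<inter> (U \<inter> V0)"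
        have "openin (top_of_set V) (V \<inter> f -` (q ` T))"
          using I D(5) unfolding I_def by (intro continuous_openin_preimage[of V f C]) auto
        then have "openin (top_of_set U) (V \<inter> f -` (q ` T))"
          using I unfolding I_def by (blast intro: openin_trans)
        then have "openin (top_of_set U) V'"
          unfolding V'_def using A(2) by (simp add: openin_Int openin_open_Int)
        moreover have "y \<in> V'"
          unfolding V'_def using q I A \<open>h (a, y) \<in> T\<close> VU unfolding I_def by (auto simp: image_iff) metis
        moreover have "V' \<subseteq> V" unfolding V'_def by blast
        moreover have hV': "h w \<in> T" if "w \<in> {a..b} \<times> V'" for w
          using that hT unfolding V'_def by auto
        then have "continuous_on ({a..b} \<times> V') (q \<circ> h)"
          by (intro continuous_on_compose continuous_on_subset[OF h(1)] continuous_on_subset[OF D(1)])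
            (use a0 b1 V'_def in auto)
        moreover have "(q \<circ> h) ` ({a..b} \<times> V') \<subseteq> C" using hV' D(4) by auto
        moreover have "\<forall>w\<in>{a..b} \<times> V'. p ((q \<circ> h) w) = h w" using hV' D(3) by auto
        moreover have "\<forall>z\<in>V'. (q \<circ> h) (a, z) = f z"
        proof
          fix z assume "z \<in> V'"
          then obtain t where "z \<in> V" "t \<in> T" "f z = q t" unfolding V'_def by auto
          then show "(q \<circ> h) (a, z) = f z" using D(3) I unfolding I_def by auto
        qed
        ultimately have "L a b V f V' (q \<circ> h)" unfolding L_def by blast
        then show "\<exists>V' k. L a b V f V' k" by blast
      qed
      then show "\<exists>d>0. \<forall>a b. a \<le> x \<and> x \<le> b \<and> b - a < d \<longrightarrow> P a b" using d(1) by blast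
    qed simp
    moreover have "I 0 U f" using f y unfolding I_def by auto
    ultimately obtain V k where "L 0 1 U f V k" unfolding P_def by blast
    then show ?thesis unfolding L_def by blast
  qed
  then obtain V K where VK: "\<And>y. y \<in> U \<Longrightarrow> openin (top_of_set U) (V y) \<and> y \<in> V y \<and>
      continuous_on ({0..1} \<times> V y) (K y) \<and> K y ` ({0..1} \<times> V y) \<subseteq> C \<and>
      (\<forall>z\<in>V y. K y (0, z) = f z) \<and> (\<forall>w\<in>{0..1} \<times> V y. p (K y w) = h w)"
    by metis
  \<comment> \<open>At each \<open>z\<close> use the lift belonging to \<open>z\<close> itself;
    \<open>kK\<close> shows that any other local lift over \<open>z\<close> gives the same value,
    and continuity is inherited from it.\<close>
  define k where "k w = K (snd w) w" for w
  have kK: "k (t, z) = K y (t, z)" if "y \<in> U" "z \<in> V y" "t \<in> {0..1}" for t y z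
  proof -
    have z: "z \<in> U" using VK[OF that(1)] that(2) openin_imp_subset by blast
    have slice: "continuous_on {0..1} (\<lambda>s. K x (s, z)) \<and> (\<lambda>s. K x (s, z)) ` {0..1} \<subseteq> C \<and>
        K x (0, z) = f z \<and> (\<forall>s\<in>{0..1}. p (K x (s, z)) = h (s, z))"
      if "x \<in> U" "z \<in> V x" for x
    proof (intro conjI ballI)
      show "continuous_on {0..1} (\<lambda>s. K x (s, z))"
        using VK[OF \<open>x \<in> U\<close>] \<open>z \<in> V x\<close>
        by (intro continuous_on_compose2[of "{0..1} \<times> V x" "K x" _ "\<lambda>s. (s, z)"] continuous_intros) auto
    qed (use VK[OF \<open>x \<in> U\<close>] \<open>z \<in> V x\<close> in blast)+
    have "z \<in> V z" using VK[OF z] by blast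
    note zz = slice[OF z this] and yz = slice[OF \<open>y \<in> U\<close> \<open>z \<in> V y\<close>]
    have "K z (t, z) = K y (t, z)"
      by (rule covering_space_lift_unique_top[OF cov connected_Icc, of 0 1 "\<lambda>s. K z (s, z)" "\<lambda>s. K y (s, z)" 0])
        (use zz yz that in simp_all)
    then show ?thesis by (simp add: k_def)
  qed
  have "continuous_on ({0..1} \<times> U) k"
  proof (rule continuous_on_openin_cover)
    fix w assume w: "w \<in> {0..1::real} \<times> U"
    then obtain t y where ty: "w = (t, y)" "t \<in> {0..1}" "y \<in> U" by auto
    have "openin (top_of_set ({0..1} \<times> U)) ({0..1} \<times> V y)"
      using VK[OF ty(3)] by (simp add: openin_Times)
    moreover have "continuous_on ({0..1} \<times> V y) k"
      using VK[OF ty(3)] kK[OF ty(3)] by (subst continuous_on_cong[OF refl, of _ _ "K y"]) auto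
    ultimately show "\<exists>W. openin (top_of_set ({0..1} \<times> U)) W \<and> w \<in> W \<and> continuous_on W k"
      using ty VK[OF ty(3)] by (intro exI[of _ "{0..1} \<times> V y"]) auto
  qed
  then show ?thesis
    using that[of k] VK by (force simp: k_def)
qed

section \<open>Lifts of paths and maps\<close>

text \<open>
  \<open>path_lift C p g c e\<close>: some path in \<open>C\<close> from \<open>c\<close> to \<open>e\<close> lies over \<open>g\<close>. For a covering it is the
  monodromy of \<open>g\<close>, as a partial function from \<open>c\<close> to \<open>e\<close>.
\<close>

definition path_lift ::
    "'c::topological_space set \<Rightarrow> ('c \<Rightarrow> 'b::topological_space) \<Rightarrow> (real \<Rightarrow> 'b) \<Rightarrow> 'c \<Rightarrow> 'c \<Rightarrow> bool" where
  "path_lift C p g c e \<longleftrightarrow>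
     (\<exists>r. path r \<and> path_image r \<subseteq> C \<and> pathstart r = c \<and> pathfinish r = e \<and> (\<forall>t\<in>{0..1}. p (r t) = g t))"

lemma path_liftI:
  assumes "path r" "path_image r \<subseteq> C" "pathstart r = c" "pathfinish r = e" "\<And>t. t \<in> {0..1} \<Longrightarrow> p (r t) = g t"
  shows "path_lift C p g c e"
  using assms unfolding path_lift_def by blast

lemma path_liftE:
  assumes "path_lift C p g c e"
  obtains r where "path r" "path_image r \<subseteq> C" "pathstart r = c" "pathfinish r = e"
    "\<And>t. t \<in> {0..1} \<Longrightarrow> p (r t) = g t"
  using assms unfolding path_lift_def by blast

lemma path_lift_endpoints:
  assumes "path_lift C p g c e"
  shows "c \<in> C" "e \<in> C" "p c = pathstart g" "p e = pathfinish g"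
proof -
  obtain r where r: "path r" "path_image r \<subseteq> C" "pathstart r = c" "pathfinish r = e"
    "\<And>t. t \<in> {0..1} \<Longrightarrow> p (r t) = g t"
    using assms by (rule path_liftE) blast
  show "c \<in> C" "e \<in> C"
    using r(2,3,4) pathstart_in_path_image[of r] pathfinish_in_path_image[of r] by auto
  show "p c = pathstart g" "p e = pathfinish g"
    using r(3,4) r(5)[of 0] r(5)[of 1] by (auto simp: pathstart_def pathfinish_def)
qed

lemma path_lift_path:
  assumes "path_lift C p g c e" "continuous_on C p" "p ` C \<subseteq> B"
  shows "path g" "path_image g \<subseteq> B"
proof -
  obtain r where r: "path r" "path_image r \<subseteq> C" "\<And>t. t \<in> {0..1} \<Longrightarrow> p (r t) = g t"
    using assms(1) by (rule path_liftE) blast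
  have "path (p \<circ> r)"
    using r assms(2) by (intro path_continuous_image) (auto intro: continuous_on_subset)
  then show "path g"
    using r(3) unfolding path_def by (subst continuous_on_cong[OF refl, of _ _ "p \<circ> r"]) auto
  have "path_image g = p ` path_image r"
    using r(3) unfolding path_image_def image_image by force
  then show "path_image g \<subseteq> B" using r(2) assms(3) by blast
qed

lemma path_lift_self:
  assumes "path r" "path_image r \<subseteq> C"
  shows "path_lift C p (p \<circ> r) (pathstart r) (pathfinish r)"
  using assms by (intro path_liftI[of r]) auto

lemma path_lift_const:
  assumes "c \<in> C"
  shows "path_lift C p (\<lambda>_. p c) c c"
  using assms by (intro path_liftI[of "\<lambda>_. c"]) (auto simp: path_def path_image_def pathstart_def pathfinish_def)

lemma path_lift_join:
  assumes "path_lift C p g c d" "path_lift C p h d e"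
  shows "path_lift C p (g +++ h) c e"
proof -
  obtain r where r: "path r" "path_image r \<subseteq> C" "pathstart r = c" "pathfinish r = d"
    "\<And>t. t \<in> {0..1} \<Longrightarrow> p (r t) = g t"
    using assms(1) by (rule path_liftE) blast
  obtain s where s: "path s" "path_image s \<subseteq> C" "pathstart s = d" "pathfinish s = e"
    "\<And>t. t \<in> {0..1} \<Longrightarrow> p (s t) = h t"
    using assms(2) by (rule path_liftE) blast
  show ?thesis
  proof (rule path_liftI[of "r +++ s"])
    show "path_image (r +++ s) \<subseteq> C" using r s by (simp add: path_image_join)
    show "p ((r +++ s) t) = (g +++ h) t" if "t \<in> {0..1}" for t
      using that r(5)[of "2 * t"] s(5)[of "2 * t - 1"] by (auto simp: joinpaths_def)
  qed (use r s in auto)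
qed

lemma path_lift_reverse:
  assumes "path_lift C p g c e"
  shows "path_lift C p (reversepath g) e c"
proof -
  obtain r where r: "path r" "path_image r \<subseteq> C" "pathstart r = c" "pathfinish r = e"
    "\<And>t. t \<in> {0..1} \<Longrightarrow> p (r t) = g t"
    using assms by (rule path_liftE) blast
  show ?thesis
    by (rule path_liftI[of "reversepath r"]) (use r in \<open>auto simp: reversepath_def pathstart_def pathfinish_def path_image_def path_def intro!: continuous_intros continuous_on_compose2[of "{0..1}" r]\<close>)
qed

lemma path_lift_map:
  assumes "path_lift C p g c e" "continuous_on C f" "f ` C \<subseteq> C'" "\<And>y. y \<in> C \<Longrightarrow> p' (f y) = p y"
  shows "path_lift C' p' g (f c) (f e)"
proof -
  obtain r where r: "path r" "path_image r \<subseteq> C" "pathstart r = c" "pathfinish r = e"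
    "\<And>t. t \<in> {0..1} \<Longrightarrow> p (r t) = g t"
    using assms(1) by (rule path_liftE) blast
  show ?thesis
  proof (rule path_liftI[of "f \<circ> r"])
    show "path (f \<circ> r)"
      using r assms(2) by (intro path_continuous_image) (auto intro: continuous_on_subset)
    show "path_image (f \<circ> r) \<subseteq> C'" using r(2) assms(3) by (auto simp: path_image_def)
    show "p' ((f \<circ> r) t) = g t" if "t \<in> {0..1}" for t
      using r(2,5) that assms(4) by (auto simp: path_image_def image_subset_iff)
  qed (use r in \<open>auto simp: pathstart_def pathfinish_def\<close>)
qed

section \<open>Existence, uniqueness and homotopy invariance of path lifts\<close>

lemma path_lift_exists:
  assumes cov: "covering_space C p B" and g: "path g" "path_image g \<subseteq> B" and c: "c \<in> C" "p c = pathstart g"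
  obtains e where "path_lift C p g c e"
proof -
  \<comment> \<open>A path is a homotopy whose parameter space is one point, here the real number
    \<open>0\<close>.\<close>
  obtain k where k: "continuous_on ({0..1} \<times> {0::real}) k" "k ` ({0..1} \<times> {0}) \<subseteq> C"
    "\<And>y. y \<in> {0} \<Longrightarrow> k (0, y) = c" "\<And>z. z \<in> {0..1} \<times> {0} \<Longrightarrow> p (k z) = (g \<circ> fst) z"
  proof (rule covering_space_lift_homotopy_top[OF cov, of "{0::real}" "g \<circ> fst" "\<lambda>_. c"])
    show "continuous_on ({0..1} \<times> {0}) (g \<circ> fst)"
      using g by (intro continuous_on_compose continuous_intros) (auto simp: path_def)
  qed (use g c in \<open>auto simp: path_image_def pathstart_def\<close>)
  show ?thesis
  proof (rule that, rule path_liftI[of "\<lambda>t. k (t, 0)"])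
    show "path (\<lambda>t. k (t, 0))"
      unfolding path_def
      by (rule continuous_on_compose2[OF k(1)]) (auto intro!: continuous_intros)
  qed (use k in \<open>auto simp: path_image_def pathstart_def pathfinish_def\<close>)
qed

lemma path_lift_unique:
  assumes cov: "covering_space C p B" and "path_lift C p g c e" "path_lift C p g c e'"
  shows "e = e'"
proof -
  obtain r where r: "path r" "path_image r \<subseteq> C" "pathstart r = c" "pathfinish r = e"
    "\<And>t. t \<in> {0..1} \<Longrightarrow> p (r t) = g t"
    using assms(2) by (rule path_liftE) blast
  obtain s where s: "path s" "path_image s \<subseteq> C" "pathstart s = c" "pathfinish s = e'"
    "\<And>t. t \<in> {0..1} \<Longrightarrow> p (s t) = g t"
    using assms(3) by (rule path_liftE) blast
  have "r 1 = s 1"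
    by (rule covering_space_lift_unique_top[OF cov connected_Icc, of 0 1 r s 0])
      (use r s in \<open>auto simp: path_def path_image_def pathstart_def\<close>)
  then show ?thesis using r s by (simp add: pathfinish_def)
qed

text \<open>Lift \<open>g\<close> and then \<open>h\<close>; uniqueness identifies the result with
  the given lift, whose midpoint is therefore \<open>d\<close>.\<close>

lemma path_lift_joinE:
  assumes cov: "covering_space C p B" and gh: "path_lift C p (g +++ h) c e"
    and "path g" "path_image g \<subseteq> B" "path h" "path_image h \<subseteq> B" "pathfinish g = pathstart h"
  obtains d where "path_lift C p g c d" "path_lift C p h d e"
proof -
  have "c \<in> C" "p c = pathstart g" using path_lift_endpoints[OF gh] by auto
  then obtain d where d: "path_lift C p g c d" using path_lift_exists[OF cov] assms by metis
  then obtain e' where e': "path_lift C p h d e'"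
    using path_lift_exists[OF cov] assms path_lift_endpoints[OF d] by metis
  then have "e' = e" using path_lift_unique[OF cov gh path_lift_join[OF d e']] by simp
  then show ?thesis using that d e' by blast
qed

lemma path_lift_homotopic:
  assumes cov: "covering_space C p B" and hom: "homotopic_paths B g g'" and "path_lift C p g c e"
  shows "path_lift C p g' c e"
proof -
  obtain r where r: "path r" "path_image r \<subseteq> C" "pathstart r = c" "pathfinish r = e"
    "\<And>t. t \<in> {0..1} \<Longrightarrow> p (r t) = g t"
    using assms(3) by (rule path_liftE) blast
  obtain h where h: "continuous_on ({0..1} \<times> {0..1}) h" "h ` ({0..1} \<times> {0..1}) \<subseteq> B"
    "\<And>x. x \<in> {0..1} \<Longrightarrow> h (0, x) = g x" "\<And>x. x \<in> {0..1} \<Longrightarrow> h (1, x) = g' x"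
    "\<And>t. t \<in> {0..1::real} \<Longrightarrow> h (t, 0) = g 0 \<and> h (t, 1) = g 1"
    using hom unfolding homotopic_paths by (auto simp: pathstart_def pathfinish_def image_subset_iff_funcset)
  obtain k where k: "continuous_on ({0..1} \<times> {0..1::real}) k" "k ` ({0..1} \<times> {0..1}) \<subseteq> C"
    "\<And>y. y \<in> {0..1} \<Longrightarrow> k (0, y) = r y" "\<And>z. z \<in> {0..1} \<times> {0..1} \<Longrightarrow> p (k z) = h z"
    by (rule covering_space_lift_homotopy_top[OF cov h(1,2), of r])
      (use r h(3) in \<open>auto simp: path_def path_image_def\<close>)
  \<comment> \<open>The homotopy is stationary over the two end points, so there \<open>k\<close>
    and the constant path are lifts of the same constant path.\<close>
  have edge: "k (1, y) = r y" if y: "y = 0 \<or> y = 1" for y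
  proof -
    have "continuous_on {0..1} (\<lambda>t. k (t, y))"
      by (rule continuous_on_compose2[OF k(1)]) (use y in \<open>auto intro!: continuous_intros\<close>)
    moreover have "(\<lambda>t. k (t, y)) ` {0..1} \<subseteq> C" "(\<lambda>t. r y) ` {0..1::real} \<subseteq> C"
      using y k(2) r(2) by (auto simp: path_image_def)
    moreover have "p (k (t, y)) = p (r y)" if "t \<in> {0..1}" for t
      using y k(4)[of "(t, y)"] h(5)[OF that] r(5)[of y] that by auto
    moreover have "k (0, y) = r y" using k(3)[of y] y by auto
    ultimately show ?thesis
      by - (rule covering_space_lift_unique_top[OF cov connected_Icc, of 0 1 "\<lambda>t. k (t, y)" "\<lambda>t. r y" 0],
          auto)
  qed
  show ?thesis
  proof (rule path_liftI[of "\<lambda>x. k (1, x)"])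
    show "path (\<lambda>x. k (1, x))"
      unfolding path_def
      by (rule continuous_on_compose2[OF k(1)]) (auto intro!: continuous_intros)
    show "pathstart (\<lambda>x. k (1, x)) = c" "pathfinish (\<lambda>x. k (1, x)) = e"
      using edge r by (auto simp: pathstart_def pathfinish_def)
    show "path_image (\<lambda>x. k (1, x)) \<subseteq> C" using k(2) by (auto simp: path_image_def)
    show "p (k (1, t)) = g' t" if "t \<in> {0..1}" for t using k(4) h(4) that by simp
  qed
qed

text \<open>The lifting criterion, with inclusion of fundamental groups replaced by a condition on
  closed lifts. The value \<open>f y\<close> is the end of the lift from \<open>v\<close> of the
  image of any path from \<open>u\<close> to \<open>y\<close>.\<close>

lemma covering_space_lift_map:
  fixes C :: "'c::topological_space set" and B :: "'b::topological_space set"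
    and P :: "'d::topological_space set"
  assumes cov: "covering_space C p B"
    and P: "path_connected P" "locally path_connected P"
    and pi: "continuous_on P \<pi>" "\<pi> ` P \<subseteq> B"
    and uv: "u \<in> P" "v \<in> C" "\<pi> u = p v"
    and loops: "\<And>g e. path_lift P \<pi> g u u \<Longrightarrow> path_lift C p g v e \<Longrightarrow> e = v"
  obtains f where "continuous_on P f" "f ` P \<subseteq> C"
    "\<And>g y. path_lift P \<pi> g u y \<Longrightarrow> path_lift C p g v (f y)"
proof -
  have path: "\<exists>g. path_lift P \<pi> g u y" if "y \<in> P" for y
    using P(1) uv(1) that path_lift_self unfolding path_connected_def by metis
  have lift: "\<exists>e. path_lift C p g v e" if "path_lift P \<pi> g u y" for g y
  proof -
    have "p v = pathstart g" using path_lift_endpoints(3)[OF that] uv(3) by simp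
    then show ?thesis
      using path_lift_exists[OF cov path_lift_path[OF that pi] uv(2)] by blast
  qed
  have "\<exists>e. \<forall>g. path_lift P \<pi> g u y \<longrightarrow> path_lift C p g v e" if "y \<in> P" for y
  proof -
    obtain g0 where g0: "path_lift P \<pi> g0 u y" using path \<open>y \<in> P\<close> by blast
    obtain e0 where e0: "path_lift C p g0 v e0" using lift[OF g0] by blast
    have "path_lift C p g v e0" if g: "path_lift P \<pi> g u y" for g
    proof -
      \<comment> \<open>Two paths from \<open>u\<close> to \<open>y\<close> differ by a loop at
        \<open>u\<close>. Its lift from \<open>v\<close> closes up by \<open>loops\<close>, so the
        two lifted paths end at the same point.\<close>
      have loop: "path_lift P \<pi> (g0 +++ reversepath g) u u"
        using path_lift_join[OF g0 path_lift_reverse[OF g]] .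
      then obtain e where e: "path_lift C p (g0 +++ reversepath g) v e" using lift by blast
      then have "e = v" using loops loop by blast
      then obtain d where d: "path_lift C p g0 v d" "path_lift C p (reversepath g) d v"
        using path_lift_joinE[OF cov, of g0 "reversepath g" v v] e path_lift_path[OF g0 pi] path_lift_path[OF g pi]
          path_lift_endpoints(4)[OF g0] path_lift_endpoints(4)[OF g]
        by auto
      then have "d = e0" using e0 path_lift_unique[OF cov] by blast
      then show ?thesis using path_lift_reverse[OF d(2)] by simp
    qed
    then show ?thesis by blast
  qed
  then obtain f where f: "\<And>y g. y \<in> P \<Longrightarrow> path_lift P \<pi> g u y \<Longrightarrow> path_lift C p g v (f y)"
    by metis
  then have fg: "\<And>g y. path_lift P \<pi> g u y \<Longrightarrow> path_lift C p g v (f y)"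
    using path_lift_endpoints(2) by metis
  have fC: "f y \<in> C \<and> p (f y) = \<pi> y" if "y \<in> P" for y
    using path[OF that] path_lift_endpoints(2,4) fg by metis
  have "continuous_on P f"
  proof (rule continuous_on_openin_cover)
    fix y assume y: "y \<in> P"
    then have "\<pi> y \<in> B" using pi(2) by blast
    then obtain T Q where T: "\<pi> y \<in> T" "openin (top_of_set B) T" and Q: "even_sections C p T Q"
      using covering_space_sections[OF cov] by metis
    obtain q where q: "q \<in> Q" "q (\<pi> y) = f y"
      using even_sectionsE[OF Q, of "f y"] fC[OF y] T(1) by metis
    note D = even_sectionsD[OF Q q(1)]
    have "openin (top_of_set P) (P \<inter> \<pi> -` T)"
      using pi T(2) by (intro continuous_openin_preimage[of P \<pi> B]) auto
    moreover have "y \<in> P \<inter> \<pi> -` T" using y T(1) by simp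
    ultimately obtain W W' where W: "openin (top_of_set P) W" "path_connected W'" "y \<in> W" "W \<subseteq> W'"
      "W' \<subseteq> P \<inter> \<pi> -` T"
      using locallyE[OF P(2)] by metis
    \<comment> \<open>Reach \<open>z\<close> by a path to \<open>y\<close> followed by a short one
      inside \<open>W'\<close>. The section \<open>q\<close> lifts the short piece, which forces
      \<open>f\<close> to be \<open>q\<close> after \<open>\<pi>\<close> near
      \<open>y\<close>.\<close>
    have eq: "f z = q (\<pi> z)" if "z \<in> W" for z
    proof -
      obtain r where r: "path r" "path_image r \<subseteq> W'" "pathstart r = y" "pathfinish r = z"
        using W \<open>z \<in> W\<close> unfolding path_connected_def by blast
      have r': "path_image r \<subseteq> P" "path_image r \<subseteq> \<pi> -` T" using r(2) W(5) by auto
      have 1: "path_lift P \<pi> (\<pi> \<circ> r) y z" using path_lift_self[of r P \<pi>] r r' by simp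
      have "path (q \<circ> (\<pi> \<circ> r))"
        by (intro path_continuous_image r(1) continuous_on_subset[OF pi(1) r'(1)] continuous_on_subset[OF D(1)])
          (use r' in \<open>auto simp: path_image_def\<close>)
      then have 2: "path_lift C p (\<pi> \<circ> r) (q (\<pi> y)) (q (\<pi> z))"
        using D(3,4) r r' by (intro path_liftI[of "q \<circ> (\<pi> \<circ> r)"])
          (auto simp: path_image_def pathstart_def pathfinish_def image_subset_iff)
      obtain g where g: "path_lift P \<pi> g u y" using path y by blast
      have "path_lift C p (g +++ (\<pi> \<circ> r)) v (f z)"
        using fg path_lift_join[OF g 1] by blast
      moreover have "path_lift C p (g +++ (\<pi> \<circ> r)) v (q (\<pi> z))"
        using path_lift_join[OF fg[OF g]] 2 q(2) by simp
      ultimately show ?thesis using path_lift_unique[OF cov] by blast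
    qed
    have "continuous_on W (q \<circ> \<pi>)"
      by (intro continuous_on_compose continuous_on_subset[OF pi(1)] continuous_on_subset[OF D(1)])
        (use W in auto)
    then have "continuous_on W f"
      using eq by (subst continuous_on_cong[OF refl, of _ _ "q \<circ> \<pi>"]) auto
    then show "\<exists>U. openin (top_of_set P) U \<and> y \<in> U \<and> continuous_on U f"
      using W by blast
  qed
  then show ?thesis using that fC fg by blast
qed

section \<open>Constructions of coverings\<close>

text \<open>Move the neighbourhood of \<open>c\<close> down along a local section, choose a
  path-connected neighbourhood in \<open>B\<close>, and move it up again; images of open sets under
  sections are open.\<close>

lemma covering_space_locally_path_connected_top:
  assumes cov: "covering_space C p B" and B: "locally path_connected B"
  shows "locally path_connected C"
proof (rule locallyI)
  fix W c assume W: "openin (top_of_set C) W" "c \<in> W"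
  have pc: "continuous_on C p" "p ` C = B" using cov by (auto simp: covering_space_def)
  have c: "c \<in> C" using W openin_imp_subset by blast
  then have "p c \<in> B" using pc by blast
  then obtain T Q where T: "p c \<in> T" "openin (top_of_set B) T" and Q: "even_sections C p T Q"
    using covering_space_sections[OF cov] by metis
  obtain q where q: "q \<in> Q" "q (p c) = c" using even_sectionsE[OF Q c T(1)] by blast
  note D = even_sectionsD[OF Q q(1)]
  have "openin (top_of_set T) (T \<inter> q -` W)"
    using D(1,2) W(1) by (intro continuous_openin_preimage[of T q C]) auto
  then have "openin (top_of_set B) (T \<inter> q -` W)" using T(2) openin_trans by blast
  moreover have "p c \<in> T \<inter> q -` W" using T q W by simp
  ultimately obtain V V' where V: "openin (top_of_set B) V" "path_connected V'" "p c \<in> V" "V \<subseteq> V'"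
    "V' \<subseteq> T \<inter> q -` W"
    using locallyE[OF B] by metis
  have "even_sections C p V Q"
    using even_sections_subset[OF Q pc(1) _ V(1)] pc(2) V by blast
  then have "openin (top_of_set C) (q ` V)" using even_sectionsD(5) q(1) by blast
  moreover have "path_connected (q ` V')"
    using V by (intro path_connected_continuous_image continuous_on_subset[OF D(1)]) auto
  moreover have "c \<in> q ` V" using V(3) q(2) by force
  ultimately show "\<exists>U Z. openin (top_of_set C) U \<and> path_connected Z \<and> c \<in> U \<and> U \<subseteq> Z \<and> Z \<subseteq> W"
    using V by (intro exI[of _ "q ` V"] exI[of _ "q ` V'"]) auto
qed

lemma connected_locally_path_connected:
  assumes "connected S" "locally path_connected S"
  shows "path_connected S"
  unfolding path_connected_component
proof (intro ballI)
  fix x y assume "x \<in> S" "y \<in> S"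
  then show "path_component S x y"
  proof (rule connected_equivalence_relation[OF assms(1)])
    fix a assume "a \<in> S"
    then show "\<exists>T. openin (top_of_set S) T \<and> a \<in> T \<and> (\<forall>x\<in>T. path_component S a x)"
      using openin_path_component_locally_path_connected[OF assms(2), of a] path_component_refl
      by (intro exI[of _ "path_component_set S a"]) auto
  qed (auto intro: path_component_sym path_component_trans)
qed

text \<open>Over a connected evenly covered \<open>W\<close> each sheet is connected, so it lies in
  the component or misses it. Discarding the latter sheets leaves even sections. The same fact makes
  membership in the image of \<open>K\<close> locally constant, whence surjectivity onto the
  connected \<open>B\<close>.\<close>

lemma covering_space_component:
  assumes cov: "covering_space C p B" and B: "connected B" "locally path_connected B" and c0: "c0 \<in> C"
  shows "covering_space (connected_component_set C c0) p B"
proof -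
  define K where "K = connected_component_set C c0"
  have KC: "K \<subseteq> C" unfolding K_def by (rule connected_component_subset)
  have c0K: "c0 \<in> K" using c0 unfolding K_def by simp
  have pc: "continuous_on C p" "p ` C = B" using cov by (auto simp: covering_space_def)
  have nbd: "\<exists>W Q. x \<in> W \<and> openin (top_of_set B) W \<and> even_sections C p W Q \<and>
      (\<forall>q\<in>Q. \<forall>t\<in>W. q t \<in> K \<longrightarrow> q ` W \<subseteq> K)"
    if "x \<in> B" for x
  proof -
    obtain T Q where T: "x \<in> T" "openin (top_of_set B) T" and Q: "even_sections C p T Q"
      using covering_space_sections[OF cov \<open>x \<in> B\<close>] by metis
    obtain W where W: "openin (top_of_set B) W" "path_connected W" "x \<in> W" "W \<subseteq> T"
      using B(2) T unfolding locally_path_connected by metis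
    have QW: "even_sections C p W Q" using even_sections_subset[OF Q pc(1) _ W(1,4)] pc(2) by blast
    have "q ` W \<subseteq> K" if "q \<in> Q" "t \<in> W" "q t \<in> K" for q t
    proof -
      have "connected (q ` W)"
        using even_sectionsD(1)[OF QW \<open>q \<in> Q\<close>] path_connected_imp_connected[OF W(2)]
        by (rule connected_continuous_image)
      then have "q ` W \<subseteq> connected_component_set C (q t)"
        using even_sectionsD(2)[OF QW \<open>q \<in> Q\<close>] that by (intro connected_component_maximal) auto
      also have "connected_component_set C (q t) = K"
        using that(3) unfolding K_def by (metis connected_component_eq)
      finally show ?thesis .
    qed
    then show ?thesis using W QW by blast
  qed
  have surj: "x \<in> p ` K" if "x \<in> B" for x
  proof -
    have "p c0 \<in> B" using pc c0 by blast
    have "(x \<in> p ` K) = (p c0 \<in> p ` K)"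
    proof (rule connected_equivalence_relation[OF B(1) \<open>x \<in> B\<close> \<open>p c0 \<in> B\<close>])
      fix a assume "a \<in> B"
      then obtain W Q where W: "a \<in> W" "openin (top_of_set B) W" "even_sections C p W Q"
        "\<And>q t. q \<in> Q \<Longrightarrow> t \<in> W \<Longrightarrow> q t \<in> K \<Longrightarrow> q ` W \<subseteq> K"
        using nbd by metis
      have "t \<in> p ` K" if st: "s \<in> W" "t \<in> W" "s \<in> p ` K" for s t
      proof -
        obtain c where c: "c \<in> K" "s = p c" using st(3) by blast
        then obtain q where q: "q \<in> Q" "q (p c) = c" using even_sectionsE[OF W(3)] st(1) KC by blast
        then have "q ` W \<subseteq> K" using W(4)[of q s] c st by simp
        then show ?thesis using even_sectionsD(3)[OF W(3) q(1) st(2)] st(2) by force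
      qed
      then have "\<forall>t\<in>W. (a \<in> p ` K) = (t \<in> p ` K)" using W(1) by metis
      then show "\<exists>T. openin (top_of_set B) T \<and> a \<in> T \<and> (\<forall>x\<in>T. (a \<in> p ` K) = (x \<in> p ` K))"
        using W(1,2) by (intro exI[of _ W]) simp
    qed simp_all
    then show ?thesis using c0K by blast
  qed
  have "covering_space K p B"
  proof (rule covering_space_sectionsI)
    show "continuous_on K p" using pc(1) KC by (rule continuous_on_subset)
    show "p ` K = B" using surj pc(2) KC by blast
    fix x assume "x \<in> B"
    then obtain W Q where W: "x \<in> W" "openin (top_of_set B) W" "even_sections C p W Q"
      "\<And>q t. q \<in> Q \<Longrightarrow> t \<in> W \<Longrightarrow> q t \<in> K \<Longrightarrow> q ` W \<subseteq> K"
      using nbd by metis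
    have "even_sections K p W {q \<in> Q. q ` W \<subseteq> K}"
      unfolding even_sections_def
    proof (intro conjI ballI impI)
      fix q assume "q \<in> {q \<in> Q. q ` W \<subseteq> K}"
      then have q: "q \<in> Q" "q ` W \<subseteq> K" by auto
      note D = even_sectionsD[OF W(3) q(1)]
      show "continuous_on W q" "q ` W \<subseteq> K" "\<And>t. t \<in> W \<Longrightarrow> p (q t) = t" using D q by auto
      show "openin (top_of_set K) (q ` W)" using D(5) q(2) KC by (meson openin_subset_trans)
    next
      fix c assume "c \<in> K" "p c \<in> W"
      then obtain q where q: "q \<in> Q" "q (p c) = c" using even_sectionsE[OF W(3)] KC by blast
      then have "q ` W \<subseteq> K" using W(4) \<open>c \<in> K\<close> \<open>p c \<in> W\<close> by metis
      then show "\<exists>q\<in>{q \<in> Q. q ` W \<subseteq> K}. q (p c) = c" using q by blast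
    next
      fix q r s t assume "q \<in> {q \<in> Q. q ` W \<subseteq> K}" "r \<in> {q \<in> Q. q ` W \<subseteq> K}" "s \<in> W" "t \<in> W" "q s = r s"
      then show "q t = r t" by (auto intro: even_sections_eq[OF W(3)])
    qed
    then show "\<exists>T Q. x \<in> T \<and> openin (top_of_set B) T \<and> even_sections K p T Q"
      using W(1,2) by blast
  qed
  then show ?thesis by (simp add: K_def)
qed

text \<open>Pairs of local sections over a common neighbourhood are the local sections of the fibre
  product.\<close>

lemma covering_space_fibre_product:
  fixes C :: "'c::topological_space set" and D :: "'d::topological_space set"
    and B :: "'b::topological_space set"
  assumes C: "covering_space C p B" and D: "covering_space D r B"
  shows "covering_space {(y, z). y \<in> C \<and> z \<in> D \<and> p y = r z} (p \<circ> fst) B"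
    (is "covering_space ?E _ _")
proof (rule covering_space_sectionsI)
  have p: "continuous_on C p" "p ` C = B" and r: "continuous_on D r" "r ` D = B"
    using C D by (auto simp: covering_space_def)
  show "continuous_on ?E (p \<circ> fst)"
    by (intro continuous_on_compose continuous_intros continuous_on_subset[OF p(1)]) auto
  show "(p \<circ> fst) ` ?E = B"
  proof
    show "B \<subseteq> (p \<circ> fst) ` ?E"
    proof
      fix x assume "x \<in> B"
      then obtain y z where "y \<in> C" "z \<in> D" "p y = x" "r z = x" using p(2) r(2) by (metis imageE)
      then show "x \<in> (p \<circ> fst) ` ?E" by (force simp: image_iff)
    qed
  qed (use p in auto)
  fix x assume "x \<in> B"
  obtain T1 Q1 where T1: "x \<in> T1" "openin (top_of_set B) T1" and Q1: "even_sections C p T1 Q1"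
    using covering_space_sections[OF C \<open>x \<in> B\<close>] by metis
  obtain T2 Q2 where T2: "x \<in> T2" "openin (top_of_set B) T2" and Q2: "even_sections D r T2 Q2"
    using covering_space_sections[OF D \<open>x \<in> B\<close>] by metis
  define T where "T = T1 \<inter> T2"
  have T: "openin (top_of_set B) T" "x \<in> T" using T1 T2 by (auto simp: T_def)
  have Q1: "even_sections C p T Q1" using even_sections_subset[OF Q1 p(1) _ T(1)] p(2) by (simp add: T_def)
  have Q2: "even_sections D r T Q2" using even_sections_subset[OF Q2 r(1) _ T(1)] r(2) by (simp add: T_def)
  have "even_sections ?E (p \<circ> fst) T {(\<lambda>t. (a t, b t)) |a b. a \<in> Q1 \<and> b \<in> Q2}"
    unfolding even_sections_def
  proof (intro conjI ballI impI)
    fix q assume "q \<in> {(\<lambda>t. (a t, b t)) |a b. a \<in> Q1 \<and> b \<in> Q2}"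
    then obtain a b where q: "q = (\<lambda>t. (a t, b t))" and ab: "a \<in> Q1" "b \<in> Q2" by blast
    note A = even_sectionsD[OF Q1 ab(1)] and B = even_sectionsD[OF Q2 ab(2)]
    show "continuous_on T q" unfolding q using A(1) B(1) by (intro continuous_intros)
    show "q ` T \<subseteq> ?E" "\<And>t. t \<in> T \<Longrightarrow> (p \<circ> fst) (q t) = t" unfolding q using A B by auto
    \<comment> \<open>If the coordinates of a point of \<open>?E\<close> lie on the sheets of
      \<open>a\<close> and \<open>b\<close>, over \<open>s\<close> and \<open>t\<close>, the fibre
      condition forces \<open>s = t\<close>, so the point is a value of \<open>q\<close>.\<close>
    have "q ` T = (?E \<inter> fst -` (a ` T)) \<inter> (?E \<inter> snd -` (b ` T))"
    proof
      show "(?E \<inter> fst -` (a ` T)) \<inter> (?E \<inter> snd -` (b ` T)) \<subseteq> q ` T"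
      proof
        fix e assume "e \<in> (?E \<inter> fst -` (a ` T)) \<inter> (?E \<inter> snd -` (b ` T))"
        then obtain s t where "s \<in> T" "t \<in> T" "e = (a s, b t)" "p (a s) = r (b t)" by auto
        then show "e \<in> q ` T" unfolding q using A(3) B(3) by auto
      qed
    qed (use A B in \<open>auto simp: q\<close>)
    moreover have "openin (top_of_set ?E) (?E \<inter> fst -` (a ` T))"
      using A(5) by (intro continuous_openin_preimage[of _ _ C] continuous_intros) auto
    moreover have "openin (top_of_set ?E) (?E \<inter> snd -` (b ` T))"
      using B(5) by (intro continuous_openin_preimage[of _ _ D] continuous_intros) auto
    ultimately show "openin (top_of_set ?E) (q ` T)" by (simp add: openin_Int)
  next
    fix e assume e: "e \<in> ?E" "(p \<circ> fst) e \<in> T"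
    have e': "fst e \<in> C" "snd e \<in> D" "p (fst e) \<in> T" "r (snd e) = p (fst e)" using e by auto
    obtain a where a: "a \<in> Q1" "a (p (fst e)) = fst e" using even_sectionsE[OF Q1 e'(1,3)] by blast
    obtain b where b: "b \<in> Q2" "b (p (fst e)) = snd e" using even_sectionsE[OF Q2 e'(2)] e'(3,4) by metis
    show "\<exists>q\<in>{(\<lambda>t. (a t, b t)) |a b. a \<in> Q1 \<and> b \<in> Q2}. q ((p \<circ> fst) e) = e"
      using a b by (intro bexI[of _ "\<lambda>t. (a t, b t)"]) (simp, blast)
  next
    fix q q' s t assume q: "q \<in> {(\<lambda>t. (a t, b t)) |a b. a \<in> Q1 \<and> b \<in> Q2}"
      "q' \<in> {(\<lambda>t. (a t, b t)) |a b. a \<in> Q1 \<and> b \<in> Q2}" "s \<in> T" "t \<in> T" "q s = q' s"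
    then obtain a b a' b' where "q = (\<lambda>t. (a t, b t))" "q' = (\<lambda>t. (a' t, b' t))"
      "a \<in> Q1" "b \<in> Q2" "a' \<in> Q1" "b' \<in> Q2" by blast
    moreover from this have "a s = a' s" "b s = b' s" using q(5) by simp_all
    ultimately show "q t = q' t"
      using q(3,4) even_sections_eq[OF Q1, of a a' s t] even_sections_eq[OF Q2, of b b' s t] by simp
  qed
  then show "\<exists>T Q. x \<in> T \<and> openin (top_of_set B) T \<and> even_sections ?E (p \<circ> fst) T Q"
    using T by blast
qed

text \<open>Finiteness of the fibres of \<open>p\<close> is essential to this argument: every point
  \<open>y\<close> above \<open>x\<close> has its own neighbourhood evenly covered by
  \<open>q\<close>, and only finitely many such constraints can be imposed on one open neighbourhood
  of \<open>x\<close>.\<close>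

lemma finite_covering_compose:
  fixes C :: "'c::topological_space set" and D :: "'d::topological_space set"
    and B :: "'b::topological_space set"
  assumes q: "finite_covering C q D" and p: "finite_covering D p B"
  shows "finite_covering C (p \<circ> q) B"
proof -
  have covq: "covering_space C q D" and covp: "covering_space D p B"
    using q p by (auto simp: finite_covering_def)
  have qc: "continuous_on C q" "q ` C = D" and pc: "continuous_on D p" "p ` D = B"
    using covp covq by (auto simp: covering_space_def)
  have "covering_space C (p \<circ> q) B"
  proof (rule covering_space_sectionsI)
    show "continuous_on C (p \<circ> q)" using pc qc by (intro continuous_on_compose) auto
    show "(p \<circ> q) ` C = B" using pc qc by (metis image_comp)
    fix x assume "x \<in> B"
    obtain T Q where T: "x \<in> T" "openin (top_of_set B) T" and Q: "even_sections D p T Q"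
      using covering_space_sections[OF covp \<open>x \<in> B\<close>] by metis
    define F where "F = {y \<in> D. p y = x}"
    have "finite F" using p \<open>x \<in> B\<close> by (simp add: finite_covering_def F_def)
    have "\<exists>\<sigma> S R. \<sigma> \<in> Q \<and> \<sigma> x = y \<and> y \<in> S \<and> openin (top_of_set D) S \<and> even_sections C q S R"
      if "y \<in> F" for y
    proof -
      have y: "y \<in> D" "p y = x" using that by (auto simp: F_def)
      show ?thesis
        using covering_space_sections[OF covq y(1)] even_sectionsE[OF Q y(1)] y(2) T(1) by metis
    qed
    then obtain \<sigma> S R where \<sigma>: "\<And>y. y \<in> F \<Longrightarrow> \<sigma> y \<in> Q" "\<And>y. y \<in> F \<Longrightarrow> \<sigma> y x = y"
      and S: "\<And>y. y \<in> F \<Longrightarrow> y \<in> S y" "\<And>y. y \<in> F \<Longrightarrow> openin (top_of_set D) (S y)"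
      and R: "\<And>y. y \<in> F \<Longrightarrow> even_sections C q (S y) (R y)"
      by metis
    \<comment> \<open>Over \<open>W\<close> each section \<open>\<sigma> y\<close> stays in the set
      \<open>S y\<close> evenly covered by \<open>q\<close>, so it can be followed by the sections
      in \<open>R y\<close>.\<close>
    define W where "W = \<Inter>(insert T ((\<lambda>y. T \<inter> \<sigma> y -` S y) ` F))"
    have "openin (top_of_set B) (T \<inter> \<sigma> y -` S y)" if "y \<in> F" for y
    proof -
      have "openin (top_of_set T) (T \<inter> \<sigma> y -` S y)"
        using even_sectionsD[OF Q \<sigma>(1)[OF that]] S(2)[OF that]
        by (intro continuous_openin_preimage[of _ _ D]) auto
      then show ?thesis using T(2) openin_trans by blast
    qed
    then have oW: "openin (top_of_set B) W"
      unfolding W_def using \<open>finite F\<close> T(2) by (intro openin_Inter) auto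
    have xW: "x \<in> W" using T S \<sigma> by (auto simp: W_def)
    have WT: "W \<subseteq> T" and WS: "\<And>y t. y \<in> F \<Longrightarrow> t \<in> W \<Longrightarrow> \<sigma> y t \<in> S y"
      unfolding W_def by blast+
    have QW: "even_sections D p W Q" using even_sections_subset[OF Q pc(1) _ oW WT] pc(2) by simp
    have "even_sections C (p \<circ> q) W {\<rho> \<circ> \<sigma> y |\<rho> y. y \<in> F \<and> \<rho> \<in> R y}"
      unfolding even_sections_def
    proof (intro conjI ballI impI)
      fix f assume "f \<in> {\<rho> \<circ> \<sigma> y |\<rho> y. y \<in> F \<and> \<rho> \<in> R y}"
      then obtain \<rho> y where f: "f = \<rho> \<circ> \<sigma> y" and y: "y \<in> F" and \<rho>: "\<rho> \<in> R y" by blast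
      note A = even_sectionsD[OF QW \<sigma>(1)[OF y]] and E = even_sectionsD[OF R[OF y] \<rho>]
      show "continuous_on W f"
        unfolding f using WS[OF y] by (intro continuous_on_compose A(1) continuous_on_subset[OF E(1)]) auto
      show "f ` W \<subseteq> C" using E(4) WS[OF y] by (auto simp: f)
      show "(p \<circ> q) (f t) = t" if "t \<in> W" for t using that A(3) E(3) WS[OF y] by (simp add: f)
      have "f ` W = \<rho> ` S y \<inter> (C \<inter> q -` (\<sigma> y ` W))"
      proof
        show "f ` W \<subseteq> \<rho> ` S y \<inter> (C \<inter> q -` (\<sigma> y ` W))" using E(3,4) WS[OF y] by (auto simp: f)
        show "\<rho> ` S y \<inter> (C \<inter> q -` (\<sigma> y ` W)) \<subseteq> f ` W" using E(3) by (auto simp: f)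
      qed
      moreover have "openin (top_of_set C) (C \<inter> q -` (\<sigma> y ` W))"
        using qc A(5) by (intro continuous_openin_preimage[of _ _ D]) auto
      ultimately show "openin (top_of_set C) (f ` W)" using E(5) by (simp add: openin_Int)
    next
      fix c assume c: "c \<in> C" "(p \<circ> q) c \<in> W"
      have qD: "q c \<in> D" using qc(2) c(1) by blast
      then obtain s where s: "s \<in> Q" "s (p (q c)) = q c" using even_sectionsE[OF QW] c(2) by auto
      \<comment> \<open>The section \<open>s\<close> passes through \<open>q c\<close>. Over
        \<open>x\<close> it passes through \<open>y\<close>, so on \<open>W\<close> it coincides
        with the section \<open>\<sigma> y\<close> chosen for \<open>y\<close>.\<close>
      define y where "y = s x"
      have "y \<in> F" using even_sectionsD(3,4)[OF QW s(1) xW] by (auto simp: F_def y_def)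
      have "\<sigma> y (p (q c)) = s (p (q c))"
        using even_sections_eq[OF QW \<sigma>(1) s(1) xW] \<sigma>(2) \<open>y \<in> F\<close> c(2) by (simp add: y_def)
      then have qc': "\<sigma> y (p (q c)) = q c" using s(2) by simp
      then have "q c \<in> S y" using WS[OF \<open>y \<in> F\<close>] c(2) by (metis comp_apply)
      then obtain \<rho> where "\<rho> \<in> R y" "\<rho> (q c) = c" using even_sectionsE[OF R[OF \<open>y \<in> F\<close>] c(1)] by blast
      then show "\<exists>f\<in>{\<rho> \<circ> \<sigma> y |\<rho> y. y \<in> F \<and> \<rho> \<in> R y}. f ((p \<circ> q) c) = c"
        using \<open>y \<in> F\<close> qc' by (intro bexI[of _ "\<rho> \<circ> \<sigma> y"]) auto
    next
      fix f g s t assume fg: "f \<in> {\<rho> \<circ> \<sigma> y |\<rho> y. y \<in> F \<and> \<rho> \<in> R y}" "g \<in> {\<rho> \<circ> \<sigma> y |\<rho> y. y \<in> F \<and> \<rho> \<in> R y}"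
        and st: "s \<in> W" "t \<in> W" "f s = g s"
      then obtain \<rho> y \<rho>' y' where f: "f = \<rho> \<circ> \<sigma> y" "y \<in> F" "\<rho> \<in> R y"
        and g: "g = \<rho>' \<circ> \<sigma> y'" "y' \<in> F" "\<rho>' \<in> R y'" by blast
      have "q (f s) = \<sigma> y s" "q (g s) = \<sigma> y' s"
        using even_sectionsD(3)[OF R[OF f(2)] f(3) WS[OF f(2) st(1)]]
          even_sectionsD(3)[OF R[OF g(2)] g(3) WS[OF g(2) st(1)]] by (simp_all add: f(1) g(1))
      then have eq: "\<sigma> y s = \<sigma> y' s" using st by simp
      have "\<sigma> y x = \<sigma> y' x"
        using even_sections_eq[OF QW \<sigma>(1)[OF f(2)] \<sigma>(1)[OF g(2)] st(1) xW eq] .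
      then have "y' = y" using \<sigma>(2) f g by simp
      then show "f t = g t"
        using even_sections_eq[OF R[OF f(2)] f(3) _ WS[OF f(2) st(1)] WS[OF f(2) st(2)], of \<rho>'] g(3) st(3)
        by (simp add: f(1) g(1))
    qed
    then show "\<exists>T Q. x \<in> T \<and> openin (top_of_set B) T \<and> even_sections C (p \<circ> q) T Q"
      using xW oW by blast
  qed
  moreover have "finite {c \<in> C. (p \<circ> q) c = x}" if "x \<in> B" for x
  proof -
    have "{c \<in> C. (p \<circ> q) c = x} \<subseteq> (\<Union>y\<in>{y \<in> D. p y = x}. {c \<in> C. q c = y})" using qc by auto
    moreover have "finite (\<Union>y\<in>{y \<in> D. p y = x}. {c \<in> C. q c = y})"
      using p q that by (auto simp: finite_covering_def)
    ultimately show ?thesis by (rule finite_subset)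
  qed
  ultimately show ?thesis by (simp add: finite_covering_def)
qed

lemma continuous_on_coord: "continuous_on X (\<lambda>x. x i)"
  for X :: "('i \<Rightarrow> 'b::topological_space) set"
  by (rule continuous_on_subset[OF continuous_on_product_coordinates]) simp

text \<open>Coordinates from \<open>d\<close> on are fixed at \<open>undefined\<close>, which keeps the fibres finite.\<close>

definition fibre_power :: "'c set \<Rightarrow> ('c \<Rightarrow> 'b) \<Rightarrow> nat \<Rightarrow> (nat \<Rightarrow> 'c) set" where
  "fibre_power C p d = {s. (\<forall>k<d. s k \<in> C \<and> p (s k) = p (s 0)) \<and> (\<forall>k\<ge>d. s k = undefined)}"

text \<open>As for the fibre product of two coverings, a local section is one section from
  \<open>Q\<close> for each of the \<open>d\<close> coordinates; its image is open as an
  intersection of \<open>d\<close> open conditions.\<close>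

lemma finite_covering_fibre_power:
  fixes C :: "'c::topological_space set" and B :: "'b::topological_space set"
  assumes cov: "finite_covering C p B" and d: "d > 0"
  shows "finite_covering (fibre_power C p d) (\<lambda>s. p (s 0)) B"
proof -
  let ?E = "fibre_power C p d"
  have cov': "covering_space C p B" using cov by (simp add: finite_covering_def)
  have pc: "continuous_on C p" "p ` C = B" using cov' by (auto simp: covering_space_def)
  have E: "s k \<in> C" "p (s k) = p (s 0)" if "s \<in> ?E" "k < d" for s k
    using that unfolding fibre_power_def by blast+
  have E': "s k = undefined" if "s \<in> ?E" "\<not> k < d" for s k
    using that unfolding fibre_power_def by simp
  have "covering_space ?E (\<lambda>s. p (s 0)) B"
  proof (rule covering_space_sectionsI)
    show "continuous_on ?E (\<lambda>s. p (s 0))"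
      using E(1) d by (intro continuous_on_compose2[OF pc(1) continuous_on_coord]) auto
    show "(\<lambda>s. p (s 0)) ` ?E = B"
    proof
      show "B \<subseteq> (\<lambda>s. p (s 0)) ` ?E"
      proof
        fix x assume "x \<in> B"
        then obtain c where "c \<in> C" "p c = x" using pc(2) by blast
        then show "x \<in> (\<lambda>s. p (s 0)) ` ?E"
          using d by (intro image_eqI[of _ _ "\<lambda>k. if k < d then c else undefined"]) (auto simp: fibre_power_def)
      qed
    qed (use E(1) d pc in auto)
    fix x assume "x \<in> B"
    obtain T Q where T: "x \<in> T" "openin (top_of_set B) T" and Q: "even_sections C p T Q"
      using covering_space_sections[OF cov' \<open>x \<in> B\<close>] by metis
    define sec where "sec \<rho> t k = (if k < d then \<rho> k t else undefined)" for \<rho> :: "nat \<Rightarrow> 'b \<Rightarrow> 'c" and t and k :: nat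
    have "even_sections ?E (\<lambda>s. p (s 0)) T (sec ` {\<rho>. \<forall>k<d. \<rho> k \<in> Q})"
      unfolding even_sections_def
    proof (intro conjI ballI impI)
      fix f assume "f \<in> sec ` {\<rho>. \<forall>k<d. \<rho> k \<in> Q}"
      then obtain \<rho> where f: "f = sec \<rho>" and \<rho>: "\<And>k. k < d \<Longrightarrow> \<rho> k \<in> Q" by auto
      note D = even_sectionsD[OF Q \<rho>]
      show "continuous_on T f"
      proof (rule continuous_on_coordinatewise_then_product)
        show "continuous_on T (\<lambda>t. f t k)" for k
          using D(1) by (cases "k < d") (auto simp: f sec_def)
      qed
      show "f ` T \<subseteq> ?E" using D d by (auto simp: f sec_def fibre_power_def)
      show "p (f t 0) = t" if "t \<in> T" for t using D(3) d that by (simp add: f sec_def)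
      have "f ` T = \<Inter>((\<lambda>k. ?E \<inter> (\<lambda>s. s k) -` (\<rho> k ` T)) ` {..<d})"
      proof
        show "f ` T \<subseteq> \<Inter>((\<lambda>k. ?E \<inter> (\<lambda>s. s k) -` (\<rho> k ` T)) ` {..<d})"
          using \<open>f ` T \<subseteq> ?E\<close> by (auto simp: f sec_def)
        show "\<Inter>((\<lambda>k. ?E \<inter> (\<lambda>s. s k) -` (\<rho> k ` T)) ` {..<d}) \<subseteq> f ` T"
        proof
          fix s assume s: "s \<in> \<Inter>((\<lambda>k. ?E \<inter> (\<lambda>s. s k) -` (\<rho> k ` T)) ` {..<d})"
          then have sE: "s \<in> ?E" using d by blast
          have k: "p (s 0) \<in> T \<and> s k = \<rho> k (p (s 0))" if "k < d" for k
          proof -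
            obtain t where "t \<in> T" "s k = \<rho> k t" using s \<open>k < d\<close> by blast
            then show ?thesis using D(3)[OF \<open>k < d\<close>] E(2)[OF sE \<open>k < d\<close>] by auto
          qed
          have "s = f (p (s 0))"
          proof
            fix j
            have "f (p (s 0)) j = (if j < d then \<rho> j (p (s 0)) else undefined)" by (simp add: f sec_def)
            then show "s j = f (p (s 0)) j" using k E'[OF sE] by metis
          qed
          then show "s \<in> f ` T" using k d by blast
        qed
      qed
      moreover have "openin (top_of_set ?E) (?E \<inter> (\<lambda>s. s k) -` (\<rho> k ` T))" if "k < d" for k
        using D(5)[OF that] E(1)[OF _ that] by (intro continuous_openin_preimage[of _ _ C] continuous_on_coord) auto
      ultimately show "openin (top_of_set ?E) (f ` T)"
        using d by (simp only:) (rule openin_Inter, auto)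
    next
      fix s assume s: "s \<in> ?E" "p (s 0) \<in> T"
      have "\<exists>\<rho>\<in>Q. \<rho> (p (s 0)) = s k" if "k < d" for k
        using even_sectionsE[OF Q E(1)[OF s(1) that]] E(2)[OF s(1) that] s(2) by metis
      then obtain \<rho> where \<rho>: "\<And>k. k < d \<Longrightarrow> \<rho> k \<in> Q \<and> \<rho> k (p (s 0)) = s k" by metis
      then have "sec \<rho> (p (s 0)) = s" using E'[OF s(1)] by (auto simp: sec_def)
      then show "\<exists>f\<in>sec ` {\<rho>. \<forall>k<d. \<rho> k \<in> Q}. f (p (s 0)) = s"
        using \<rho> by (intro bexI[of _ "sec \<rho>"]) blast+
    next
      fix f g s t assume fg: "f \<in> sec ` {\<rho>. \<forall>k<d. \<rho> k \<in> Q}" "g \<in> sec ` {\<rho>. \<forall>k<d. \<rho> k \<in> Q}"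
        and st: "s \<in> T" "t \<in> T" "f s = g s"
      then obtain \<rho> \<rho>' where f: "f = sec \<rho>" "\<And>k. k < d \<Longrightarrow> \<rho> k \<in> Q"
        and g: "g = sec \<rho>'" "\<And>k. k < d \<Longrightarrow> \<rho>' k \<in> Q" by auto
      have "\<rho> k t = \<rho>' k t" if "k < d" for k
      proof -
        have "\<rho> k s = \<rho>' k s" using fun_cong[OF st(3), of k] that by (simp add: f g sec_def)
        then show ?thesis using even_sections_eq[OF Q f(2)[OF that] g(2)[OF that] st(1,2)] by blast
      qed
      then show "f t = g t" by (auto simp: f g sec_def)
    qed
    then show "\<exists>T Q. x \<in> T \<and> openin (top_of_set B) T \<and> even_sections ?E (\<lambda>s. p (s 0)) T Q"
      using T by blast
  qed
  moreover have "finite {s \<in> ?E. p (s 0) = x}" if "x \<in> B" for x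
  proof -
    have "{s \<in> ?E. p (s 0) = x} \<subseteq> PiE {..<d} (\<lambda>_. {c \<in> C. p c = x})"
    proof
      fix s assume "s \<in> {s \<in> ?E. p (s 0) = x}"
      then show "s \<in> PiE {..<d} (\<lambda>_. {c \<in> C. p c = x})"
        using E(1)[of s] E(2)[of s] E'[of s] by (intro PiE_I) simp_all
    qed
    moreover have "finite (PiE {..<d} (\<lambda>_. {c \<in> C. p c = x}))"
      using cov that by (intro finite_PiE) (auto simp: finite_covering_def)
    ultimately show ?thesis by (rule finite_subset)
  qed
  ultimately show ?thesis by (simp add: finite_covering_def)
qed

section \<open>Local isotopies of manifolds\<close>

text \<open>The l1 distance, used because points of \<open>Euclidean_space n\<close> are sequences
  vanishing from index \<open>n\<close> on and because its triangle inequality, homogeneity and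
  comparison with coordinates are immediate.\<close>

definition coord_dist :: "nat \<Rightarrow> (nat \<Rightarrow> real) \<Rightarrow> (nat \<Rightarrow> real) \<Rightarrow> real" where
  "coord_dist n x y = (\<Sum>i<n. \<bar>x i - y i\<bar>)"

definition coord_ball :: "nat \<Rightarrow> (nat \<Rightarrow> real) \<Rightarrow> real \<Rightarrow> (nat \<Rightarrow> real) set" where
  "coord_ball n c r = {x. (\<forall>i\<ge>n. x i = 0) \<and> coord_dist n x c \<le> r}"

lemma coord_dist_nonneg: "coord_dist n x y \<ge> 0"
  by (simp add: coord_dist_def sum_nonneg)

lemma coord_dist_triangle: "coord_dist n x z \<le> coord_dist n x y + coord_dist n y z"
  unfolding coord_dist_def sum.distrib[symmetric] by (intro sum_mono) linarith

lemma coord_dist_commute: "coord_dist n x y = coord_dist n y x"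
  by (simp add: coord_dist_def abs_minus_commute)

lemma coord_dist_component: "i < n \<Longrightarrow> \<bar>x i - y i\<bar> \<le> coord_dist n x y"
  unfolding coord_dist_def by (intro member_le_sum) auto

lemma coord_dist_scaled:
  assumes "\<And>i. i < n \<Longrightarrow> x i - y i = s * (u i - v i)"
  shows "coord_dist n x y = \<bar>s\<bar> * coord_dist n u v"
  using assms by (simp add: coord_dist_def abs_mult sum_distrib_left)

lemma continuous_on_coord_dist:
  assumes "continuous_on X f"
  shows "continuous_on X (\<lambda>x. coord_dist n (f x) c)"
  unfolding coord_dist_def
  by (intro continuous_intros continuous_on_product_then_coordinatewise[OF assms])

lemma compact_coord_ball: "compact (coord_ball n c r)"
proof -
  \<comment> \<open>Pinning the coordinates from \<open>n\<close> on to \<open>0\<close> places the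
    ball as a closed subset in a product of compact sets.\<close>
  define X where "X i = (if i < n then {c i - r..c i + r} else {0})" for i
  have "compactin (product_topology (\<lambda>_. euclideanreal) UNIV) (PiE UNIV X)"
    unfolding compactin_PiE by (auto simp: X_def)
  then have cX: "compact (PiE UNIV X)" by (simp add: euclidean_product_topology)
  have "closed {x. coord_dist n x c \<le> r}"
    by (intro closed_Collect_le continuous_on_coord_dist continuous_intros)
  with cX have "compact (PiE UNIV X \<inter> {x. coord_dist n x c \<le> r})"
    by (rule compact_Int_closed)
  moreover have "coord_ball n c r = PiE UNIV X \<inter> {x. coord_dist n x c \<le> r}"
  proof
    show "coord_ball n c r \<subseteq> PiE UNIV X \<inter> {x. coord_dist n x c \<le> r}"
    proof
      fix x assume x: "x \<in> coord_ball n c r"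
      have "x i \<in> X i" for i
        using x coord_dist_component[of i n x c] by (auto simp: coord_ball_def X_def abs_le_iff)
      then show "x \<in> PiE UNIV X \<inter> {x. coord_dist n x c \<le> r}" using x by (auto simp: coord_ball_def)
    qed
    show "PiE UNIV X \<inter> {x. coord_dist n x c \<le> r} \<subseteq> coord_ball n c r"
    proof
      fix x assume x: "x \<in> PiE UNIV X \<inter> {x. coord_dist n x c \<le> r}"
      then have "x i \<in> X i" for i by auto
      then have "x i = 0" if "i \<ge> n" for i using that by (metis X_def not_le singletonD)
      then show "x \<in> coord_ball n c r" using x by (auto simp: coord_ball_def)
    qed
  qed
  ultimately show ?thesis by simp
qed

lemma coord_ball_subset_open:
  assumes W: "openin (Euclidean_space n) W" "c \<in> W"
  obtains r where "r > 0" "coord_ball n c r \<subseteq> W"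
proof -
  obtain O' where O': "openin (powertop_real UNIV) O'" "W = O' \<inter> {x. \<forall>i\<ge>n. x i = 0}"
    using W(1) unfolding Euclidean_space_def openin_subtopology by blast
  then obtain X where X: "c \<in> PiE UNIV X" "\<And>i. open (X i)" "PiE UNIV X \<subseteq> O'"
    using product_topology_open_contains_basis[of "\<lambda>_. euclideanreal" UNIV O' c] W(2) by auto
  have "\<exists>e>0. ball (c i) e \<subseteq> X i" for i
    using X(1,2) by (auto intro: openE)
  then obtain e where e: "\<And>i. e i > 0" "\<And>i. ball (c i) (e i) \<subseteq> X i" by metis
  \<comment> \<open>The inserted \<open>1\<close> keeps the minimum defined for
    \<open>n = 0\<close>; halving gives the strict inequality \<open>r < e i\<close>.\<close>
  define r where "r = Min (insert 1 (e ` {..<n})) / 2"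
  have "Min (insert 1 (e ` {..<n})) > 0" using e(1) by (subst Min_gr_iff) auto
  then have r: "r > 0" by (simp add: r_def)
  have re: "r < e i" if "i < n" for i
  proof -
    have "Min (insert 1 (e ` {..<n})) \<le> e i" using that by (intro Min_le) auto
    then show ?thesis using r unfolding r_def by linarith
  qed
  have "coord_ball n c r \<subseteq> W"
  proof
    fix x assume x: "x \<in> coord_ball n c r"
    have "x i \<in> X i" for i
    proof (cases "i < n")
      case True
      then have "\<bar>x i - c i\<bar> < e i"
        using x coord_dist_component[OF True, of x c] re[OF True] by (auto simp: coord_ball_def)
      then show ?thesis using e(2)[of i] by (auto simp: dist_real_def abs_minus_commute)
    next
      case False
      then have "x i = c i" using x W(2) O'(2) by (auto simp: coord_ball_def)
      then show ?thesis using X(1) by auto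
    qed
    then show "x \<in> W" using X(3) O'(2) x by (auto simp: coord_ball_def)
  qed
  then show ?thesis using that r by blast
qed

text \<open>The closed ball is compact, so \<open>K\<close> is closed in the Hausdorff space
  \<open>B\<close>. Together with the openness of the interior this lets a map supported in
  \<open>K\<close> be extended by the identity.\<close>

lemma manifold_coordinate_ball:
  assumes B: "closed_connected_manifold B" and W: "openin (top_of_set B) W" "m \<in> W"
  obtains n c r K g g' where "r > 0" "K \<subseteq> W" "closedin (top_of_set B) K" "m \<in> K" "g m = c"
    "homeomorphism K (coord_ball n c r) g g'"
    "openin (top_of_set B) {y \<in> K. coord_dist n (g y) c < r}"
proof -
  have "m \<in> B" using W openin_imp_subset by blast
  then obtain n U V where U: "openin (top_of_set B) U" "m \<in> U" and V: "openin (Euclidean_space n) V"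
    and "top_of_set U homeomorphic_space subtopology (Euclidean_space n) V"
    using B unfolding closed_connected_manifold_def locally_euclidean_def by blast
  then obtain g g' where gg: "homeomorphic_maps (top_of_set U) (subtopology (Euclidean_space n) V) g g'"
    unfolding homeomorphic_space_def by blast
  define En :: "(nat \<Rightarrow> real) set" where "En = {x. \<forall>i\<ge>n. x i = 0}"
  have Eu: "Euclidean_space n = top_of_set En"
    by (simp add: Euclidean_space_def En_def euclidean_product_topology)
  have VE: "V \<subseteq> En" using V Eu by (auto dest: openin_imp_subset)
  have sub: "subtopology (Euclidean_space n) V = top_of_set V"
    using VE by (simp add: Eu subtopology_subtopology inf.absorb2)
  have g: "continuous_on U g" "g ` U \<subseteq> V" "continuous_on V g'" "g' ` V \<subseteq> U"
    "\<And>y. y \<in> U \<Longrightarrow> g' (g y) = y" "\<And>v. v \<in> V \<Longrightarrow> g (g' v) = v"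
    using gg unfolding sub homeomorphic_maps_def by (auto simp: image_subset_iff_funcset)
  have "openin (top_of_set U) (U \<inter> W)"
    using W(1) U(1) by (metis inf.cobounded1 openin_Int openin_imp_subset openin_subset_trans)
  then have "openin (top_of_set V) (V \<inter> g' -` (U \<inter> W))"
    using g by (intro continuous_openin_preimage[of V g' U]) auto
  then have "openin (Euclidean_space n) (V \<inter> g' -` (U \<inter> W))"
    using V Eu openin_trans by metis
  moreover have "g m \<in> V \<inter> g' -` (U \<inter> W)" using g U W by auto
  ultimately obtain r where r: "r > 0" "coord_ball n (g m) r \<subseteq> V \<inter> g' -` (U \<inter> W)"
    using coord_ball_subset_open by metis
  define D where "D = coord_ball n (g m) r"
  define K where "K = g' ` D"
  have DV: "D \<subseteq> V" and KW: "K \<subseteq> W" and KU: "K \<subseteq> U" using r by (auto simp: D_def K_def)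
  have "compact D" unfolding D_def by (rule compact_coord_ball)
  then have "compact K"
    unfolding K_def using compact_continuous_image[OF continuous_on_subset[OF g(3) DV]] by blast
  moreover have "K \<subseteq> B" using KU U(1) by (auto dest: openin_imp_subset)
  moreover have "Hausdorff_space (top_of_set B)" using B by (simp add: closed_connected_manifold_def)
  ultimately have "closedin (top_of_set B) K"
    by (intro compactin_imp_closedin) (auto simp: compactin_subtopology)
  moreover have "homeomorphism K D g g'"
    unfolding homeomorphism_def
  proof (intro conjI ballI)
    show "continuous_on K g" using g(1) KU continuous_on_subset by blast
    show "continuous_on D g'" using g(3) DV continuous_on_subset by blast
    show "g ` K = D" using g(6) DV by (force simp: K_def image_image)
    show "g' ` D = K" by (simp add: K_def)
  qed (use g KU DV in auto)
  moreover have "openin (top_of_set B) {y \<in> K. coord_dist n (g y) (g m) < r}"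
  proof -
    have "{y \<in> K. coord_dist n (g y) (g m) < r} = U \<inter> (\<lambda>y. coord_dist n (g y) (g m)) -` {..<r}"
    proof
      show "U \<inter> (\<lambda>y. coord_dist n (g y) (g m)) -` {..<r} \<subseteq> {y \<in> K. coord_dist n (g y) (g m) < r}"
      proof
        fix y assume y: "y \<in> U \<inter> (\<lambda>y. coord_dist n (g y) (g m)) -` {..<r}"
        then have "g y \<in> D" using g(2) VE by (auto simp: D_def coord_ball_def En_def)
        then have "y \<in> K" unfolding K_def using g(5) y by (metis IntD1 imageI)
        then show "y \<in> {y \<in> K. coord_dist n (g y) (g m) < r}" using y by simp
      qed
    qed (use KU in auto)
    moreover have "openin (top_of_set U) (U \<inter> (\<lambda>y. coord_dist n (g y) (g m)) -` {..<r})"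
      by (intro continuous_openin_preimage_gen continuous_on_coord_dist g(1)) simp
    ultimately show ?thesis using U(1) openin_trans by metis
  qed
  moreover have "m \<in> K"
  proof -
    have "g m \<in> D" using g(2) U(2) VE r(1)
      by (auto simp: D_def coord_ball_def En_def coord_dist_def)
    then show ?thesis unfolding K_def using g(5) U(2) by (metis imageI)
  qed
  ultimately show ?thesis using that[of r K g "g m" n g'] r(1) KW by (simp add: D_def)
qed

lemma path_connected_coord_ball:
  assumes "\<forall>i\<ge>n. c i = 0"
  shows "path_connected (coord_ball n c r)"
proof -
  have to_c: "path_component (coord_ball n c r) c x" if x: "x \<in> coord_ball n c r" for x
    unfolding path_component_def
  proof (intro exI conjI)
    let ?g = "\<lambda>t i. c i + t * (x i - c i)"
    show "path ?g" unfolding path_def by (intro continuous_intros)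
    have "?g t \<in> coord_ball n c r" if "t \<in> {0..1}" for t
    proof -
      have "coord_dist n (?g t) c = \<bar>t\<bar> * coord_dist n x c" by (rule coord_dist_scaled) simp
      also have "\<dots> \<le> 1 * coord_dist n x c" using that coord_dist_nonneg by (intro mult_right_mono) auto
      finally show ?thesis using x assms by (auto simp: coord_ball_def)
    qed
    then show "path_image ?g \<subseteq> coord_ball n c r" by (auto simp: path_image_def)
    show "pathstart ?g = c" "pathfinish ?g = x" by (auto simp: pathstart_def pathfinish_def)
  qed
  then show ?thesis
    unfolding path_connected_component by (meson path_component_sym path_component_trans)
qed

lemma closed_connected_manifold_locally_path_connected:
  assumes B: "closed_connected_manifold B"
  shows "locally path_connected B"
proof (rule locallyI)
  fix W m assume W: "openin (top_of_set B) W" "m \<in> W"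
  obtain n c r K g g' where K: "r > 0" "K \<subseteq> W" "m \<in> K" "g m = c"
    "homeomorphism K (coord_ball n c r) g g'"
    "openin (top_of_set B) {y \<in> K. coord_dist n (g y) c < r}"
    by (rule manifold_coordinate_ball[OF B W]) blast
  have "c \<in> coord_ball n c r" using K by (auto simp: homeomorphism_def)
  then have "path_connected (coord_ball n c r)"
    by (intro path_connected_coord_ball) (auto simp: coord_ball_def)
  then have "path_connected K"
    using K(5) unfolding homeomorphism_def by (metis path_connected_continuous_image)
  moreover have "coord_dist n (g m) c < r" using K by (simp add: coord_dist_def)
  ultimately show "\<exists>U Z. openin (top_of_set B) U \<and> path_connected Z \<and> m \<in> U \<and> U \<subseteq> Z \<and> Z \<subseteq> W"
    using K by (intro exI[of _ "{y \<in> K. coord_dist n (g y) c < r}"] exI[of _ K]) auto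
qed

text \<open>At \<open>t = 1\<close> this moves \<open>c\<close> to \<open>b\<close>, and it is the identity where \<open>coord_dist n v c = r\<close>.\<close>

definition radial_push :: "nat \<Rightarrow> (nat \<Rightarrow> real) \<Rightarrow> real \<Rightarrow> (nat \<Rightarrow> real) \<Rightarrow> real \<Rightarrow> (nat \<Rightarrow> real) \<Rightarrow> nat \<Rightarrow> real" where
  "radial_push n c r b t v = (\<lambda>i. v i + t * (1 - coord_dist n v c / r) * (b i - c i))"

text \<open>A point at distance \<open>d\<close> from \<open>c\<close> is moved by at most
  \<open>(1 - d / r) * r = r - d\<close>, which is just what is left up to the boundary.\<close>

lemma radial_push_in_ball:
  assumes "r > 0" "b \<in> coord_ball n c r" "\<forall>i\<ge>n. c i = 0" "t \<in> {0..1}" "v \<in> coord_ball n c r"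
  shows "radial_push n c r b t v \<in> coord_ball n c r"
proof -
  let ?s = "1 - coord_dist n v c / r"
  have s: "0 \<le> ?s" using assms(1,5) by (simp add: coord_ball_def)
  have "coord_dist n (radial_push n c r b t v) v = \<bar>t * ?s\<bar> * coord_dist n b c"
    by (rule coord_dist_scaled) (simp add: radial_push_def)
  also have "\<dots> \<le> ?s * r"
    using assms s coord_dist_nonneg[of n b c]
    by (intro mult_mono) (auto simp: coord_ball_def abs_mult mult_left_le_one_le)
  also have "\<dots> = r - coord_dist n v c" using assms(1) by (simp add: field_simps)
  finally have "coord_dist n (radial_push n c r b t v) c \<le> r"
    using coord_dist_triangle[of n "radial_push n c r b t v" c v] by linarith
  then show ?thesis using assms by (auto simp: coord_ball_def radial_push_def)
qed

text \<open>The displacement is Lipschitz with constant \<open>coord_dist n b c / r\<close>, which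
  is less than \<open>1\<close>; two points with the same image have displacements differing by
  exactly their own difference.\<close>

lemma radial_push_inj:
  assumes "r > 0" "coord_dist n b c < r"
  shows "inj_on (radial_push n c r b 1) (coord_ball n c r)"
proof (rule inj_onI)
  fix v w assume vw: "v \<in> coord_ball n c r" "w \<in> coord_ball n c r"
    "radial_push n c r b 1 v = radial_push n c r b 1 w"
  let ?s = "(coord_dist n v c - coord_dist n w c) / r"
  have "v i - w i = ?s * (b i - c i)" for i
    using fun_cong[OF vw(3), of i] \<open>r > 0\<close> by (simp add: radial_push_def field_simps)
  then have "coord_dist n v w = \<bar>?s\<bar> * coord_dist n b c" by (rule coord_dist_scaled)
  moreover have "\<bar>?s\<bar> \<le> coord_dist n v w / r"
    using coord_dist_triangle[of n v c w] coord_dist_triangle[of n w c v] coord_dist_commute[of n v w] \<open>r > 0\<close>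
    by (simp add: abs_le_iff divide_right_mono)
  ultimately have "coord_dist n v w \<le> coord_dist n v w / r * coord_dist n b c"
    using coord_dist_nonneg mult_right_mono by metis
  then have "coord_dist n v w * (r - coord_dist n b c) \<le> 0"
    using \<open>r > 0\<close> by (simp add: field_simps)
  then have "coord_dist n v w \<le> 0" using assms(2) by (simp add: mult_le_0_iff)
  then have "v i = w i" if "i < n" for i using coord_dist_component[OF that, of v w] by auto
  moreover have "v i = w i" if "\<not> i < n" for i using vw that by (auto simp: coord_ball_def)
  ultimately show "v = w" by (metis ext)
qed

text \<open>A preimage of \<open>w\<close> must have the form \<open>w - s * (b - c)\<close> with
  \<open>s\<close> equal to the factor of the push at that point. The intermediate value theorem
  provides such an \<open>s\<close>.\<close>

lemma radial_push_surj:
  assumes "r > 0" "\<forall>i\<ge>n. c i = 0" "\<forall>i\<ge>n. b i = 0" and w: "w \<in> coord_ball n c r"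
  shows "\<exists>v\<in>coord_ball n c r. radial_push n c r b 1 v = w"
proof -
  define v where "v s = (\<lambda>i. w i - s * (b i - c i))" for s :: real
  define f where "f s = s - 1 + coord_dist n (v s) c / r" for s :: real
  have "continuous_on {0..1} f"
    unfolding f_def v_def by (intro continuous_intros continuous_on_coord_dist) (use \<open>r > 0\<close> in auto)
  moreover have "f 0 \<le> 0" using w \<open>r > 0\<close> by (simp add: f_def v_def coord_ball_def)
  moreover have "0 \<le> f 1" using coord_dist_nonneg \<open>r > 0\<close> by (simp add: f_def)
  ultimately obtain s where s: "0 \<le> s" "s \<le> 1" "f s = 0" using IVT'[of f 0 0 1] by auto
  then have eq: "1 - coord_dist n (v s) c / r = s" by (simp add: f_def)
  then have "coord_dist n (v s) c = r * (1 - s)" using \<open>r > 0\<close> by (simp add: field_simps)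
  also have "\<dots> \<le> r * 1" using s \<open>r > 0\<close> by (intro mult_left_mono) auto
  finally have "v s \<in> coord_ball n c r" using w assms by (auto simp: coord_ball_def v_def)
  moreover have "radial_push n c r b 1 (v s) = w"
    unfolding radial_push_def eq by (simp add: v_def)
  ultimately show ?thesis by blast
qed

text \<open>Transport \<open>radial_push\<close> to \<open>B\<close> by a chart centred at
  \<open>m\<close> and extend it by the identity; \<open>W\<close> is the open coordinate ball, each
  point of which can be the target of the centre.\<close>

lemma manifold_local_isotopy:
  assumes B: "closed_connected_manifold B" and "m \<in> B"
  obtains W where "openin (top_of_set B) W" "m \<in> W"
    "\<And>m'. m' \<in> W \<Longrightarrow> \<exists>H j. continuous_on ({0..1} \<times> B) H \<and> H ` ({0..1::real} \<times> B) \<subseteq> B \<and>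
       (\<forall>y\<in>B. H (0, y) = y) \<and> homeomorphism B B (\<lambda>y. H (1, y)) j \<and> H (1, m) = m'"
proof -
  obtain n c r K g g' where K: "r > 0" "closedin (top_of_set B) K" "m \<in> K" "g m = c"
    and hom: "homeomorphism K (coord_ball n c r) g g'"
    and W: "openin (top_of_set B) {y \<in> K. coord_dist n (g y) c < r}"
    by (rule manifold_coordinate_ball[OF B openin_subtopology_self \<open>m \<in> B\<close>]) blast
  define W where "W = {y \<in> K. coord_dist n (g y) c < r}"
  have KB: "K \<subseteq> B" using K(2) by (auto dest: closedin_imp_subset)
  note gK = homeomorphism_image1[OF hom] homeomorphism_image2[OF hom]
    homeomorphism_apply1[OF hom] homeomorphism_apply2[OF hom]
  have gin: "\<And>y. y \<in> K \<Longrightarrow> g y \<in> coord_ball n c r" and g'in: "\<And>v. v \<in> coord_ball n c r \<Longrightarrow> g' v \<in> K"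
    using gK(1,2) by blast+
  have c: "\<forall>i\<ge>n. c i = 0" using gin[OF K(3)] K(4) by (simp add: coord_ball_def)
  have "\<exists>H j. continuous_on ({0..1} \<times> B) H \<and> H ` ({0..1::real} \<times> B) \<subseteq> B \<and>
       (\<forall>y\<in>B. H (0, y) = y) \<and> homeomorphism B B (\<lambda>y. H (1, y)) j \<and> H (1, m) = m'" if m': "m' \<in> W" for m'
  proof -
    define b where "b = g m'"
    have b: "b \<in> coord_ball n c r" "coord_dist n b c < r" "\<forall>i\<ge>n. b i = 0"
      using m' gin by (auto simp: b_def W_def coord_ball_def)
    define \<phi> where "\<phi> = radial_push n c r b"
    have \<phi>in: "\<phi> t v \<in> coord_ball n c r" if "t \<in> {0..1}" "v \<in> coord_ball n c r" for t v
      unfolding \<phi>_def using radial_push_in_ball[OF K(1) b(1) c that] .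
    define H where "H = (\<lambda>(t, y). if y \<in> K then g' (\<phi> t (g y)) else y)"
    have HK: "H (t, y) = g' (\<phi> t (g y))" if "y \<in> K" for t y using that by (simp add: H_def)
    have HK_in: "H (t, y) \<in> K" if "y \<in> K" "t \<in> {0..1}" for t y
      using that HK g'in \<phi>in gin by auto
    have Hout: "H (t, y) = y" if "y \<in> B - W" for t y
    proof (cases "y \<in> K")
      case True
      then have "coord_dist n (g y) c = r" using that gin[OF True] by (auto simp: W_def coord_ball_def)
      then have "\<phi> t (g y) = g y" using K(1) by (simp add: \<phi>_def radial_push_def)
      then show ?thesis using True gK(3) by (simp add: H_def)
    qed (simp add: H_def)
    \<comment> \<open>\<open>K\<close> and \<open>B - W\<close> are closed, cover \<open>B\<close>,
      and meet only in the boundary sphere of the ball, where the push is the identity.\<close>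
    have "continuous_on ({0..1} \<times> K \<union> {0..1} \<times> (B - W)) H"
    proof (rule continuous_on_Un_local)
      have eq: "{0..1} \<times> K \<union> {0..1} \<times> (B - W) = {0..1::real} \<times> B" using KB by (auto simp: W_def)
      show "closedin (top_of_set ({0..1} \<times> K \<union> {0..1} \<times> (B - W))) ({0..1::real} \<times> K)"
        unfolding eq using K(2) by (intro closedin_Times) auto
      have "closedin (top_of_set B) (B - W)" using W unfolding W_def by (simp add: closedin_diff)
      then show "closedin (top_of_set ({0..1} \<times> K \<union> {0..1} \<times> (B - W))) ({0..1::real} \<times> (B - W))"
        unfolding eq by (intro closedin_Times) auto
      have gc: "continuous_on ({0..1::real} \<times> K) (\<lambda>w. g (snd w))"
        by (rule continuous_on_compose2[OF homeomorphism_cont1[OF hom]]) (auto intro!: continuous_intros)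
      have "continuous_on ({0..1::real} \<times> K) (\<lambda>w. \<phi> (fst w) (g (snd w)))"
        unfolding \<phi>_def radial_push_def
        by (intro continuous_intros continuous_on_product_then_coordinatewise[OF gc] continuous_on_coord_dist gc)
          (use K(1) in auto)
      then have "continuous_on ({0..1::real} \<times> K) (\<lambda>w. g' (\<phi> (fst w) (g (snd w))))"
        using \<phi>in gin by (intro continuous_on_compose2[OF homeomorphism_cont2[OF hom]]) auto
      then show "continuous_on ({0..1} \<times> K) H"
        by (rule continuous_on_eq) (auto simp: HK)
      show "continuous_on ({0..1} \<times> (B - W)) H"
        by (rule continuous_on_eq[of _ snd]) (auto intro!: continuous_intros simp: Hout)
    qed
    moreover have "{0..1} \<times> K \<union> {0..1} \<times> (B - W) = {0..1::real} \<times> B" using KB by (auto simp: W_def)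
    ultimately have Hc: "continuous_on ({0..1} \<times> B) H" by simp
    have HB: "H ` ({0..1::real} \<times> B) \<subseteq> B" 
    proof clarify
      fix t :: real and y assume "t \<in> {0..1}" "y \<in> B"
      then show "H (t, y) \<in> B" using HK_in[of y t] KB by (cases "y \<in> K") (auto simp: H_def)
    qed
    have H0: "\<forall>y\<in>B. H (0, y) = y"
      using gK(3) by (auto simp: H_def \<phi>_def radial_push_def)
    have Hm: "H (1, m) = m'"
    proof -
      have "\<phi> 1 c = b" by (simp add: \<phi>_def radial_push_def coord_dist_def)
      then show ?thesis using HK[OF K(3)] K(4) gK(3) m' by (simp add: b_def W_def)
    qed
    let ?h = "\<lambda>y. H (1, y)"
    have hc: "continuous_on B ?h"
      by (rule continuous_on_compose2[OF Hc]) (auto intro!: continuous_intros)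
    have hK: "?h y \<in> K \<longleftrightarrow> y \<in> K" if "y \<in> B" for y
      using HK_in[of y 1] by (auto simp: H_def)
    have inj: "inj_on ?h B"
    proof (rule inj_onI)
      fix y z assume yz: "y \<in> B" "z \<in> B" "?h y = ?h z"
      show "y = z"
      proof (cases "y \<in> K")
        case True
        then have "z \<in> K" using hK yz by metis
        then have "g' (\<phi> 1 (g y)) = g' (\<phi> 1 (g z))" using True yz by (simp add: HK)
        then have "\<phi> 1 (g y) = \<phi> 1 (g z)"
          using gK(4)[OF \<phi>in] True \<open>z \<in> K\<close> gin by (metis atLeastAtMost_iff order_refl zero_le_one)
        then have "g y = g z"
          using radial_push_inj[OF K(1) b(2)] gin True \<open>z \<in> K\<close> unfolding \<phi>_def inj_on_def by blast
        then show ?thesis using gK(3) True \<open>z \<in> K\<close> by metis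
      next
        case False
        then have "z \<notin> K" using hK yz by metis
        then show ?thesis using False yz by (simp add: H_def)
      qed
    qed
    have surj: "?h ` B = B"
    proof
      show "?h ` B \<subseteq> B" using HB by auto
      show "B \<subseteq> ?h ` B"
      proof
        fix y assume y: "y \<in> B"
        show "y \<in> ?h ` B"
        proof (cases "y \<in> K")
          case True
          then obtain v where v: "v \<in> coord_ball n c r" "\<phi> 1 v = g y"
            using radial_push_surj[OF K(1) c b(3) gin] unfolding \<phi>_def by blast
          then have "?h (g' v) = y" using HK[OF g'in] gK(3,4) True by simp
          then show ?thesis using g'in[OF v(1)] KB by (metis imageI subsetD)
        next
          case False
          then have "?h y = y" by (simp add: H_def)
          then show ?thesis using y by (metis imageI)
        qed
      qed
    qed
    \<comment> \<open>Continuity of the inverse is automatic for a continuous bijection from a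
      compact space to a Hausdorff space.\<close>
    have "homeomorphic_map (top_of_set B) (top_of_set B) ?h"
    proof (rule continuous_imp_homeomorphic_map)
      show "continuous_map (top_of_set B) (top_of_set B) ?h" using hc surj by auto
      show "compact_space (top_of_set B)" "Hausdorff_space (top_of_set B)"
        using B by (auto simp: closed_connected_manifold_def compact_space_subtopology)
    qed (use inj surj in auto)
    then obtain j where "homeomorphic_maps (top_of_set B) (top_of_set B) ?h j"
      unfolding homeomorphic_map_maps by blast
    then have "homeomorphism B B ?h j"
      by (auto simp: homeomorphic_maps_def homeomorphism_def image_iff) (metis PiE funcset_mem)+
    then show ?thesis using Hc HB H0 Hm by blast
  qed
  moreover have "openin (top_of_set B) W" "m \<in> W"
    using W K by (auto simp: W_def coord_dist_def)
  ultimately show ?thesis using that by blast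
qed

section \<open>Homogeneous inverse limits\<close>

text \<open>
  The last assumption is the triviality of the discriminant in terms of lifts: a loop with one closed
  lift far enough up the tower has only closed lifts at level \<open>i\<close>.
\<close>

locale regular_covering_tower =
  fixes P :: "nat \<Rightarrow> 'c::topological_space set" and \<pi> :: "nat \<Rightarrow> 'c \<Rightarrow> 'b::topological_space"
    and b :: "nat \<Rightarrow> 'c \<Rightarrow> 'c" and B :: "'b set"
  assumes manifold: "closed_connected_manifold B"
    and cov: "covering_space (P i) (\<pi> i) B"
    and conn: "connected (P i)"
    and bond: "continuous_on (P (Suc i)) (b i)" "y \<in> P (Suc i) \<Longrightarrow> b i y \<in> P i"
      "y \<in> P (Suc i) \<Longrightarrow> \<pi> i (b i y) = \<pi> (Suc i) y"
    and regular: "\<exists>j\<ge>i. \<forall>g w. path_lift (P j) (\<pi> j) g w w \<longrightarrow>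
      (\<forall>w' w''. path_lift (P i) (\<pi> i) g w' w'' \<longrightarrow> w'' = w')"
begin

abbreviation "S \<equiv> inverse_limit P b"
abbreviation "lift i \<equiv> path_lift (P i) (\<pi> i)"

lemma proj: "continuous_on (P i) (\<pi> i)" "\<pi> i ` P i = B"
  using cov by (auto simp: covering_space_def)

lemma threadD: "s \<in> S \<Longrightarrow> s i \<in> P i" "s \<in> S \<Longrightarrow> b i (s (Suc i)) = s i"
  by (auto simp: inverse_limit_def)

lemma thread_base: "s \<in> S \<Longrightarrow> \<pi> i (s i) = \<pi> 0 (s 0)"
  by (induction i) (metis bond(3) threadD)+

lemma base_in: "s \<in> S \<Longrightarrow> \<pi> 0 (s 0) \<in> B"
  using threadD(1) proj(2) by blast

lemma path_connected_P: "path_connected (P i)" "locally path_connected (P i)"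
  using conn cov closed_connected_manifold_locally_path_connected[OF manifold]
    covering_space_locally_path_connected_top connected_locally_path_connected by blast+

lemma thread_path:
  assumes "s \<in> S" "t \<in> S"
  obtains g where "lift i g (s i) (t i)"
  using path_connected_P(1)[of i] threadD(1)[OF assms(1)] threadD(1)[OF assms(2)] path_lift_self
  unfolding path_connected_def by metis

lemma thread_lift:
  assumes "s \<in> S" "t \<in> S" "lift n g (s n) (t n)" "i \<le> n"
  shows "lift i g (s i) (t i)"
  using \<open>i \<le> n\<close>
proof (induction rule: inc_induct)
  case (step k)
  have "lift k g (b k (s (Suc k))) (b k (t (Suc k)))"
    by (rule path_lift_map[OF step.IH bond(1)]) (use bond in auto)
  then show ?case using threadD(2) assms(1,2) by simp
qed (rule assms(3))

lemma lift_unique: "lift i g y z \<Longrightarrow> lift i g y z' \<Longrightarrow> z = z'"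
  using path_lift_unique[OF cov] .

section \<open>Symmetries of the limit covering the identity of \<open>B\<close>\<close>

text \<open>By \<open>regular\<close>, loops closing up at \<open>u j\<close> have only closed lifts
  at level \<open>i\<close>, so the lifting criterion gives a map from level \<open>j\<close> to
  level \<open>i\<close> taking \<open>u j\<close> to \<open>v i\<close>. The last conclusion
  characterises the limit map: a base path leading from \<open>u\<close> to \<open>s\<close> leads
  from \<open>v\<close> to \<open>h s\<close>. Inverses are computed from it.\<close>

lemma fibre_map:
  assumes u: "u \<in> S" and v: "v \<in> S" and uv: "\<pi> 0 (u 0) = \<pi> 0 (v 0)"
  obtains h where "continuous_on S h" "h ` S \<subseteq> S"
    "\<And>i. \<exists>j\<ge>i. \<forall>s\<in>S. \<forall>g. lift j g (u j) (s j) \<longrightarrow> lift i g (v i) (h s i)"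
proof -
  have "\<exists>j f. j \<ge> i \<and> continuous_on (P j) f \<and> f ` P j \<subseteq> P i \<and>
      (\<forall>g y. lift j g (u j) y \<longrightarrow> lift i g (v i) (f y))" for i
  proof -
    obtain j where j: "j \<ge> i" "\<And>g w w' w''. lift j g w w \<Longrightarrow> lift i g w' w'' \<Longrightarrow> w'' = w'"
      using regular by metis
    obtain f where "continuous_on (P j) f" "f ` P j \<subseteq> P i"
      "\<And>g y. lift j g (u j) y \<Longrightarrow> lift i g (v i) (f y)"
    proof (rule covering_space_lift_map[OF cov path_connected_P proj(1)])
      show "\<pi> j (u j) = \<pi> i (v i)" using thread_base[OF u] thread_base[OF v] uv by metis
      show "e = v i" if "lift j g (u j) (u j)" "lift i g (v i) e" for g e
        using j(2) that by blast
    qed (use proj threadD(1)[OF u] threadD(1)[OF v] in auto)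
    then show ?thesis using j(1) by blast
  qed
  then obtain J f where Jf: "\<And>i. J i \<ge> i" "\<And>i. continuous_on (P (J i)) (f i)" "\<And>i. f i ` P (J i) \<subseteq> P i"
    "\<And>i g y. lift (J i) g (u (J i)) y \<Longrightarrow> lift i g (v i) (f i y)"
    by metis
  define h where "h s i = f i (s (J i))" for s :: "nat \<Rightarrow> 'c" and i
  have h: "lift i g (v i) (h s i)" if "s \<in> S" "lift (J i) g (u (J i)) (s (J i))" for i s g
    using Jf(4)[OF that(2)] by (simp add: h_def)
  show ?thesis
  proof (rule that)
    show "continuous_on S h"
    proof (rule continuous_on_coordinatewise_then_product)
      show "continuous_on S (\<lambda>s. h s i)" for i
        unfolding h_def by (rule continuous_on_compose2[OF Jf(2) continuous_on_coord]) (use threadD(1) in auto)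
    qed
    show "h ` S \<subseteq> S"
    proof
      fix t assume "t \<in> h ` S"
      then obtain s where s: "s \<in> S" "t = h s" by blast
      have "h s i \<in> P i" for i using Jf(3) threadD(1)[OF s(1)] by (auto simp: h_def)
      moreover have "b i (h s (Suc i)) = h s i" for i
      proof -
        \<comment> \<open>Above both source levels, so that one base path \<open>g\<close>
          determines two consecutive coordinates of \<open>h s\<close>.\<close>
        define n where "n = max (J i) (J (Suc i))"
        obtain g where g: "lift n g (u n) (s n)" using thread_path[OF u s(1)] .
        have "lift (Suc i) g (v (Suc i)) (h s (Suc i))" "lift i g (v i) (h s i)"
          by (intro h s(1) thread_lift[OF u s(1) g], simp add: n_def)+
        moreover from this(1) have "lift i g (b i (v (Suc i))) (b i (h s (Suc i)))"
          by (rule path_lift_map[OF _ bond(1)]) (use bond in auto)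
        ultimately show ?thesis using lift_unique threadD(2)[OF v] by metis
      qed
      ultimately show "t \<in> S" using s(2) by (simp add: inverse_limit_def)
    qed
    show "\<exists>j\<ge>i. \<forall>s\<in>S. \<forall>g. lift j g (u j) (s j) \<longrightarrow> lift i g (v i) (h s i)" for i
      using Jf(1) h by blast
  qed
qed

text \<open>A base path leading from \<open>u\<close> to \<open>s\<close> leads from
  \<open>v\<close> to \<open>h s\<close>, hence from \<open>u\<close> to \<open>k (h s)\<close>;
  lifts from \<open>u\<close> have unique ends.\<close>

lemma fibre_map_inverse:
  assumes u: "u \<in> S" and v: "v \<in> S"
    and h: "h ` S \<subseteq> S" "\<And>i. \<exists>j\<ge>i. \<forall>s\<in>S. \<forall>g. lift j g (u j) (s j) \<longrightarrow> lift i g (v i) (h s i)"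
    and k: "\<And>i. \<exists>j\<ge>i. \<forall>s\<in>S. \<forall>g. lift j g (v j) (s j) \<longrightarrow> lift i g (u i) (k s i)"
    and s: "s \<in> S"
  shows "k (h s) = s"
proof
  fix i
  obtain j where j: "j \<ge> i" "\<And>s g. s \<in> S \<Longrightarrow> lift j g (v j) (s j) \<Longrightarrow> lift i g (u i) (k s i)"
    using k by metis
  obtain l where l: "l \<ge> j" "\<And>s g. s \<in> S \<Longrightarrow> lift l g (u l) (s l) \<Longrightarrow> lift j g (v j) (h s j)"
    using h(2) by metis
  obtain g where g: "lift l g (u l) (s l)" using thread_path[OF u s] .
  have "h s \<in> S" using h(1) s by blast
  then have "lift i g (u i) (k (h s) i)" using j(2) l(2)[OF s g] by blast
  moreover have "lift i g (u i) (s i)" using thread_lift[OF u s g] j(1) l(1) by simp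
  ultimately show "k (h s) i = s i" by (rule lift_unique)
qed

lemma fibre_homeomorphism:
  assumes u: "u \<in> S" and v: "v \<in> S" and uv: "\<pi> 0 (u 0) = \<pi> 0 (v 0)"
  obtains h k where "homeomorphism S S h k" "h u = v"
proof -
  obtain h where h: "continuous_on S h" "h ` S \<subseteq> S"
    "\<And>i. \<exists>j\<ge>i. \<forall>s\<in>S. \<forall>g. lift j g (u j) (s j) \<longrightarrow> lift i g (v i) (h s i)"
    using fibre_map[OF u v uv] by blast
  obtain k where k: "continuous_on S k" "k ` S \<subseteq> S"
    "\<And>i. \<exists>j\<ge>i. \<forall>s\<in>S. \<forall>g. lift j g (v j) (s j) \<longrightarrow> lift i g (u i) (k s i)"
    using fibre_map[OF v u uv[symmetric]] by blast
  have kh: "\<And>s. s \<in> S \<Longrightarrow> k (h s) = s" using fibre_map_inverse[OF u v h(2,3) k(3)] .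
  have hk: "\<And>s. s \<in> S \<Longrightarrow> h (k s) = s" using fibre_map_inverse[OF v u k(2,3) h(3)] .
  have "homeomorphism S S h k"
    by (rule homeomorphismI[OF h(1) k(1)]) (use h(2) k(2) hk kh in auto)
  moreover have "h u = v"
  proof
    fix i
    obtain j where j: "\<And>g. lift j g (u j) (u j) \<Longrightarrow> lift i g (v i) (h u i)" using h(3) u by metis
    \<comment> \<open>Apply the characterisation of \<open>h\<close> to the constant path.\<close>
    have "\<pi> j (u j) = \<pi> i (v i)" using thread_base[OF u] thread_base[OF v] uv by metis
    moreover have "lift j (\<lambda>_. \<pi> j (u j)) (u j) (u j)" using path_lift_const threadD(1)[OF u] .
    moreover have "lift i (\<lambda>_. \<pi> i (v i)) (v i) (v i)" using path_lift_const threadD(1)[OF v] .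
    ultimately show "h u i = v i" using j lift_unique by metis
  qed
  ultimately show ?thesis using that by blast
qed

section \<open>Symmetries that move the base point\<close>

text \<open>Homotopy lifting with parameter space the whole level \<open>P i\<close>, started at its
  identity map.\<close>

lemma lifted_isotopy:
  assumes H: "continuous_on ({0..1} \<times> B) H" "H ` ({0..1::real} \<times> B) \<subseteq> B" "\<And>y. y \<in> B \<Longrightarrow> H (0, y) = y"
  obtains L where "\<And>i. continuous_on ({0..1} \<times> P i) (L i)" "\<And>i. L i ` ({0..1} \<times> P i) \<subseteq> P i"
    "\<And>i y. y \<in> P i \<Longrightarrow> L i (0, y) = y"
    "\<And>i t y. y \<in> P i \<Longrightarrow> t \<in> {0..1} \<Longrightarrow> \<pi> i (L i (t, y)) = H (t, \<pi> i y)"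
proof -
  have "\<exists>k. continuous_on ({0..1} \<times> P i) k \<and> k ` ({0..1} \<times> P i) \<subseteq> P i \<and> (\<forall>y\<in>P i. k (0, y) = y) \<and>
      (\<forall>y\<in>P i. \<forall>t\<in>{0..1}. \<pi> i (k (t, y)) = H (t, \<pi> i y))" for i
  proof -
    have in_B: "\<pi> i y \<in> B" if "y \<in> P i" for y using proj(2) that by blast
    obtain k where "continuous_on ({0..1} \<times> P i) k" "k ` ({0..1} \<times> P i) \<subseteq> P i"
      "\<And>y. y \<in> P i \<Longrightarrow> k (0, y) = id y"
      "\<And>z. z \<in> {0..1} \<times> P i \<Longrightarrow> \<pi> i (k z) = H (fst z, \<pi> i (snd z))"
    proof (rule covering_space_lift_homotopy_top[OF cov, of "P i" "\<lambda>z. H (fst z, \<pi> i (snd z))" id i])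
      show "continuous_on ({0..1} \<times> P i) (\<lambda>z. H (fst z, \<pi> i (snd z)))"
        by (intro continuous_on_compose2[OF H(1)] continuous_intros continuous_on_compose2[OF proj(1)])
          (use in_B in auto)
      show "(\<lambda>z. H (fst z, \<pi> i (snd z))) ` ({0..1} \<times> P i) \<subseteq> B"
        using H(2) in_B by (auto simp: image_subset_iff)
    qed (use H(3) in_B in \<open>auto simp: continuous_on_id'\<close>)
    then show ?thesis by (intro exI[of _ k]) auto
  qed
  then show ?thesis using that by metis
qed

lemma lift_end_unique:
  assumes "continuous_on {0..1} f" "f ` {0..1::real} \<subseteq> P i" "continuous_on {0..1} f'" "f' ` {0..1} \<subseteq> P i"
    and "\<And>t. t \<in> {0..1} \<Longrightarrow> \<pi> i (f t) = \<pi> i (f' t)" "f 0 = f' 0"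
  shows "f 1 = f' 1"
  by (rule covering_space_lift_unique_top[OF cov connected_Icc, of 0 1 f i f' 0]) (use assms in auto)

lemma isotopy_slice:
  assumes "continuous_on ({0..1::real} \<times> P i) L" "L ` ({0..1} \<times> P i) \<subseteq> P i" "y \<in> P i"
  shows "continuous_on {0..1} (\<lambda>t. L (t, y))" "(\<lambda>t. L (t, y)) ` {0..1} \<subseteq> P i"
    "continuous_on {0..1} (\<lambda>t. L (1 - t, y))" "(\<lambda>t. L (1 - t, y)) ` {0..1} \<subseteq> P i"
  using assms(2,3) by (auto intro!: continuous_on_compose2[OF assms(1)] continuous_intros)

text \<open>Following the isotopy and then the bonding map, or the bonding map and then the isotopy,
  lifts the same path in \<open>B\<close> from the same point. Unique lifting makes the ends agree,
  so the lifts act on threads.\<close>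

lemma lifted_isotopy_bond:
  assumes L: "\<And>i. continuous_on ({0..1::real} \<times> P i) (L i)" "\<And>i. L i ` ({0..1} \<times> P i) \<subseteq> P i"
    "\<And>i y. y \<in> P i \<Longrightarrow> L i (0, y) = y"
    "\<And>i t y. y \<in> P i \<Longrightarrow> t \<in> {0..1} \<Longrightarrow> \<pi> i (L i (t, y)) = H (t, \<pi> i y)"
  shows "continuous_on S (\<lambda>s i. L i (1, s i))" "(\<lambda>s i. L i (1, s i)) ` S \<subseteq> S"
proof -
  have bond_L: "b i (L (Suc i) (1, y)) = L i (1, b i y)" if y: "y \<in> P (Suc i)" for i y
  proof (rule lift_end_unique[of "\<lambda>t. b i (L (Suc i) (t, y))" i "\<lambda>t. L i (t, b i y)"])
    have bP: "b i y \<in> P i" using bond(2) y .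
    note s1 = isotopy_slice[OF L(1,2) y] and s2 = isotopy_slice[OF L(1,2) bP]
    show "continuous_on {0..1} (\<lambda>t. b i (L (Suc i) (t, y)))"
      using continuous_on_compose2[OF bond(1) s1(1,2)] .
    show "(\<lambda>t. b i (L (Suc i) (t, y))) ` {0..1} \<subseteq> P i" using s1(2) bond(2) by blast
    show "continuous_on {0..1} (\<lambda>t. L i (t, b i y))" "(\<lambda>t. L i (t, b i y)) ` {0..1} \<subseteq> P i"
      using s2 by auto
    show "\<pi> i (b i (L (Suc i) (t, y))) = \<pi> i (L i (t, b i y))" if "t \<in> {0..1}" for t
    proof -
      have "L (Suc i) (t, y) \<in> P (Suc i)" using s1(2) that by blast
      then show ?thesis using L(4)[OF y that] L(4)[OF bP that] bond(3)[OF y] bond(3) by simp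
    qed
    show "b i (L (Suc i) (0, y)) = L i (0, b i y)" using L(3) y bP by simp
  qed
  show "continuous_on S (\<lambda>s i. L i (1, s i))"
  proof (rule continuous_on_coordinatewise_then_product)
    fix i
    have "continuous_on S (\<lambda>s. (1::real, s i))"
      by (intro continuous_intros continuous_on_coord)
    then show "continuous_on S (\<lambda>s. L i (1, s i))"
      by (rule continuous_on_compose2[OF L(1)]) (use threadD(1) in auto)
  qed
  show "(\<lambda>s i. L i (1, s i)) ` S \<subseteq> S"
  proof
    fix t assume "t \<in> (\<lambda>s i. L i (1, s i)) ` S"
    then obtain s where s: "s \<in> S" "t = (\<lambda>i. L i (1, s i))" by blast
    have "t i \<in> P i" for i using L(2)[of i] threadD(1)[OF s(1)] by (auto simp: s(2))
    moreover have "b i (t (Suc i)) = t i" for i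
      using bond_L threadD[OF s(1)] by (simp add: s(2))
    ultimately show "t \<in> S" by (simp add: inverse_limit_def)
  qed
qed

text \<open>Only the end of \<open>H\<close> is assumed invertible. Reversing time and composing
  with \<open>j\<close> again gives a homotopy starting at the identity, without inverting the
  intermediate stages.\<close>

lemma isotopy_homeomorphism:
  assumes H: "continuous_on ({0..1} \<times> B) H" "H ` ({0..1::real} \<times> B) \<subseteq> B" "\<And>y. y \<in> B \<Longrightarrow> H (0, y) = y"
    and hom: "homeomorphism B B (\<lambda>y. H (1, y)) j"
  obtains h k where "homeomorphism S S h k" "\<And>s. s \<in> S \<Longrightarrow> \<pi> 0 (h s 0) = H (1, \<pi> 0 (s 0))"
proof -
  have j: "\<And>y. y \<in> B \<Longrightarrow> j y \<in> B" "\<And>y. y \<in> B \<Longrightarrow> H (1, j y) = y" "\<And>y. y \<in> B \<Longrightarrow> j (H (1, y)) = y"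
    using hom by (auto simp: homeomorphism_def)
  \<comment> \<open>The isotopy run backwards; its lift ends at the inverse of the end of the lift of \<open>H\<close>.\<close>
  define H' where "H' = (\<lambda>(t, y). H (1 - t, j y))"
  obtain L where L: "\<And>i. continuous_on ({0..1} \<times> P i) (L i)" "\<And>i. L i ` ({0..1} \<times> P i) \<subseteq> P i"
    "\<And>i y. y \<in> P i \<Longrightarrow> L i (0, y) = y"
    "\<And>i t y. y \<in> P i \<Longrightarrow> t \<in> {0..1} \<Longrightarrow> \<pi> i (L i (t, y)) = H (t, \<pi> i y)"
    using lifted_isotopy[OF H] by blast
  obtain L' where L': "\<And>i. continuous_on ({0..1} \<times> P i) (L' i)" "\<And>i. L' i ` ({0..1} \<times> P i) \<subseteq> P i"
    "\<And>i y. y \<in> P i \<Longrightarrow> L' i (0, y) = y"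
    "\<And>i t y. y \<in> P i \<Longrightarrow> t \<in> {0..1} \<Longrightarrow> \<pi> i (L' i (t, y)) = H' (t, \<pi> i y)"
  proof (rule lifted_isotopy[of H'])
    have jc: "continuous_on ({0..1::real} \<times> B) (\<lambda>z. j (snd z))"
      by (rule continuous_on_compose2[OF homeomorphism_cont2[OF hom]]) (auto intro!: continuous_intros)
    show "continuous_on ({0..1} \<times> B) H'"
      unfolding H'_def case_prod_beta
      by (rule continuous_on_compose2[OF H(1)]) (use j in \<open>auto intro!: continuous_intros jc\<close>)
    show "H' ` ({0..1} \<times> B) \<subseteq> B" using H(2) j(1) by (auto simp: H'_def image_subset_iff)
    show "H' (0, y) = y" if "y \<in> B" for y using that j by (simp add: H'_def)
  qed blast
  have in_B: "\<pi> i y \<in> B" if "y \<in> P i" for i y using proj(2) that by blast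
  have in_P: "L i (1, y) \<in> P i" "L' i (1, y) \<in> P i" if "y \<in> P i" for i y
    using L(2)[of i] L'(2)[of i] that by auto
  have L'L: "L' i (1, L i (1, y)) = y" if y: "y \<in> P i" for i y
  proof -
    \<comment> \<open>Both sides are lifts of the path taking \<open>t\<close> to
      \<open>H (1 - t, \<pi> i y)\<close>, both starting at \<open>L i (1, y)\<close>; compare their
      ends.\<close>
    have "L' i (1, L i (1, y)) = L i (1 - 1, y)"
    proof (rule lift_end_unique[of "\<lambda>t. L' i (t, L i (1, y))" i "\<lambda>t. L i (1 - t, y)"])
      show "\<pi> i (L' i (t, L i (1, y))) = \<pi> i (L i (1 - t, y))" if "t \<in> {0..1}" for t
        using that L(4)[OF y] L'(4)[OF in_P(1)[OF y]] j(3)[OF in_B[OF y]] by (simp add: H'_def)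
    qed (use isotopy_slice[OF L'(1,2) in_P(1)[OF y]] isotopy_slice[OF L(1,2) y] L'(3)[OF in_P(1)[OF y]] in auto)
    then show ?thesis using L(3) y by simp
  qed
  have LL': "L i (1, L' i (1, y)) = y" if y: "y \<in> P i" for i y
  proof -
    have "L i (1, L' i (1, y)) = L' i (1 - 1, y)"
    proof (rule lift_end_unique[of "\<lambda>t. L i (t, L' i (1, y))" i "\<lambda>t. L' i (1 - t, y)"])
      show "\<pi> i (L i (t, L' i (1, y))) = \<pi> i (L' i (1 - t, y))" if "t \<in> {0..1}" for t
        using that L'(4)[OF y] L(4)[OF in_P(2)[OF y]] H(3)[OF j(1)[OF in_B[OF y]]] by (simp add: H'_def)
    qed (use isotopy_slice[OF L(1,2) in_P(2)[OF y]] isotopy_slice[OF L'(1,2) y] L(3)[OF in_P(2)[OF y]] in auto)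
    then show ?thesis using L'(3) y by simp
  qed
  have "homeomorphism S S (\<lambda>s i. L i (1, s i)) (\<lambda>s i. L' i (1, s i))"
    by (rule homeomorphismI[OF lifted_isotopy_bond(1)[OF L] lifted_isotopy_bond(1)[OF L']
          lifted_isotopy_bond(2)[OF L] lifted_isotopy_bond(2)[OF L']])
      (use LL' L'L threadD(1) in auto)
  moreover have "\<pi> 0 (L 0 (1, s 0)) = H (1, \<pi> 0 (s 0))" if "s \<in> S" for s
    using L(4) threadD(1)[OF that] by simp
  ultimately show ?thesis using that by blast
qed

text \<open>Being related by a homeomorphism that carries one fibre into the other is an equivalence
  relation on \<open>B\<close> with open classes, so connectedness leaves one class. A symmetry
  covering the identity then corrects the position inside the target fibre.\<close>

lemma homogeneous_inverse_limit: "homogeneous_space S"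
  unfolding homogeneous_space_def
proof (intro ballI)
  fix u v assume u: "u \<in> S" and v: "v \<in> S"
  \<comment> \<open>The clause for the inverse \<open>k\<close> is what makes the relation
    symmetric.\<close>
  define R where "R m m' \<longleftrightarrow> (\<exists>h k. homeomorphism S S h k \<and> (\<forall>s\<in>S. \<pi> 0 (s 0) = m \<longrightarrow> \<pi> 0 (h s 0) = m') \<and>
      (\<forall>s\<in>S. \<pi> 0 (s 0) = m' \<longrightarrow> \<pi> 0 (k s 0) = m))" for m m'
  have "connected B" using manifold by (simp add: closed_connected_manifold_def)
  then have "R (\<pi> 0 (u 0)) (\<pi> 0 (v 0))"
  proof (rule connected_equivalence_relation)
    show "\<pi> 0 (u 0) \<in> B" "\<pi> 0 (v 0) \<in> B" using base_in u v by auto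
    show "R m' m" if "R m m'" for m m'
      using that unfolding R_def by (meson homeomorphism_symD)
    show "R m m''" if R1: "R m m'" and R2: "R m' m''" for m m' m''
    proof -
      obtain h k where 1: "homeomorphism S S h k" "\<forall>s\<in>S. \<pi> 0 (s 0) = m \<longrightarrow> \<pi> 0 (h s 0) = m'"
        "\<forall>s\<in>S. \<pi> 0 (s 0) = m' \<longrightarrow> \<pi> 0 (k s 0) = m"
        using R1 unfolding R_def by blast
      obtain h' k' where 2: "homeomorphism S S h' k'" "\<forall>s\<in>S. \<pi> 0 (s 0) = m' \<longrightarrow> \<pi> 0 (h' s 0) = m''"
        "\<forall>s\<in>S. \<pi> 0 (s 0) = m'' \<longrightarrow> \<pi> 0 (k' s 0) = m'"
        using R2 unfolding R_def by blast
      have "h s \<in> S" "k' s \<in> S" if "s \<in> S" for s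
        using homeomorphism_image1[OF 1(1)] homeomorphism_image2[OF 2(1)] that by blast+
      then show ?thesis
        unfolding R_def using homeomorphism_compose[OF 1(1) 2(1)] 1(2,3) 2(2,3)
        by (intro exI[of _ "h' \<circ> h"] exI[of _ "k \<circ> k'"]) simp
    qed
    fix m assume m: "m \<in> B"
    obtain W where W: "openin (top_of_set B) W" "m \<in> W"
      "\<And>m'. m' \<in> W \<Longrightarrow> \<exists>H j. continuous_on ({0..1} \<times> B) H \<and> H ` ({0..1::real} \<times> B) \<subseteq> B \<and>
         (\<forall>y\<in>B. H (0, y) = y) \<and> homeomorphism B B (\<lambda>y. H (1, y)) j \<and> H (1, m) = m'"
      by (rule manifold_local_isotopy[OF manifold m]) blast
    have "R m m'" if "m' \<in> W" for m'
    proof -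
      obtain H j where H: "continuous_on ({0..1} \<times> B) H" "H ` ({0..1::real} \<times> B) \<subseteq> B"
        "\<And>y. y \<in> B \<Longrightarrow> H (0, y) = y" and hom: "homeomorphism B B (\<lambda>y. H (1, y)) j" and Hm: "H (1, m) = m'"
        using W(3)[OF \<open>m' \<in> W\<close>] by blast
      obtain h k where hk: "homeomorphism S S h k" "\<And>s. s \<in> S \<Longrightarrow> \<pi> 0 (h s 0) = H (1, \<pi> 0 (s 0))"
        using isotopy_homeomorphism[OF H hom] by blast
      have "\<pi> 0 (k s 0) = m" if s: "s \<in> S" "\<pi> 0 (s 0) = m'" for s
      proof -
        have ks: "k s \<in> S" using homeomorphism_image2[OF hk(1)] s by blast
        have "H (1, \<pi> 0 (k s 0)) = \<pi> 0 (h (k s) 0)" using hk(2)[OF ks] by simp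
        also have "\<dots> = H (1, m)" using homeomorphism_apply2[OF hk(1)] s Hm by simp
        finally show ?thesis using homeomorphism_apply1[OF hom] base_in[OF ks] m by metis
      qed
      then show ?thesis unfolding R_def using hk Hm by blast
    qed
    then show "\<exists>T. openin (top_of_set B) T \<and> m \<in> T \<and> (\<forall>x\<in>T. R m x)" using W by blast
  qed
  then obtain h k where hk: "homeomorphism S S h k" "\<pi> 0 (h u 0) = \<pi> 0 (v 0)"
    using u unfolding R_def by blast
  have hu: "h u \<in> S" using homeomorphism_image1[OF hk(1)] u by blast
  obtain h' k' where h'k': "homeomorphism S S h' k'" "h' (h u) = v"
    using fibre_homeomorphism[OF hu v hk(2)] by blast
  then show "\<exists>h k. homeomorphism S S h k \<and> h u = v"
    using homeomorphism_compose[OF hk(1) h'k'(1)] by (intro exI[of _ "h' \<circ> h"] exI[of _ "k \<circ> k'"]) simp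
qed

end

section \<open>Finite discriminant groups\<close>

context group begin

lemma normal_core_iff:
  assumes "H \<subseteq> carrier G"
  shows "x \<in> normal_core G H \<longleftrightarrow> x \<in> carrier G \<and> (\<forall>g\<in>carrier G. inv g \<otimes> x \<otimes> g \<in> H)"
proof
  assume x: "x \<in> normal_core G H"
  have "x \<in> carrier G \<and> inv g \<otimes> x \<otimes> g \<in> H" if g: "g \<in> carrier G" for g
  proof -
    obtain h where h: "h \<in> H" "x = g \<otimes> (h \<otimes> inv g)"
      using x g unfolding normal_core_def l_coset_def r_coset_def by blast
    have hG: "h \<in> carrier G" using h assms by blast
    then have "inv g \<otimes> x \<otimes> g = h" using g h(2) by (simp add: m_assoc) (simp add: m_assoc[symmetric])
    then show ?thesis using h g hG by simp
  qed
  then show "x \<in> carrier G \<and> (\<forall>g\<in>carrier G. inv g \<otimes> x \<otimes> g \<in> H)" by blast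
next
  assume x: "x \<in> carrier G \<and> (\<forall>g\<in>carrier G. inv g \<otimes> x \<otimes> g \<in> H)"
  show "x \<in> normal_core G H"
    unfolding normal_core_def
  proof
    fix g assume g: "g \<in> carrier G"
    have "x = g \<otimes> ((inv g \<otimes> x \<otimes> g) \<otimes> inv g)"
      using x g by (simp add: m_assoc) (simp add: m_assoc[symmetric])
    then show "x \<in> g <# (H #> inv g)"
      using x g unfolding l_coset_def r_coset_def by blast
  qed
qed

lemma normal_core_mono:
  assumes "H \<subseteq> K" "K \<subseteq> carrier G"
  shows "normal_core G H \<subseteq> normal_core G K"
  using normal_core_iff[of H] normal_core_iff[of K] assms by blast

lemma subgroup_normal_core:
  assumes H: "subgroup H G"
  shows "subgroup (normal_core G H) G"
proof (rule subgroupI)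
  note iff = normal_core_iff[OF subgroup.subset[OF H]]
  show "normal_core G H \<subseteq> carrier G" using iff by blast
  have "\<one> \<in> normal_core G H" using iff subgroup.one_closed[OF H] by simp
  then show "normal_core G H \<noteq> {}" by blast
  fix x assume x: "x \<in> normal_core G H"
  have "inv g \<otimes> inv x \<otimes> g \<in> H" if g: "g \<in> carrier G" for g
  proof -
    have "inv (inv g \<otimes> x \<otimes> g) \<in> H" using x iff g subgroup.m_inv_closed[OF H] by blast
    moreover have "inv (inv g \<otimes> x \<otimes> g) = inv g \<otimes> inv x \<otimes> g"
      using x iff g by (simp add: inv_mult_group m_assoc)
    ultimately show ?thesis by simp
  qed
  then show "inv x \<in> normal_core G H" using iff x by simp
  fix y assume y: "y \<in> normal_core G H"
  have "inv g \<otimes> (x \<otimes> y) \<otimes> g \<in> H" if g: "g \<in> carrier G" for g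
  proof -
    have xy: "x \<in> carrier G" "y \<in> carrier G" using x y iff by auto
    have "(inv g \<otimes> x \<otimes> g) \<otimes> (inv g \<otimes> y \<otimes> g) \<in> H"
      using x y iff g subgroup.m_closed[OF H] by blast
    moreover have "(inv g \<otimes> x \<otimes> g) \<otimes> (inv g \<otimes> y \<otimes> g) = inv g \<otimes> (x \<otimes> y) \<otimes> g"
    proof -
      have "g \<otimes> (inv g \<otimes> (y \<otimes> g)) = y \<otimes> g" using xy g by (simp add: m_assoc[symmetric])
      then show ?thesis using xy g by (simp add: m_assoc)
    qed
    ultimately show ?thesis by simp
  qed
  then show "x \<otimes> y \<in> normal_core G H" using iff x y by simp
qed

text \<open>Evaluates the bonding maps of the discriminant group on cosets of normal cores.\<close>

lemma subgroup_mult_r_coset: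
  assumes H: "subgroup H G" and K: "subgroup K G" "K \<subseteq> H" and g: "g \<in> carrier G"
  shows "H <#> (K #> g) = H #> g"
proof -
  have "H <#> K = H"
  proof
    show "H <#> K \<subseteq> H" using K(2) subgroup.m_closed[OF H] by (auto simp: set_mult_def)
    show "H \<subseteq> H <#> K"
    proof
      fix h assume h: "h \<in> H"
      then have "h = h \<otimes> \<one>" using subgroup.mem_carrier[OF H] by simp
      then show "h \<in> H <#> K" using h subgroup.one_closed[OF K(1)] by (auto simp: set_mult_def)
    qed
  qed
  moreover have "H <#> (K #> g) = H <#> K #> g"
    using setmult_rcos_assoc subgroup.subset[OF H] subgroup.subset[OF K(1)] g by blast
  ultimately show ?thesis by simp
qed

lemma carrier_chain_quotient:
  "carrier (chain_quotient G H i) = {normal_core G (H i) #> g |g. g \<in> H i}"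
  by (auto simp: chain_quotient_def FactGroup_def RCOSETS_def r_coset_def)

lemma carrier_discriminant_group:
  "carrier (discriminant_group G H) =
     {s. \<forall>i. (\<exists>g\<in>H i. s i = normal_core G (H i) #> g) \<and> normal_core G (H i) <#> s (Suc i) = s i}"
  unfolding discriminant_group_def inverse_limit_def carrier_chain_quotient by (simp, blast)

text \<open>If the inclusion failed for some \<open>i\<close> and all \<open>j\<close>, there would
  be elements \<open>g j\<close> of \<open>H j\<close> in \<open>C n\<close> outside
  \<open>C i\<close>. The finitely many cosets at each level let a compatible sequence of cosets be
  extracted; it is an element of the discriminant trivial at level \<open>n\<close> but not at level
  \<open>i\<close>, against the choice of \<open>n\<close>.\<close>

lemma finite_discriminant_stable:
  assumes H: "\<And>i. subgroup (H i) G" "\<And>i. H (Suc i) \<subseteq> H i"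
    and fin_index: "\<And>i. finite ((\<lambda>g. normal_core G (H i) #> g) ` H i)"
    and fin: "finite (carrier (discriminant_group G H))"
  shows "\<exists>n. \<forall>i. \<exists>j\<ge>i. H j \<inter> normal_core G (H n) \<subseteq> normal_core G (H i)"
proof -
  define C where "C i = normal_core G (H i)" for i
  define D where "D = carrier (discriminant_group G H)"
  have HG: "H i \<subseteq> carrier G" for i using subgroup.subset[OF H(1)] .
  have C: "subgroup (C i) G" "C (Suc i) \<subseteq> C i" "C i \<subseteq> carrier G" for i
    unfolding C_def using subgroup_normal_core[OF H(1)] normal_core_mono[OF H(2) HG]
    by (auto dest: subgroup.subset)
  have anti: "H j \<subseteq> H i" if "i \<le> j" for i j using H(2) that by (rule lift_Suc_antimono_le)
  have D: "s \<in> D \<longleftrightarrow> (\<forall>i. (\<exists>g\<in>H i. s i = C i #> g) \<and> C i <#> s (Suc i) = s i)" for s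
    by (simp add: D_def C_def carrier_discriminant_group)
  have CC: "C i <#> (C (Suc i) #> g) = C i #> g" if "g \<in> carrier G" for g i
    using subgroup_mult_r_coset[OF C(1) C(1) C(2) that] .
  have C1: "C i #> \<one> = C i" for i using C(3) by (rule coset_mult_one)
  have descend: "s i = C i" if "s \<in> D" "s n = C n" "i \<le> n" for s i n
    using \<open>i \<le> n\<close>
  proof (induction rule: inc_induct)
    case (step k)
    have "s k = C k <#> s (Suc k)" using \<open>s \<in> D\<close> D by metis
    then show ?case using step CC[OF one_closed] C1 by metis
  qed (rule that(2))
  obtain n where n: "\<And>s. s \<in> D \<Longrightarrow> s n = C n \<Longrightarrow> s = C"
  proof -
    \<comment> \<open>A level at which \<open>s\<close> is nontrivial. Triviality descends to lower
      levels, so a level above all these finitely many values detects every nontrivial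
      element.\<close>
    define N where "N s = (SOME m. s m \<noteq> C m)" for s
    have "s = C" if s: "s \<in> D" "s (Max (insert 0 (N ` D))) = C (Max (insert 0 (N ` D)))" for s
    proof (rule ccontr)
      assume "s \<noteq> C"
      then have "\<exists>m. s m \<noteq> C m" by (simp add: fun_eq_iff)
      then have "s (N s) \<noteq> C (N s)" unfolding N_def by (rule someI_ex)
      moreover have "N s \<le> Max (insert 0 (N ` D))" using fin s(1) by (intro Max_ge) (auto simp: D_def)
      ultimately show False using descend[OF s] by blast
    qed
    then show ?thesis using that by blast
  qed
  have "\<exists>j\<ge>i. H j \<inter> C n \<subseteq> C i" for i
  proof (rule ccontr)
    assume "\<not> (\<exists>j\<ge>i. H j \<inter> C n \<subseteq> C i)"
    then have "\<forall>j. \<exists>g. j \<ge> i \<longrightarrow> g \<in> H j \<inter> C n \<and> g \<notin> C i" by blast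
    then obtain g where g: "\<And>j. j \<ge> i \<Longrightarrow> g j \<in> H j \<inter> C n \<and> g j \<notin> C i" by metis
    \<comment> \<open>The bound \<open>m \<le> j\<close> ensures that \<open>g j\<close> lies in
      \<open>H m\<close>, so that its coset occurs at level \<open>m\<close> of the
      discriminant.\<close>
    define A where "A m K = {j. i \<le> j \<and> m \<le> j \<and> C m #> g j = K}" for m K
    have gH: "g j \<in> H m" if "i \<le> j" "m \<le> j" for j m using g anti that by blast
    have refine: "\<exists>j\<in>A'. infinite {k \<in> A'. C m #> g k = C m #> g j}"
      if "infinite A'" "\<And>j. j \<in> A' \<Longrightarrow> i \<le> j \<and> m \<le> j" for A' m
    proof -
      have "(\<lambda>j. C m #> g j) ` A' \<subseteq> (\<lambda>g. C m #> g) ` H m" using gH that(2) by blast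
      then have "finite ((\<lambda>j. C m #> g j) ` A')"
        using fin_index[of m] unfolding C_def by (rule finite_subset)
      then show ?thesis using pigeonhole_infinite[OF that(1), of "\<lambda>j. C m #> g j"] by auto
    qed
    \<comment> \<open>Koenig's lemma: follow cosets that contain infinitely many of the \<open>g j\<close>.\<close>
    have "\<exists>K. \<forall>m. infinite (A m (K m)) \<and> C m <#> K (Suc m) = K m"
    proof (rule dependent_nat_choice)
      have "infinite {i..}" by (rule infinite_Ici)
      then obtain j where "infinite {k \<in> {i..}. C 0 #> g k = C 0 #> g j}" using refine[of "{i..}" 0] by auto
      then show "\<exists>K. infinite (A 0 K)" unfolding A_def by auto
    next
      fix K m assume "infinite (A m K)"
      \<comment> \<open>Indices up to \<open>m\<close> are dropped to have \<open>g j\<close> in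
        \<open>H (Suc m)\<close>; infinitely many remain.\<close>
      moreover have "A m K \<subseteq> (A m K \<inter> {Suc m..}) \<union> {..m}" by auto
      ultimately have "infinite (A m K \<inter> {Suc m..})"
        by (meson finite_UnI finite_atMost finite_subset)
      moreover have "i \<le> j \<and> Suc m \<le> j" if "j \<in> A m K \<inter> {Suc m..}" for j
        using that by (simp add: A_def)
      ultimately obtain j where j: "j \<in> A m K \<inter> {Suc m..}"
        "infinite {k \<in> A m K \<inter> {Suc m..}. C (Suc m) #> g k = C (Suc m) #> g j}"
        using refine[of "A m K \<inter> {Suc m..}" "Suc m"] by blast
      have "{k \<in> A m K \<inter> {Suc m..}. C (Suc m) #> g k = C (Suc m) #> g j} \<subseteq> A (Suc m) (C (Suc m) #> g j)"
        unfolding A_def by fastforce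
      then have "infinite (A (Suc m) (C (Suc m) #> g j))"
        using j(2) infinite_super by blast
      moreover have "C m <#> (C (Suc m) #> g j) = K"
      proof -
        have "g j \<in> carrier G" "K = C m #> g j" using j(1) gH[of j m] HG by (auto simp: A_def)
        then show ?thesis using CC by simp
      qed
      ultimately show "\<exists>K'. infinite (A (Suc m) K') \<and> C m <#> K' = K" by blast
    qed
    then obtain K where K: "\<And>m. infinite (A m (K m))" "\<And>m. C m <#> K (Suc m) = K m" by blast
    have ex: "\<exists>j. j \<in> A m (K m)" for m using infinite_imp_nonempty[OF K(1)[of m]] by blast
    have rep: "\<exists>j. i \<le> j \<and> m \<le> j \<and> K m = C m #> g j" for m using ex[of m] by (auto simp: A_def)
    then have "K \<in> D" unfolding D using K(2) gH by metis
    \<comment> \<open>Every \<open>g j\<close> with \<open>i \<le> j\<close> lies in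
      \<open>C n\<close>, so its coset at level \<open>n\<close> is trivial.\<close>
    moreover have "K n = C n"
    proof -
      obtain j where "i \<le> j" "K n = C n #> g j" using rep by blast
      then show ?thesis using g subgroup.rcos_const[OF C(1) group_axioms] by auto
    qed
    ultimately have "K = C" using n by blast
    obtain j where j: "i \<le> j" "K i = C i #> g j" using rep by blast
    then have "C i #> g j = C i" using \<open>K = C\<close> by simp
    then have "g j \<in> C i" using coset_join1[OF _ _ C(1)] g[OF j(1)] HG by blast
    then show False using g j(1) by blast
  qed
  then show ?thesis unfolding C_def by blast
qed

end

section \<open>The fundamental group and its covering subgroups\<close>

lemma homotopic_paths_const_join:
  fixes p :: "real \<Rightarrow> 'a::topological_space"
  assumes "path p" "path_image p \<subseteq> S" "pathstart p = a"
  shows "homotopic_paths S ((\<lambda>_. a) +++ p) p"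
proof (rule homotopic_paths_sym, rule homotopic_paths_reparametrize[OF assms(1,2)])
  show "continuous_on {0..1} (\<lambda>t::real. max 0 (2 * t - 1))" by (intro continuous_intros)
  show "((\<lambda>_. a) +++ p) t = p (max 0 (2 * t - 1))" if "t \<in> {0..1}" for t
    using assms(3) by (cases "t \<le> 1/2") (simp_all add: joinpaths_def pathstart_def max_absorb1 max_absorb2)
qed auto

lemma homotopic_paths_reversepath_join:
  fixes p :: "real \<Rightarrow> 'a::topological_space"
  assumes "path p" "path_image p \<subseteq> S"
  shows "homotopic_paths S (reversepath p +++ p) (\<lambda>_. pathfinish p)"
proof -
  \<comment> \<open>At stage \<open>a\<close> the path runs from the end of \<open>p\<close> back to
    parameter \<open>a\<close> and returns; the excursion shrinks to the end point at
    \<open>a = 1\<close>.\<close>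
  let ?h = "\<lambda>z. p (1 - (1 - fst z) * (1 - \<bar>2 * snd z - 1\<bar>))"
  have in01: "1 - (1 - a) * (1 - \<bar>2 * t - 1\<bar>) \<in> {0..1}" if "a \<in> {0..1}" "t \<in> {0..1}" for a t :: real
  proof -
    have "0 \<le> 1 - a" "1 - a \<le> 1" "0 \<le> 1 - \<bar>2 * t - 1\<bar>" "1 - \<bar>2 * t - 1\<bar> \<le> 1"
      using that by auto
    then have "0 \<le> (1 - a) * (1 - \<bar>2 * t - 1\<bar>)" "(1 - a) * (1 - \<bar>2 * t - 1\<bar>) \<le> 1"
      by (auto intro: mult_le_one)
    then show ?thesis by simp
  qed
  show ?thesis
    unfolding homotopic_paths
  proof (intro exI conjI ballI)
    show "continuous_on ({0..1} \<times> {0..1}) ?h"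
      by (rule continuous_on_compose2[of "{0..1}" p]) (use assms(1) in01 in \<open>auto simp: path_def intro!: continuous_intros\<close>)
    show "?h \<in> {0..1} \<times> {0..1} \<rightarrow> S" using assms(2) in01 by (auto simp: path_image_def image_subset_iff)
    show "?h (0, t) = (reversepath p +++ p) t" if "t \<in> {0..1}" for t
      by (auto simp: joinpaths_def reversepath_def)
    show "?h (1, t) = pathfinish p" if "t \<in> {0..1}" for t by (simp add: pathfinish_def)
  qed (auto simp: pathstart_def pathfinish_def joinpaths_def reversepath_def)
qed

lemma based_loops_join: "q \<in> based_loops S a \<Longrightarrow> r \<in> based_loops S a \<Longrightarrow> q +++ r \<in> based_loops S a"
  by (auto simp: based_loops_def path_image_join)

lemma based_loops_reverse: "q \<in> based_loops S a \<Longrightarrow> reversepath q \<in> based_loops S a"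
  by (auto simp: based_loops_def path_reversepath)

lemma based_loops_const: "a \<in> S \<Longrightarrow> (\<lambda>_. a) \<in> based_loops S a"
  by (auto simp: based_loops_def path_def path_image_def pathstart_def pathfinish_def)

lemma path_class_eq_iff:
  assumes "q \<in> based_loops S a"
  shows "path_class S q = path_class S r \<longleftrightarrow> homotopic_paths S q r"
proof
  assume eq: "path_class S q = path_class S r"
  have "homotopic_paths S q q" using assms by (simp add: based_loops_def)
  then have "q \<in> path_class S r" using eq by (auto simp: path_class_def)
  then show "homotopic_paths S q r" by (simp add: path_class_def homotopic_paths_sym)
next
  assume "homotopic_paths S q r"
  then show "path_class S q = path_class S r"
    unfolding path_class_def by (blast intro: homotopic_paths_sym homotopic_paths_trans)
qed

lemma path_class_self: "q \<in> based_loops S a \<Longrightarrow> q \<in> path_class S q"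
  by (simp add: path_class_def based_loops_def)

lemma fundamental_group_carrier:
  "A \<in> carrier (fundamental_group S a) \<longleftrightarrow> (\<exists>q\<in>based_loops S a. A = path_class S q)"
  by (auto simp: fundamental_group_def)

text \<open>The union over all representatives in the definition of the product is a union of equal
  sets, because joining respects homotopy.\<close>

lemma fundamental_group_mult:
  assumes q: "q \<in> based_loops S a" and r: "r \<in> based_loops S a"
  shows "path_class S q \<otimes>\<^bsub>fundamental_group S a\<^esub> path_class S r = path_class S (q +++ r)"
proof -
  have "path_class S (q' +++ r') = path_class S (q +++ r)" if "q' \<in> path_class S q" "r' \<in> path_class S r" for q' r'
  proof -
    have "homotopic_paths S (q +++ r) (q' +++ r')"
      using that q r unfolding path_class_def
      by (intro homotopic_paths_join) (auto simp: based_loops_def)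
    then show ?thesis using path_class_eq_iff[OF based_loops_join[OF q r]] by metis
  qed
  then have "(\<Union>q'\<in>path_class S q. \<Union>r'\<in>path_class S r. path_class S (q' +++ r')) = path_class S (q +++ r)"
    using path_class_self[OF q] path_class_self[OF r] by blast
  then show ?thesis by (simp add: fundamental_group_def)
qed

lemma fundamental_group_one: "\<one>\<^bsub>fundamental_group S a\<^esub> = path_class S (\<lambda>_. a)"
  by (simp add: fundamental_group_def)

lemma fundamental_group_left_inverse:
  assumes "q \<in> based_loops S a"
  shows "path_class S (reversepath q) \<otimes>\<^bsub>fundamental_group S a\<^esub> path_class S q = \<one>\<^bsub>fundamental_group S a\<^esub>"
proof -
  have "homotopic_paths S (reversepath q +++ q) (\<lambda>_. a)"
    using homotopic_paths_reversepath_join[of q S] assms by (simp add: based_loops_def)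
  then have "path_class S (reversepath q +++ q) = path_class S (\<lambda>_. a)"
    using path_class_eq_iff[OF based_loops_join[OF based_loops_reverse[OF assms] assms]] by simp
  then show ?thesis
    using fundamental_group_mult[OF based_loops_reverse[OF assms] assms] by (simp add: fundamental_group_one)
qed

lemma group_fundamental_group:
  assumes "a \<in> S"
  shows "group (fundamental_group S a)" (is "group ?G")
proof (rule groupI)
  show "\<one>\<^bsub>?G\<^esub> \<in> carrier ?G"
    using based_loops_const[OF assms] by (auto simp: fundamental_group_carrier fundamental_group_one)
next
  fix A A' assume "A \<in> carrier ?G" "A' \<in> carrier ?G"
  then obtain q r where q: "q \<in> based_loops S a" "A = path_class S q"
    and r: "r \<in> based_loops S a" "A' = path_class S r"
    unfolding fundamental_group_carrier by blast
  show "A \<otimes>\<^bsub>?G\<^esub> A' \<in> carrier ?G"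
    unfolding q(2) r(2) fundamental_group_mult[OF q(1) r(1)] fundamental_group_carrier
    using based_loops_join[OF q(1) r(1)] by blast
next
  fix A A' A'' assume "A \<in> carrier ?G" "A' \<in> carrier ?G" "A'' \<in> carrier ?G"
  then obtain q r s where q: "q \<in> based_loops S a" "A = path_class S q"
    and r: "r \<in> based_loops S a" "A' = path_class S r"
    and s: "s \<in> based_loops S a" "A'' = path_class S s"
    unfolding fundamental_group_carrier by blast
  have "homotopic_paths S (q +++ (r +++ s)) ((q +++ r) +++ s)"
    using q r s by (intro homotopic_paths_assoc) (auto simp: based_loops_def)
  then have "path_class S (q +++ (r +++ s)) = path_class S ((q +++ r) +++ s)"
    using path_class_eq_iff[OF based_loops_join[OF q(1) based_loops_join[OF r(1) s(1)]]] by simp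
  then show "A \<otimes>\<^bsub>?G\<^esub> A' \<otimes>\<^bsub>?G\<^esub> A'' = A \<otimes>\<^bsub>?G\<^esub> (A' \<otimes>\<^bsub>?G\<^esub> A'')"
    unfolding q(2) r(2) s(2)
    by (simp add: fundamental_group_mult based_loops_join q(1) r(1) s(1))
next
  fix A assume "A \<in> carrier ?G"
  then obtain q where q: "q \<in> based_loops S a" "A = path_class S q"
    unfolding fundamental_group_carrier by blast
  have "homotopic_paths S ((\<lambda>_. a) +++ q) q"
    using q by (intro homotopic_paths_const_join) (auto simp: based_loops_def)
  then have "path_class S ((\<lambda>_. a) +++ q) = path_class S q"
    using path_class_eq_iff[OF based_loops_join[OF based_loops_const[OF assms] q(1)]] by simp
  then show "\<one>\<^bsub>?G\<^esub> \<otimes>\<^bsub>?G\<^esub> A = A"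
    using fundamental_group_mult[OF based_loops_const[OF assms] q(1)] by (simp add: fundamental_group_one q(2))
  show "\<exists>A'\<in>carrier ?G. A' \<otimes>\<^bsub>?G\<^esub> A = \<one>\<^bsub>?G\<^esub>"
    using fundamental_group_left_inverse[OF q(1)] based_loops_reverse[OF q(1)]
    unfolding q(2) Bex_def fundamental_group_carrier by blast
qed

lemma fundamental_group_inv:
  assumes "a \<in> S" "q \<in> based_loops S a"
  shows "inv\<^bsub>fundamental_group S a\<^esub> path_class S q = path_class S (reversepath q)"
proof -
  interpret group "fundamental_group S a" by (rule group_fundamental_group[OF assms(1)])
  show ?thesis
    using inv_equality[OF fundamental_group_left_inverse[OF assms(2)]] assms(2) based_loops_reverse[OF assms(2)]
    by (auto simp: fundamental_group_carrier)
qed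

section \<open>Covering subgroups and monodromy on a fibre\<close>

text \<open>Abstracts one member of \<open>group_chain\<close> from the tower, so that each level
  can be treated as a single pointed covering.\<close>

definition covering_group ::
    "'c::topological_space set \<Rightarrow> ('c \<Rightarrow> 'b::topological_space) \<Rightarrow> 'b set \<Rightarrow> 'c \<Rightarrow> (real \<Rightarrow> 'b) set set" where
  "covering_group C p B c = induced_map B p ` carrier (fundamental_group C c)"

locale pointed_covering =
  fixes C :: "'c::topological_space set" and p :: "'c \<Rightarrow> 'b::topological_space" and B c0 x0
  assumes cov: "covering_space C p B" and c0: "c0 \<in> C" "p c0 = x0"
begin

abbreviation "G \<equiv> fundamental_group B x0"
abbreviation "H \<equiv> covering_group C p B c0"

lemma pcont: "continuous_on C p" "p ` C = B"
  using cov by (auto simp: covering_space_def)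

lemma x0_in: "x0 \<in> B"
  using pcont c0 by blast

lemma induced_map_path_class:
  assumes "q \<in> based_loops C c0"
  shows "induced_map B p (path_class C q) = path_class B (p \<circ> q)" "p \<circ> q \<in> based_loops B x0"
proof -
  have "path (p \<circ> q)"
    using assms pcont(1) by (intro path_continuous_image) (auto simp: based_loops_def intro: continuous_on_subset)
  then show pq: "p \<circ> q \<in> based_loops B x0"
    using assms pcont c0 by (auto simp: based_loops_def pathstart_compose pathfinish_compose path_image_compose)
  have "path_class B (p \<circ> q') = path_class B (p \<circ> q)" if "q' \<in> path_class C q" for q'
  proof -
    have "homotopic_paths B (p \<circ> q) (p \<circ> q')"
      using that pcont unfolding path_class_def by (intro homotopic_paths_continuous_image[of C]) auto
    then show ?thesis using path_class_eq_iff[OF pq] by metis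
  qed
  then show "induced_map B p (path_class C q) = path_class B (p \<circ> q)"
    unfolding induced_map_def using path_class_self[OF assms] by blast
qed

lemma covering_group_subset: "H \<subseteq> carrier G"
proof
  fix A assume "A \<in> H"
  then obtain q where "q \<in> based_loops C c0" "A = path_class B (p \<circ> q)"
    using induced_map_path_class(1) unfolding covering_group_def by (auto simp: fundamental_group_carrier)
  then show "A \<in> carrier G" using induced_map_path_class(2) fundamental_group_carrier by blast
qed

text \<open>The dictionary between subgroups and closed lifts. Passing from a class to a chosen loop
  is possible because homotopic paths have lifts with the same ends.\<close>

lemma path_class_in_covering_group:
  assumes g: "g \<in> based_loops B x0"
  shows "path_class B g \<in> H \<longleftrightarrow> path_lift C p g c0 c0"
proof
  assume "path_class B g \<in> H"
  then obtain q where q: "q \<in> based_loops C c0" "path_class B g = path_class B (p \<circ> q)"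
    using induced_map_path_class(1) unfolding covering_group_def by (auto simp: fundamental_group_carrier)
  have "path_lift C p (p \<circ> q) c0 c0"
    using path_lift_self[of q C p] q(1) by (auto simp: based_loops_def)
  moreover have "homotopic_paths B (p \<circ> q) g"
    using q path_class_eq_iff[OF g] homotopic_paths_sym by blast
  ultimately show "path_lift C p g c0 c0" using path_lift_homotopic[OF cov] by blast
next
  assume "path_lift C p g c0 c0"
  then obtain r where r: "path r" "path_image r \<subseteq> C" "pathstart r = c0" "pathfinish r = c0"
    "\<And>t. t \<in> {0..1} \<Longrightarrow> p (r t) = g t"
    by (rule path_liftE) blast
  then have rl: "r \<in> based_loops C c0" by (simp add: based_loops_def)
  have "homotopic_paths B g (p \<circ> r)"
    using g r(5) by (intro homotopic_paths_eq) (auto simp: based_loops_def)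
  then have "path_class B g = induced_map B p (path_class C r)"
    using path_class_eq_iff[OF g] induced_map_path_class(1)[OF rl] by simp
  moreover have "path_class C r \<in> carrier (fundamental_group C c0)"
    using rl fundamental_group_carrier by blast
  ultimately show "path_class B g \<in> H"
    unfolding covering_group_def by blast
qed

lemma subgroup_covering_group: "subgroup H G"
proof -
  interpret group G by (rule group_fundamental_group[OF x0_in])
  have rep: "\<exists>g\<in>based_loops B x0. A = path_class B g \<and> path_lift C p g c0 c0" if "A \<in> H" for A
    using that covering_group_subset path_class_in_covering_group by (fastforce simp: fundamental_group_carrier)
  show ?thesis
  proof (rule subgroupI[OF covering_group_subset])
    have "path_class B (\<lambda>_. x0) \<in> H"
      using path_class_in_covering_group[OF based_loops_const[OF x0_in]] path_lift_const[OF c0(1), of p] c0(2) by simp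
    then show "H \<noteq> {}" by blast
    fix A assume "A \<in> H"
    then obtain g where g: "g \<in> based_loops B x0" "A = path_class B g" "path_lift C p g c0 c0" using rep by blast
    show "inv\<^bsub>G\<^esub> A \<in> H"
      unfolding g(2) fundamental_group_inv[OF x0_in g(1)]
      using path_class_in_covering_group[OF based_loops_reverse[OF g(1)]] path_lift_reverse[OF g(3)] by blast
    fix A' assume "A' \<in> H"
    then obtain g' where g': "g' \<in> based_loops B x0" "A' = path_class B g'" "path_lift C p g' c0 c0" using rep by blast
    show "A \<otimes>\<^bsub>G\<^esub> A' \<in> H"
      unfolding g(2) g'(2) fundamental_group_mult[OF g(1) g'(1)]
      using path_class_in_covering_group[OF based_loops_join[OF g(1) g'(1)]] path_lift_join[OF g(3) g'(3)] by blast
  qed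
qed

text \<open>Conjugating \<open>g\<close> by a loop \<open>h\<close> amounts to lifting
  \<open>g\<close> from the end of the lift of the reversed \<open>h\<close> instead of from
  \<open>c0\<close>. As \<open>C\<close> is path-connected, every point of the fibre is such an
  end.\<close>

lemma path_class_in_normal_core:
  assumes C: "path_connected C" and g: "g \<in> based_loops B x0"
  shows "path_class B g \<in> normal_core G H \<longleftrightarrow> (\<forall>c\<in>C. p c = x0 \<longrightarrow> path_lift C p g c c)"
proof -
  interpret group G by (rule group_fundamental_group[OF x0_in])
  have conj: "inv\<^bsub>G\<^esub> path_class B h \<otimes>\<^bsub>G\<^esub> path_class B g \<otimes>\<^bsub>G\<^esub> path_class B h =
      path_class B ((reversepath h +++ g) +++ h)" if h: "h \<in> based_loops B x0" for h
    using h g by (simp add: fundamental_group_inv[OF x0_in] fundamental_group_mult based_loops_reverse based_loops_join)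
  have core: "path_class B g \<in> normal_core G H \<longleftrightarrow>
      (\<forall>h\<in>based_loops B x0. path_lift C p ((reversepath h +++ g) +++ h) c0 c0)"
    unfolding normal_core_iff[OF covering_group_subset]
    using conj path_class_in_covering_group g
    by (auto simp: fundamental_group_carrier Ball_def based_loops_join based_loops_reverse)
  have gB: "path g" "path_image g \<subseteq> B" "pathstart g = x0" "pathfinish g = x0"
    using g by (auto simp: based_loops_def)
  show ?thesis
  proof
    assume L: "path_class B g \<in> normal_core G H"
    show "\<forall>c\<in>C. p c = x0 \<longrightarrow> path_lift C p g c c"
    proof (intro ballI impI)
      fix c assume c: "c \<in> C" "p c = x0"
      obtain r where r: "path r" "path_image r \<subseteq> C" "pathstart r = c" "pathfinish r = c0"
        using C c c0 unfolding path_connected_def by blast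
      let ?h = "p \<circ> r"
      have h: "path_lift C p ?h c c0" using path_lift_self[OF r(1,2)] r by simp
      note hB = path_lift_path[OF h pcont(1) equalityD1[OF pcont(2)]]
      have hl: "?h \<in> based_loops B x0" using hB r c c0 by (simp add: based_loops_def pathstart_def pathfinish_def)
      then have hB': "pathstart ?h = x0" "pathfinish ?h = x0" by (auto simp: based_loops_def)
      have "path_lift C p ((reversepath ?h +++ g) +++ ?h) c0 c0" using L core hl by blast
      then obtain d where d: "path_lift C p (reversepath ?h +++ g) c0 d" "path_lift C p ?h d c0"
        by (rule path_lift_joinE[OF cov]) (use hB hB' gB in \<open>auto simp: path_image_join\<close>)
      from d(1) obtain e where e: "path_lift C p (reversepath ?h) c0 e" "path_lift C p g e d"
        by (rule path_lift_joinE[OF cov]) (use hB hB' gB in auto)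
      have "e = c" using path_lift_unique[OF cov e(1) path_lift_reverse[OF h]] .
      moreover have "d = c"
        using path_lift_unique[OF cov path_lift_reverse[OF d(2)] path_lift_reverse[OF h]] .
      ultimately show "path_lift C p g c c" using e(2) by simp
    qed
  next
    assume R: "\<forall>c\<in>C. p c = x0 \<longrightarrow> path_lift C p g c c"
    have "path_lift C p ((reversepath h +++ g) +++ h) c0 c0" if h: "h \<in> based_loops B x0" for h
    proof -
      have hB: "path h" "path_image h \<subseteq> B" "pathstart h = x0" "pathfinish h = x0"
        using h by (auto simp: based_loops_def)
      obtain c where c: "path_lift C p (reversepath h) c0 c"
        using path_lift_exists[OF cov, of "reversepath h" c0] hB c0 by (auto simp: path_reversepath)
      then have "c \<in> C" "p c = x0" using path_lift_endpoints[OF c] hB by auto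
      then have "path_lift C p g c c" using R by blast
      then show ?thesis
        using path_lift_join[OF path_lift_join[OF c]] path_lift_reverse[OF c] by simp
    qed
    then show "path_class B g \<in> normal_core G H" using core by blast
  qed
qed

text \<open>The coset of a class is determined by its monodromy on the fibre: if two loops move all
  fibre points alike, the first followed by the reverse of the second fixes each of them. A finite
  fibre has only finitely many self-maps.\<close>

lemma finite_cosets_normal_core:
  assumes C: "path_connected C" and fin: "finite {c \<in> C. p c = x0}"
  shows "finite ((\<lambda>A. normal_core G H #>\<^bsub>G\<^esub> A) ` carrier G)"
proof -
  interpret group G by (rule group_fundamental_group[OF x0_in])
  define F where "F = {c \<in> C. p c = x0}"
  define rep where "rep A = (SOME g. g \<in> based_loops B x0 \<and> A = path_class B g)" for A
  have rep: "rep A \<in> based_loops B x0 \<and> A = path_class B (rep A)" if "A \<in> carrier G" for A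
  proof -
    have "\<exists>g. g \<in> based_loops B x0 \<and> A = path_class B g" using that fundamental_group_carrier by blast
    then show ?thesis unfolding rep_def by (rule someI_ex)
  qed
  define act where "act A = (\<lambda>c\<in>F. SOME e. path_lift C p (rep A) c e)" for A
  have act: "path_lift C p (rep A) c (act A c)" if A: "A \<in> carrier G" and c: "c \<in> F" for A c
  proof -
    have "path (rep A)" "path_image (rep A) \<subseteq> B" "c \<in> C" "p c = pathstart (rep A)"
      using rep[OF A] c by (auto simp: F_def based_loops_def)
    then have "\<exists>e. path_lift C p (rep A) c e" using path_lift_exists[OF cov] by blast
    then show ?thesis using c by (simp add: act_def someI_ex)
  qed
  have N: "subgroup (normal_core G H) G" by (rule subgroup_normal_core[OF subgroup_covering_group])
  have "act ` carrier G \<subseteq> PiE F (\<lambda>_. F)"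
  proof
    fix f assume "f \<in> act ` carrier G"
    then obtain A where A: "A \<in> carrier G" "f = act A" by blast
    have "act A c \<in> F" if "c \<in> F" for c
      using path_lift_endpoints[OF act[OF A(1) that]] rep[OF A(1)] by (auto simp: F_def based_loops_def)
    then show "f \<in> PiE F (\<lambda>_. F)" using A(2) by (auto simp: act_def)
  qed
  moreover have "finite (PiE F (\<lambda>_. F))" using fin by (intro finite_PiE) (auto simp: F_def)
  ultimately have fin_act: "finite (act ` carrier G)" by (rule finite_subset)
  have coset_eq: "normal_core G H #>\<^bsub>G\<^esub> A = normal_core G H #>\<^bsub>G\<^esub> A'"
    if A: "A \<in> carrier G" "A' \<in> carrier G" "act A = act A'" for A A'
  proof -
    let ?g = "rep A" and ?g' = "rep A'"
    have "path_lift C p (?g +++ reversepath ?g') c c" if c: "c \<in> C" "p c = x0" for c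
    proof -
      have "c \<in> F" using c by (simp add: F_def)
      then show ?thesis
        using path_lift_join[OF act[OF A(1)] path_lift_reverse] act[OF A(2)] A(3) by simp
    qed
    then have "path_class B (?g +++ reversepath ?g') \<in> normal_core G H"
      using path_class_in_normal_core[OF C based_loops_join[OF _ based_loops_reverse]] rep[OF A(1)] rep[OF A(2)]
      by blast
    moreover have "A \<otimes>\<^bsub>G\<^esub> inv\<^bsub>G\<^esub> A' = path_class B (?g +++ reversepath ?g')"
      using rep[OF A(1)] rep[OF A(2)] fundamental_group_inv[OF x0_in] fundamental_group_mult based_loops_reverse
      by metis
    ultimately have d: "A \<otimes>\<^bsub>G\<^esub> inv\<^bsub>G\<^esub> A' \<in> normal_core G H" by simp
    have "normal_core G H #>\<^bsub>G\<^esub> (A \<otimes>\<^bsub>G\<^esub> inv\<^bsub>G\<^esub> A') = normal_core G H"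
      by (rule coset_join2[OF subgroup.mem_carrier[OF N d] N d])
    then show ?thesis by (rule coset_mult_inv1[OF _ A(1,2) subgroup.subset[OF N]])
  qed
  \<comment> \<open>The coset factors through \<open>act\<close>, so there are at most as many
    cosets as values of \<open>act\<close>.\<close>
  have "(\<lambda>A. normal_core G H #>\<^bsub>G\<^esub> A) ` carrier G \<subseteq>
      (\<lambda>f. normal_core G H #>\<^bsub>G\<^esub> inv_into (carrier G) act f) ` act ` carrier G"
  proof
    fix K assume "K \<in> (\<lambda>A. normal_core G H #>\<^bsub>G\<^esub> A) ` carrier G"
    then obtain A where A: "A \<in> carrier G" "K = normal_core G H #>\<^bsub>G\<^esub> A" by blast
    have actA: "act A \<in> act ` carrier G" using A(1) by blast
    have "K = normal_core G H #>\<^bsub>G\<^esub> inv_into (carrier G) act (act A)"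
      unfolding A(2) by (rule coset_eq[OF A(1) inv_into_into[OF actA] f_inv_into_f[OF actA, symmetric]])
    then show "K \<in> (\<lambda>f. normal_core G H #>\<^bsub>G\<^esub> inv_into (carrier G) act f) ` act ` carrier G"
      using actA by (rule image_eqI)
  qed
  then show ?thesis using fin_act finite_subset by blast
qed

end

section \<open>Homogeneity of a pullback solenoid\<close>

text \<open>The discriminant controls only loops at \<open>x0\<close>, while \<open>regular\<close>
  concerns loops based anywhere. A path \<open>h\<close> from \<open>x0\<close> to the start of
  \<open>g\<close> transfers the conclusion from the conjugated loop back to
  \<open>g\<close>.\<close>

lemma path_lift_conjugate:
  assumes cov: "covering_space C p B"
    and h: "path h" "path_image h \<subseteq> B" and g: "path g" "path_image g \<subseteq> B"
    and hg: "pathfinish h = pathstart g" "pathfinish g = pathstart g"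
    and closed: "\<And>c. c \<in> C \<Longrightarrow> p c = pathstart h \<Longrightarrow> path_lift C p (h +++ (g +++ reversepath h)) c c"
    and e: "path_lift C p g e e'"
  shows "e' = e"
proof -
  have "e \<in> C" "p e = pathstart (reversepath h)" using path_lift_endpoints[OF e] hg by auto
  then obtain c where c: "path_lift C p (reversepath h) e c"
    using path_lift_exists[OF cov, of "reversepath h" e] h by (auto simp: path_reversepath)
  then have hc: "path_lift C p h c e" using path_lift_reverse[OF c] by simp
  have "path_lift C p (h +++ (g +++ reversepath h)) c c"
    using closed path_lift_endpoints[OF hc] by blast
  then obtain e1 where e1: "path_lift C p h c e1" "path_lift C p (g +++ reversepath h) e1 c"
    by (rule path_lift_joinE[OF cov]) (use h g hg in \<open>auto simp: path_image_join\<close>)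
  from e1(2) obtain e2 where e2: "path_lift C p g e1 e2" "path_lift C p (reversepath h) e2 c"
    by (rule path_lift_joinE[OF cov]) (use h g hg in auto)
  have "e1 = e" using path_lift_unique[OF cov e1(1) hc] .
  then have "e2 = e'" using path_lift_unique[OF cov e] e2(1) by blast
  moreover have "e2 = e" using path_lift_unique[OF cov hc] path_lift_reverse[OF e2(2)] by simp
  ultimately show ?thesis by simp
qed

lemma finite_covering_tower_proj:
  assumes "solenoid_tower M p"
  shows "finite_covering (M i) (tower_proj p i) (M 0)"
proof (induction i)
  case 0
  have "covering_space (M 0) id (M 0)"
    by (rule homeomorphism_imp_covering_space[of _ _ _ id]) (simp add: homeomorphism_def)
  moreover have "finite {z \<in> M 0. id z = y}" for y
    by (rule finite_subset[of _ "{y}"]) auto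
  ultimately show ?case unfolding tower_proj.simps finite_covering_def by blast
next
  case (Suc i)
  have "finite_covering (M (Suc i)) (p i) (M i)" using assms by (simp add: solenoid_tower_def)
  then show ?case unfolding tower_proj.simps using Suc by (rule finite_covering_compose)
qed

text \<open>The inclusion of \<open>finite_discriminant_stable\<close> in terms of lifts: the two
  premises say that the class of \<open>g\<close> is in \<open>G j\<close> and in
  \<open>C n\<close>, the conclusion that it is in \<open>C i\<close>.\<close>

lemma finite_discriminant_lifts:
  assumes tower: "solenoid_tower M p" and x: "x \<in> solenoid_fiber M p x0"
    and fin: "finite (carrier (discriminant_group (fundamental_group (M 0) x0) (group_chain M p x)))"
  obtains n where "\<And>i. \<exists>j\<ge>i. \<forall>g\<in>based_loops (M 0) x0.
      path_lift (M j) (tower_proj p j) g (x j) (x j) \<longrightarrow>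
      (\<forall>c\<in>M n. tower_proj p n c = x0 \<longrightarrow> path_lift (M n) (tower_proj p n) g c c) \<longrightarrow>
      (\<forall>c\<in>M i. tower_proj p i c = x0 \<longrightarrow> path_lift (M i) (tower_proj p i) g c c)"
proof -
  let ?\<pi> = "tower_proj p" and ?G = "fundamental_group (M 0) x0" and ?H = "group_chain M p x"
  have B: "closed_connected_manifold (M 0)" and cov1: "\<And>i. finite_covering (M (Suc i)) (p i) (M i)"
    and con: "\<And>i. connected (M i)"
  proof -
    show "closed_connected_manifold (M 0)" "\<And>i. finite_covering (M (Suc i)) (p i) (M i)"
      using tower by (auto simp: solenoid_tower_def)
    show "connected (M i)" for i
      using tower by (cases i) (auto simp: solenoid_tower_def closed_connected_manifold_def)
  qed
  have fcov: "finite_covering (M i) (?\<pi> i) (M 0)" for i by (rule finite_covering_tower_proj[OF tower])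
  have cov: "covering_space (M i) (?\<pi> i) (M 0)" for i using fcov by (simp add: finite_covering_def)
  have pcon: "path_connected (M i)" for i
    using connected_locally_path_connected[OF con] covering_space_locally_path_connected_top[OF cov]
      closed_connected_manifold_locally_path_connected[OF B] by blast
  have xM: "x i \<in> M i" "p i (x (Suc i)) = x i" for i
    using x by (auto simp: solenoid_fiber_def inverse_limit_def)
  have x\<pi>: "?\<pi> i (x i) = x0" for i
  proof (induction i)
    case 0
    then show ?case using x by (simp add: solenoid_fiber_def)
  next
    case (Suc i)
    then show ?case using xM(2) by simp
  qed
  have pc: "pointed_covering (M i) (?\<pi> i) (M 0) (x i) x0" for i
    using cov xM(1) x\<pi> by unfold_locales
  have H: "?H i = covering_group (M i) (?\<pi> i) (M 0) (x i)" for i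
    by (simp add: group_chain_def covering_group_def)
  have x0: "x0 \<in> M 0" using xM(1)[of 0] x\<pi>[of 0] by simp
  interpret group ?G by (rule group_fundamental_group[OF x0])
  have HG: "?H i \<subseteq> carrier ?G" for i unfolding H by (rule pointed_covering.covering_group_subset[OF pc])
  have "\<exists>n. \<forall>i. \<exists>j\<ge>i. ?H j \<inter> normal_core ?G (?H n) \<subseteq> normal_core ?G (?H i)"
  proof (rule finite_discriminant_stable[OF _ _ _ fin])
    show "subgroup (?H i) ?G" for i unfolding H by (rule pointed_covering.subgroup_covering_group[OF pc])
    show "?H (Suc i) \<subseteq> ?H i" for i
    proof
      fix A assume A: "A \<in> ?H (Suc i)"
      then obtain g where g: "g \<in> based_loops (M 0) x0" "A = path_class (M 0) g"
        using HG fundamental_group_carrier by blast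
      have "path_lift (M (Suc i)) (?\<pi> (Suc i)) g (x (Suc i)) (x (Suc i))"
        using A g pointed_covering.path_class_in_covering_group[OF pc g(1)] unfolding H by blast
      then have "path_lift (M i) (?\<pi> i) g (p i (x (Suc i))) (p i (x (Suc i)))"
        by (rule path_lift_map) (use cov1[of i] in \<open>auto simp: finite_covering_def covering_space_def\<close>)
      then have "path_lift (M i) (?\<pi> i) g (x i) (x i)" by (simp add: xM(2))
      then show "A \<in> ?H i"
        using pointed_covering.path_class_in_covering_group[OF pc g(1)] g(2) unfolding H by blast
    qed
    show "finite ((\<lambda>g. normal_core ?G (?H i) #>\<^bsub>?G\<^esub> g) ` ?H i)" for i
    proof (rule finite_subset[OF image_mono[OF HG]])
      show "finite ((\<lambda>g. normal_core ?G (?H i) #>\<^bsub>?G\<^esub> g) ` carrier ?G)"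
        unfolding H using fcov x0
        by (intro pointed_covering.finite_cosets_normal_core[OF pc pcon]) (auto simp: finite_covering_def)
    qed
  qed
  then obtain n where n: "\<And>i. \<exists>j\<ge>i. ?H j \<inter> normal_core ?G (?H n) \<subseteq> normal_core ?G (?H i)" by blast
  note core = pointed_covering.path_class_in_normal_core[OF pc pcon, folded H]
    and grp = pointed_covering.path_class_in_covering_group[OF pc, folded H]
  show ?thesis
  proof (rule that)
    fix i
    obtain j where j: "j \<ge> i" "?H j \<inter> normal_core ?G (?H n) \<subseteq> normal_core ?G (?H i)" using n by blast
    show "\<exists>j\<ge>i. \<forall>g\<in>based_loops (M 0) x0. path_lift (M j) (?\<pi> j) g (x j) (x j) \<longrightarrow>
      (\<forall>c\<in>M n. ?\<pi> n c = x0 \<longrightarrow> path_lift (M n) (?\<pi> n) g c c) \<longrightarrow>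
      (\<forall>c\<in>M i. ?\<pi> i c = x0 \<longrightarrow> path_lift (M i) (?\<pi> i) g c c)"
    proof (intro exI conjI ballI[of "based_loops (M 0) x0"] impI)
      show "j \<ge> i" by (rule j(1))
      fix g assume g: "g \<in> based_loops (M 0) x0" "path_lift (M j) (?\<pi> j) g (x j) (x j)"
        "\<forall>c\<in>M n. ?\<pi> n c = x0 \<longrightarrow> path_lift (M n) (?\<pi> n) g c c"
      have "path_class (M 0) g \<in> normal_core ?G (?H i)"
        using grp[OF g(1)] core[OF g(1)] g(2,3) j(2) by blast
      then show "\<forall>c\<in>M i. ?\<pi> i c = x0 \<longrightarrow> path_lift (M i) (?\<pi> i) g c c"
        using core[OF g(1)] by blast
    qed
  qed
qed

theorem corollary1p14:
  fixes M :: "nat \<Rightarrow> 'a::topological_space set"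
    and p :: "nat \<Rightarrow> 'a \<Rightarrow> 'a"
    and x0 :: 'a
    and x :: "nat \<Rightarrow> 'a"
  assumes "solenoid_tower M p"
    and "x0 \<in> M 0"
    and "x \<in> solenoid_fiber M p x0"
    and "finite (carrier (discriminant_group (fundamental_group (M 0) x0) (group_chain M p x)))"
  shows "\<exists>(M0' :: (nat \<Rightarrow> 'a) set) p0 x0'.
           connected M0' \<and> finite_covering M0' p0 (M 0) \<and> x0' \<in> M0' \<and> p0 x0' = x0 \<and>
           homogeneous_space (pullback_solenoid M p x M0' p0 x0')"
proof -
  define \<pi> where "\<pi> = tower_proj p"
  obtain n where n: "\<And>i. \<exists>j\<ge>i. \<forall>g\<in>based_loops (M 0) x0.
      path_lift (M j) (\<pi> j) g (x j) (x j) \<longrightarrow>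
      (\<forall>c\<in>M n. \<pi> n c = x0 \<longrightarrow> path_lift (M n) (\<pi> n) g c c) \<longrightarrow>
      (\<forall>c\<in>M i. \<pi> i c = x0 \<longrightarrow> path_lift (M i) (\<pi> i) g c c)"
    unfolding \<pi>_def using finite_discriminant_lifts[OF assms(1,3,4)] by blast
  have B: "closed_connected_manifold (M 0)" and cov1: "\<And>i. finite_covering (M (Suc i)) (p i) (M i)"
    using assms(1) by (auto simp: solenoid_tower_def)
  have Bcon: "connected (M 0)" "locally path_connected (M 0)"
    using B closed_connected_manifold_locally_path_connected by (auto simp: closed_connected_manifold_def)
  have fcov: "finite_covering (M i) (\<pi> i) (M 0)" for i
    unfolding \<pi>_def by (rule finite_covering_tower_proj[OF assms(1)])
  have cov: "covering_space (M i) (\<pi> i) (M 0)" for i using fcov by (simp add: finite_covering_def)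
  have xM: "x i \<in> M i" "p i (x (Suc i)) = x i" "x 0 = x0" for i
    using assms(3) by (auto simp: solenoid_fiber_def inverse_limit_def)
  have \<pi>Suc: "\<pi> (Suc i) y = \<pi> i (p i y)" for i y by (simp add: \<pi>_def)
  have x\<pi>: "\<pi> i (x i) = x0" for i
  proof (induction i)
    case 0
    then show ?case by (simp add: \<pi>_def xM(3))
  qed (simp add: \<pi>Suc xM(2))

  define F where "F = {c \<in> M n. \<pi> n c = x0}"
  have "finite F" using fcov[of n] assms(2) by (simp add: F_def finite_covering_def)
  define d where "d = card F"
  obtain f where f: "bij_betw f {0..<d} F" using ex_bij_betw_nat_finite[OF \<open>finite F\<close>] d_def by auto
  have "x n \<in> F" using xM(1) x\<pi> by (simp add: F_def)
  then have d: "d > 0" using \<open>finite F\<close> by (auto simp: d_def card_gt_0_iff)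
  have fF: "f k \<in> F" if "k < d" for k using f that by (auto simp: bij_betw_def)
  \<comment> \<open>\<open>N\<close> is the Galois closure of \<open>M n\<close>: a loop lifts to a closed path in it iff all its lifts to \<open>M n\<close>
    are closed.\<close>
  define E where "E = fibre_power (M n) (\<pi> n) d"
  define p0 where "p0 = (\<lambda>s :: nat \<Rightarrow> 'a. \<pi> n (s 0))"
  \<comment> \<open>The base tuple lists every point of the fibre of \<open>M n\<close> over
    \<open>x0\<close>, so a loop that fixes \<open>y\<close> fixes that whole fibre.\<close>
  define y where "y = (\<lambda>k. if k < d then f k else undefined)"
  define N where "N = connected_component_set E y"
  have ED: "s k \<in> M n" "\<pi> n (s k) = p0 s" if "s \<in> E" "k < d" for s k
    using that unfolding E_def p0_def fibre_power_def by blast+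
  have EU: "s k = undefined" if "s \<in> E" "\<not> k < d" for s k
    using that by (simp add: E_def fibre_power_def)
  have fy: "f k \<in> M n" "\<pi> n (f k) = x0" if "k < d" for k using fF[OF that] by (auto simp: F_def)
  have yE: "y \<in> E" using fy d by (simp add: E_def fibre_power_def y_def)
  have NE: "N \<subseteq> E" unfolding N_def by (rule connected_component_subset)
  have yN: "y \<in> N" using yE by (simp add: N_def)
  have p0y: "p0 y = x0" using fy d by (simp add: p0_def y_def)
  have covE: "finite_covering E p0 (M 0)"
    unfolding E_def p0_def by (rule finite_covering_fibre_power[OF fcov d])
  have covN: "covering_space N p0 (M 0)"
    unfolding N_def using covE yE by (intro covering_space_component Bcon) (auto simp: finite_covering_def)
  have "finite {s \<in> N. p0 s = z}" if "z \<in> M 0" for z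
  proof (rule finite_subset)
    show "{s \<in> N. p0 s = z} \<subseteq> {s \<in> E. p0 s = z}" using NE by blast
    show "finite {s \<in> E. p0 s = z}" using covE that by (simp add: finite_covering_def)
  qed
  with covN have fcovN: "finite_covering N p0 (M 0)" by (simp add: finite_covering_def)
  have conN: "connected N" unfolding N_def by (rule connected_connected_component)

  \<comment> \<open>The whole fibre product; the pullback level \<open>P i\<close> is its component
    through \<open>(x i, y)\<close>.\<close>
  define Q where "Q i = {(a, z). a \<in> M i \<and> z \<in> N \<and> \<pi> i a = p0 z}" for i
  define P where "P = pullback_space M p x N p0 y"
  have P: "P i = connected_component_set (Q i) (x i, y)" for i
    by (simp add: P_def pullback_space_def Q_def \<pi>_def)
  have base: "(x i, y) \<in> Q i" for i using xM(1) x\<pi> yN p0y by (simp add: Q_def)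
  have PQ: "P i \<subseteq> Q i" for i unfolding P by (rule connected_component_subset)
  have baseP: "(x i, y) \<in> P i" for i using base by (simp add: P)
  have PD: "fst w \<in> M i" "snd w \<in> N" "\<pi> i (fst w) = p0 (snd w)" if "w \<in> P i" for w i
    using PQ[of i] that by (auto simp: Q_def)
  have conP: "connected (P i)" for i unfolding P by (rule connected_connected_component)
  have covP: "covering_space (P i) (\<pi> i \<circ> fst) (M 0)" for i
    unfolding P using covering_space_fibre_product[OF cov covN] base
    by (intro covering_space_component Bcon) (auto simp: Q_def)
  have pconP: "path_connected (P i)" for i
    using connected_locally_path_connected[OF conP] covering_space_locally_path_connected_top[OF covP Bcon(2)] .
  have bond: "pullback_bond p i w = (p i (fst w), snd w)" for i w
    by (simp add: pullback_bond_def case_prod_beta)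
  have p_cont: "continuous_on (M (Suc i)) (p i)" "p i ` M (Suc i) = M i" for i
    using cov1[of i] by (auto simp: finite_covering_def covering_space_def)
  have bond_cont: "continuous_on (P (Suc i)) (pullback_bond p i)" for i
    unfolding bond
    by (intro continuous_intros continuous_on_compose2[OF p_cont(1)]) (use PD(1) in auto)
  \<comment> \<open>The image of a component is connected and contains the next base point, so it
    stays in the component there.\<close>
  have bond_P: "pullback_bond p i ` P (Suc i) \<subseteq> P i" for i
    unfolding P[of i]
  proof (rule connected_component_maximal)
    have "pullback_bond p i (x (Suc i), y) = (x i, y)" by (simp add: bond xM(2))
    then show "(x i, y) \<in> pullback_bond p i ` P (Suc i)" using baseP[of "Suc i"] by (metis imageI)
    show "connected (pullback_bond p i ` P (Suc i))"
      by (rule connected_continuous_image[OF bond_cont conP])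
    show "pullback_bond p i ` P (Suc i) \<subseteq> Q i"
    proof
      fix w assume "w \<in> pullback_bond p i ` P (Suc i)"
      then obtain v where "v \<in> P (Suc i)" "w = (p i (fst v), snd v)" by (auto simp: bond)
      then show "w \<in> Q i" using PD[of v "Suc i"] p_cont(2)[of i] by (auto simp: Q_def \<pi>Suc)
    qed
  qed

  have lift_fst: "path_lift (M i) (\<pi> i) g (fst v) (fst w)"
    if "path_lift (P i) (\<pi> i \<circ> fst) g v w" for i g v w
    by (rule path_lift_map[OF that]) (use PD in \<open>auto intro!: continuous_intros\<close>)
  \<comment> \<open>Each of the \<open>d\<close> coordinates of the \<open>N\<close> part is a map
    to \<open>M n\<close> over \<open>M 0\<close>, so it carries lifts to lifts.\<close>
  have lift_coord: "path_lift (M n) (\<pi> n) g (snd v k) (snd w k)"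
    if "path_lift (P i) (\<pi> i \<circ> fst) g v w" "k < d" for i g v w k
  proof (rule path_lift_map[OF that(1)])
    show "continuous_on (P i) (\<lambda>w. snd w k)"
      by (rule continuous_on_product_then_coordinatewise) (intro continuous_intros)
    show "(\<lambda>w. snd w k) ` P i \<subseteq> M n" using PD(2) NE ED(1) \<open>k < d\<close> by blast
    show "\<pi> n (snd w k) = (\<pi> i \<circ> fst) w" if "w \<in> P i" for w
      using PD[OF that] NE ED(2) \<open>k < d\<close> by (metis comp_apply subsetD)
  qed

  interpret tower: regular_covering_tower P "\<lambda>i. \<pi> i \<circ> fst" "pullback_bond p" "M 0"
  proof unfold_locales
    fix i
    obtain j where j: "j \<ge> i" "\<And>g. g \<in> based_loops (M 0) x0 \<Longrightarrow> path_lift (M j) (\<pi> j) g (x j) (x j) \<Longrightarrow>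
      (\<forall>c\<in>M n. \<pi> n c = x0 \<longrightarrow> path_lift (M n) (\<pi> n) g c c) \<Longrightarrow>
      (\<forall>c\<in>M i. \<pi> i c = x0 \<longrightarrow> path_lift (M i) (\<pi> i) g c c)"
      using n by metis
    have "w'' = w'" if g: "path_lift (P j) (\<pi> j \<circ> fst) g w w"
      and w': "path_lift (P i) (\<pi> i \<circ> fst) g w' w''" for g w w' w''
    proof -
      have "w \<in> P j" using path_lift_endpoints(2)[OF g] .
      then obtain r where r: "path r" "path_image r \<subseteq> P j" "pathstart r = (x j, y)" "pathfinish r = w"
        using pconP[of j] baseP[of j] unfolding path_connected_def by blast
      \<comment> \<open>The image of a path from the base point of \<open>P j\<close> to
        \<open>w\<close>. Conjugating by it turns \<open>g\<close> into a loop \<open>l\<close> at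
        \<open>x0\<close> that lifts to a closed path at the base point of level
        \<open>j\<close>.\<close>
      define h where "h = \<pi> j \<circ> fst \<circ> r"
      have h: "path_lift (P j) (\<pi> j \<circ> fst) h (x j, y) w"
        unfolding h_def using path_lift_self[OF r(1,2)] r(3,4) by metis
      define l where "l = h +++ (g +++ reversepath h)"
      have l: "path_lift (P j) (\<pi> j \<circ> fst) l (x j, y) (x j, y)"
        unfolding l_def by (rule path_lift_join[OF h path_lift_join[OF g path_lift_reverse[OF h]]])
      have Pc: "continuous_on (P j) (\<pi> j \<circ> fst)" "(\<pi> j \<circ> fst) ` P j \<subseteq> M 0"
        using covP[of j] by (auto simp: covering_space_def)
      have lb: "l \<in> based_loops (M 0) x0"
        using path_lift_path[OF l Pc] path_lift_endpoints[OF l] x\<pi> by (simp add: based_loops_def)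
      \<comment> \<open>A closed lift at \<open>y\<close> gives closed lifts at all its coordinates,
        that is, at the whole fibre.\<close>
      have ln: "\<forall>c\<in>M n. \<pi> n c = x0 \<longrightarrow> path_lift (M n) (\<pi> n) l c c"
      proof (intro ballI impI)
        fix c assume "c \<in> M n" "\<pi> n c = x0"
        then have "c \<in> f ` {0..<d}" using f by (simp add: F_def bij_betw_def)
        then obtain k where "k < d" "c = f k" by auto
        then show "path_lift (M n) (\<pi> n) l c c" using lift_coord[OF l \<open>k < d\<close>] by (simp add: y_def)
      qed
      have li: "\<forall>c\<in>M i. \<pi> i c = x0 \<longrightarrow> path_lift (M i) (\<pi> i) l c c"
        using j(2)[OF lb] lift_fst[OF l] ln by simp
      note hp = path_lift_path[OF h Pc] and gp = path_lift_path[OF g Pc]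
      have ends: "pathstart h = x0" "pathfinish h = pathstart g" "pathfinish g = pathstart g"
        using path_lift_endpoints[OF h] path_lift_endpoints[OF g] x\<pi> by auto
      \<comment> \<open>The loop \<open>l\<close> has only closed lifts to \<open>M i\<close> and to
        \<open>M n\<close>; conjugating back, so does \<open>g\<close>. The former handles the first
        component, the latter the coordinates of the second.\<close>
      have "fst w'' = fst w'"
        using path_lift_conjugate[OF cov hp gp ends(2,3) _ lift_fst[OF w']] li ends(1) by (simp add: l_def)
      moreover have "snd w'' k = snd w' k" for k
      proof (cases "k < d")
        case True
        then show ?thesis
          using path_lift_conjugate[OF cov hp gp ends(2,3) _ lift_coord[OF w' True]] ln ends(1)
          by (simp add: l_def)
      next
        case False
        \<comment> \<open>Beyond \<open>d\<close> both tuples have the default value.\<close>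
        have "snd w'' \<in> E" "snd w' \<in> E" using path_lift_endpoints(1,2)[OF w'] PD(2) NE by blast+
        then show ?thesis using EU False by metis
      qed
      ultimately show ?thesis by (simp add: prod_eq_iff fun_eq_iff)
    qed
    then show "\<exists>j\<ge>i. \<forall>g w. path_lift (P j) (\<pi> j \<circ> fst) g w w \<longrightarrow>
        (\<forall>w' w''. path_lift (P i) (\<pi> i \<circ> fst) g w' w'' \<longrightarrow> w'' = w')"
      using j(1) by blast
    show "(\<pi> i \<circ> fst) (pullback_bond p i w) = (\<pi> (Suc i) \<circ> fst) w" if "w \<in> P (Suc i)" for w
      by (simp add: bond \<pi>Suc)
    show "pullback_bond p i w \<in> P i" if "w \<in> P (Suc i)" for w using bond_P that by blast
  qed (use B covP conP bond_cont in auto)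
  have "homogeneous_space (pullback_solenoid M p x N p0 y)"
    using tower.homogeneous_inverse_limit by (simp add: pullback_solenoid_def P_def)
  then show ?thesis using conN fcovN yN p0y by blast
qed

end
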